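(* Let $n\ge3$, let $\Omega\subset\mathbb{R}^n$ be a bounded domain satisfying the capacity density condition with constants $(C_0,R)$, and let $L=-\operatorname{div}(A\nabla)$ with $A$ a real bounded measurable uniformly elliptic matrix on $\Omega$ with ellipticity constant $\lambda$. Then there is a constant $\beta=\beta(C_0,n,\lambda)\in(0,1]$ such that for every $Q_0\in\partial\Omega$ and every $0<\rho\le\min\{\operatorname{diam}(\Omega)/4,\,3R/4\}$, if $u\in W^{1,2}(B_{3\rho}(Q_0)\cap\Omega)\cap C(\overline{B_{3\rho}(Q_0)\cap\Omega})$ satisfies $Lu=0$ on $B_{3\rho}(Q_0)\cap\Omega$ and $u=0$ on $B_{3\rho}(Q_0)\cap\partial\Omega$, then $$|u(X)|\le 2\left(\frac{|X-Q_0|}{\rho}\right)^{\beta}\sup_{\overline{B(Q_0,3\rho)\cap\Omega}}|u|\qquad\text{for every }X\in B_\rho(Q_0)\cap\Omega .$$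
   Context: Uniform ellipticity with constant $\lambda>0$: $\lambda^{-1}|\xi|^2\le\langle A(X)\xi,\xi\rangle\le\lambda|\xi|^2$ for all $\xi\in\mathbb{R}^n\setminus\{0\}$, $X\in\Omega$ ($A$ bounded measurable, not necessarily symmetric); $Lu=0$ is understood in the weak sense. Capacity: for a set $K\subset\mathbb{R}^n$, $\operatorname{cap}_2(K)=\inf\{\int|\nabla\varphi|^2dx:\varphi\in C_c^\infty(\mathbb{R}^n),\ K\subset\operatorname{int}\{\varphi\ge1\}\}$. Capacity density condition (CDC) with constants $C_0,R>0$: $\operatorname{cap}_2(B_r(Q)\cap\Omega^c)\ge C_0r^{n-2}$ for every $Q\in\partial\Omega$ and every $r\in(0,R)$.
   Formalization: The ellipticity constant λ is also required to bound the matrix itself, |A(X)ξ| ≤ λ|ξ| (automatic for symmetric A); for nonsymmetric A bounded only through the quadratic form, no β depending only on C₀, n, λ exists. *)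

theory Defs
  imports "HOL-Analysis.Analysis"
begin

definition gradient :: "(real^'n \<Rightarrow> real) \<Rightarrow> real^'n \<Rightarrow> real^'n" where
  "gradient f x = (\<chi> i. frechet_derivative f (at x) (axis i 1))"

primrec Ck :: "nat \<Rightarrow> (real^'n \<Rightarrow> real) \<Rightarrow> bool" where
  "Ck 0 f \<longleftrightarrow> continuous_on UNIV f"
| "Ck (Suc k) f \<longleftrightarrow>
     (\<forall>x. f differentiable (at x)) \<and> (\<forall>i. Ck k (\<lambda>x. gradient f x $ i))"

definition test_functions :: "(real^'n) set \<Rightarrow> (real^'n \<Rightarrow> real) set" where
  "test_functions U =
     {\<phi>. (\<forall>k. Ck k \<phi>) \<and> compact (closure {x. \<phi> x \<noteq> 0}) \<and> closure {x. \<phi> x \<noteq> 0} \<subseteq> U}"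

(* Extended nonnegative values, so that the infimum over an empty family is \<infinity>. *)
definition cap2 :: "(real^'n) set \<Rightarrow> ennreal" where
  "cap2 K = (INF \<phi> \<in> {\<phi> \<in> test_functions UNIV. K \<subseteq> interior {x. \<phi> x \<ge> 1}}.
     \<integral>\<^sup>+ x. ennreal ((norm (gradient \<phi> x))\<^sup>2) \<partial>lborel)"

definition capacity_density :: "(real^'n) set \<Rightarrow> real \<Rightarrow> real \<Rightarrow> bool" where
  "capacity_density \<Omega> C0 R \<longleftrightarrow> C0 > 0 \<and> R > 0 \<and>
     (\<forall>Q \<in> frontier \<Omega>. \<forall>r. 0 < r \<and> r < R \<longrightarrow>
        cap2 (ball Q r \<inter> - \<Omega>) \<ge> ennreal (C0 * r ^ (CARD('n) - 2)))"

(* The quadratic form does not see the antisymmetric part of A, so its upper bound does not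
   bound a nonsymmetric A. Estimates with constants depending on the coefficients only through
   ell need the bound on A itself to be ell as well. For symmetric A this last clause
   already follows from the two bounds on the quadratic form. *)
definition elliptic_matrix :: "real \<Rightarrow> (real^'n) set \<Rightarrow> (real^'n \<Rightarrow> real^'n^'n) \<Rightarrow> bool" where
  "elliptic_matrix ell \<Omega> A \<longleftrightarrow> ell > 0 \<and> A \<in> borel_measurable (lebesgue_on \<Omega>) \<and>
     (\<forall>X \<in> \<Omega>. \<forall>\<xi>. inverse ell * (norm \<xi>)\<^sup>2 \<le> (A X *v \<xi>) \<bullet> \<xi> \<and>
                   (A X *v \<xi>) \<bullet> \<xi> \<le> ell * (norm \<xi>)\<^sup>2) \<and>
     (\<forall>X \<in> \<Omega>. \<forall>\<xi>. norm (A X *v \<xi>) \<le> ell * norm \<xi>)"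

definition L2_on :: "(real^'n) set \<Rightarrow> (real^'n \<Rightarrow> 'b::euclidean_space) \<Rightarrow> bool" where
  "L2_on U f \<longleftrightarrow> f \<in> borel_measurable (lebesgue_on U) \<and>
     integrable (lebesgue_on U) (\<lambda>x. (norm (f x))\<^sup>2)"

definition weak_gradient :: "(real^'n) set \<Rightarrow> (real^'n \<Rightarrow> real) \<Rightarrow> (real^'n \<Rightarrow> real^'n) \<Rightarrow> bool" where
  "weak_gradient U u g \<longleftrightarrow> L2_on U u \<and> L2_on U g \<and>
     (\<forall>\<phi> \<in> test_functions U. \<forall>i.
        integral\<^sup>L (lebesgue_on U) (\<lambda>x. u x * gradient \<phi> x $ i) =
        - integral\<^sup>L (lebesgue_on U) (\<lambda>x. g x $ i * \<phi> x))"

definition W12 :: "(real^'n) set \<Rightarrow> (real^'n \<Rightarrow> real) set" where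
  "W12 U = {u. \<exists>g. weak_gradient U u g}"

(* Weak gradients are unique almost everywhere, so the choice of g is immaterial. *)
definition weak_solution ::
    "(real^'n \<Rightarrow> real^'n^'n) \<Rightarrow> (real^'n) set \<Rightarrow> (real^'n \<Rightarrow> real) \<Rightarrow> bool" where
  "weak_solution A U u \<longleftrightarrow> (\<exists>g. weak_gradient U u g \<and>
     (\<forall>\<phi> \<in> test_functions U.
        integral\<^sup>L (lebesgue_on U) (\<lambda>x. (A x *v g x) \<bullet> gradient \<phi> x) = 0))"

end

theory Submission
  imports Defs
begin

text \<open>
  The estimate follows from a decay step at one scale, repeated. The step: if a solution is at
  most 1 on \<open>ball Q (4 * s)\<close> and vanishes on the part of the boundary of \<open>\<Omega>\<close> in that ball, then it
  is at most \<open>1 - \<tau> / 2\<close> on \<open>ball Q s\<close>, where \<open>\<tau> > 0\<close> depends only on the dimension, \<open>C0\<close> and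
  the ellipticity constant (\<open>oscillation_decay\<close>). Applied to \<open>u / N\<close> and \<open>- u / N\<close> on the balls of
  radius \<open>\<rho> / 4 ^ k\<close>, with \<open>N\<close> the bound of the previous scale, it gives geometric decay
  (\<open>boundary_decay\<close>), and geometric decay over scales of ratio 4 is a power of the distance. As the
  ratio \<open>1 - \<tau> / 2\<close> is at least \<open>1 / 2\<close>, rounding the distance to a power of 4 costs at most the
  factor 2 of the theorem (\<open>geometric_to_power\<close>).

  The step has two halves. First, the set where \<open>u > 1 - \<tau>\<close> is small in measure. Let \<open>w = H u\<close> with
  \<open>H t = - ln (1 - (t - \<tau>)\<^sub>+ ^ 3)\<close>. Since \<open>H'' \<ge> H'\<^sup>2\<close>, testing the equation with \<open>H' u\<close> times a
  squared cutoff bounds the Dirichlet energy of \<open>w\<close> by a multiple of \<open>s ^ (n - 2)\<close>, independently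
  of \<open>u\<close> (\<open>energy_inequality\<close>). Moreover \<open>w\<close> vanishes near the complement of \<open>\<Omega>\<close>. If \<open>c\<close> is a
  typical value of \<open>w\<close>, then \<open>1 - w / c\<close> times a cutoff is admissible for the capacity of that
  complement in \<open>ball Q s\<close>; as this capacity is at least \<open>C0 * s ^ (n - 2)\<close>, \<open>c\<close> is bounded, and
  the Poincare inequality then bounds the mean square of \<open>w\<close> (\<open>capacity_poincare\<close>). But \<open>w\<close> is
  at least \<open>- ln (9 * \<tau>)\<close>, up to the approximation described below, where \<open>u > 1 - \<tau>\<close>, so this
  happens on a small set if \<open>\<tau>\<close> is small (\<open>log_level_estimate\<close>). Second, a De Giorgi iteration over
  shrinking balls and rising levels turns smallness in measure into the pointwise bound
  (\<open>de_giorgi_iteration\<close>).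

  No theory of Sobolev spaces is involved. As \<open>u\<close> is continuous and vanishes on the boundary, the
  set where \<open>u \<ge> k > 0\<close> stays at a positive distance from the complement of \<open>\<Omega>\<close> in every smaller
  concentric closed ball. On it, the mollifications of \<open>u\<close> have gradients that converge in mean square
  to the weak gradient (\<open>approximation_exists\<close>). All functions used above vanish where \<open>u\<close> is small,
  so the inequalities can be proved for C1 functions, with errors that tend to 0. For C1 functions
  the integral of \<open>(f (x + h) - f x)\<^sup>2\<close> is at most \<open>(norm h)\<^sup>2\<close> times the Dirichlet energy
  (\<open>translation_increment_le\<close>). Averaging this over \<open>h\<close> in a ball gives the Poincare inequality
  (\<open>poincare_ball\<close>), and, for functions supported in a set of small measure, the inequality of
  Faber and Krahn (\<open>faber_krahn\<close>), which does the work of the Sobolev embedding in the iteration.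
\<close>

section \<open>Gradients and functions of class C1\<close>

lemma GDERIV_gradient:
  fixes f :: "real^'n \<Rightarrow> real"
  assumes "f differentiable (at x)"
  shows "GDERIV f x :> gradient f x"
proof -
  let ?D = "frechet_derivative f (at x)"
  have D: "(f has_derivative ?D) (at x)"
    using assms by (simp add: frechet_derivative_works)
  then have lin: "linear ?D"
    by (rule has_derivative_linear)
  have eq: "?D h = h \<bullet> gradient f x" for h
  proof -
    have "?D h = ?D (\<Sum>i\<in>UNIV. (h $ i) *s axis i 1)"
      by (simp add: basis_expansion)
    also have "\<dots> = (\<Sum>i\<in>UNIV. h $ i * ?D (axis i 1))"
      using lin by (simp add: linear_sum scalar_mult_eq_scaleR linear_scale)
    finally show ?thesis
      by (simp add: inner_vec_def gradient_def)
  qed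
  have "?D = (\<lambda>h. h \<bullet> gradient f x)"
    by (rule ext) (rule eq)
  with D show ?thesis
    by (simp only: gderiv_def)
qed

lemma gradient_eqI:
  fixes f :: "real^'n \<Rightarrow> real"
  assumes "GDERIV f x :> D"
  shows "gradient f x = D"
proof -
  have "frechet_derivative f (at x) = (\<lambda>h. h \<bullet> D)"
    using assms frechet_derivative_at unfolding gderiv_def by metis
  then show ?thesis
    by (simp add: gradient_def vec_eq_iff inner_axis' )
qed

lemma GDERIV_differentiable:
  fixes f :: "real^'n \<Rightarrow> real"
  shows "GDERIV f x :> D \<Longrightarrow> f differentiable (at x)"
  unfolding gderiv_def by (rule differentiableI)

lemma continuous_on_vec_iff:
  fixes G :: "'a::topological_space \<Rightarrow> real^'n"
  shows "continuous_on S G \<longleftrightarrow> (\<forall>i. continuous_on S (\<lambda>x. G x $ i))"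
proof
  assume *: "\<forall>i. continuous_on S (\<lambda>x. G x $ i)"
  have "continuous_on S (\<lambda>x. \<chi> i. G x $ i)"
    by (rule continuous_on_vec_lambda) (use * in blast)
  then show "continuous_on S G" by simp
qed (auto intro: continuous_intros)

definition C1 :: "(real^'n \<Rightarrow> real) \<Rightarrow> bool" where
  "C1 f \<longleftrightarrow> (\<forall>x. f differentiable (at x)) \<and> continuous_on UNIV (gradient f)"

lemma C1_iff_Ck: "C1 f \<longleftrightarrow> Ck (Suc 0) f"
  using continuous_on_vec_iff[of UNIV "gradient f"] by (auto simp: C1_def)

lemma C1I:
  assumes "\<And>x. GDERIV f x :> G x" "continuous_on UNIV G"
  shows "C1 f" and "gradient f = G"
proof -
  have "gradient f = G" using assms(1) gradient_eqI by blast
  with assms show "C1 f" "gradient f = G"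
    by (auto simp: C1_def intro: GDERIV_differentiable)
qed

lemma C1_GDERIV: "C1 f \<Longrightarrow> GDERIV f x :> gradient f x"
  by (simp add: C1_def GDERIV_gradient)

lemma C1_continuous_gradient: "C1 f \<Longrightarrow> continuous_on S (gradient f)"
  using continuous_on_subset by (auto simp: C1_def)

lemma C1_continuous: "C1 f \<Longrightarrow> continuous_on S f"
  unfolding C1_def
  by (meson continuous_at_imp_continuous_on differentiable_imp_continuous_within)

lemma C1_mult:
  assumes "C1 f" "C1 g"
  shows "C1 (\<lambda>x. f x * g x)"
    "gradient (\<lambda>x. f x * g x) = (\<lambda>x. f x *\<^sub>R gradient g x + g x *\<^sub>R gradient f x)"
proof -
  have *: "GDERIV (\<lambda>x. f x * g x) x :> f x *\<^sub>R gradient g x + g x *\<^sub>R gradient f x" for x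
    using assms by (intro GDERIV_mult C1_GDERIV)
  have c: "continuous_on UNIV (\<lambda>x. f x *\<^sub>R gradient g x + g x *\<^sub>R gradient f x)"
    using assms by (intro continuous_intros C1_continuous C1_continuous_gradient)
  from C1I[OF * c] show "C1 (\<lambda>x. f x * g x)"
    "gradient (\<lambda>x. f x * g x) = (\<lambda>x. f x *\<^sub>R gradient g x + g x *\<^sub>R gradient f x)" by auto
qed

lemma C1_compose:
  assumes "C1 f" "\<And>x. f x \<in> T"
    and H: "\<And>t. t \<in> T \<Longrightarrow> (H has_real_derivative H' t) (at t)" and H': "continuous_on T H'"
  shows "C1 (\<lambda>x. H (f x))" "gradient (\<lambda>x. H (f x)) = (\<lambda>x. H' (f x) *\<^sub>R gradient f x)"
proof -
  have *: "GDERIV (\<lambda>x. H (f x)) x :> H' (f x) *\<^sub>R gradient f x" for x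
    using assms by (intro GDERIV_DERIV_compose C1_GDERIV) auto
  have "continuous_on UNIV (\<lambda>x. H' (f x))"
    by (rule continuous_on_compose2[OF H']) (use assms in \<open>auto intro: C1_continuous\<close>)
  then have c: "continuous_on UNIV (\<lambda>x. H' (f x) *\<^sub>R gradient f x)"
    using assms(1) by (intro continuous_intros C1_continuous_gradient)
  from C1I[OF * c] show "C1 (\<lambda>x. H (f x))"
     "gradient (\<lambda>x. H (f x)) = (\<lambda>x. H' (f x) *\<^sub>R gradient f x)" by auto
qed

text \<open>
  The closure matters: at a boundary point of the support the function need not vanish nearby.
\<close>

lemma gradient_eq_0_off_support:
  fixes f :: "real^'n \<Rightarrow> real"
  assumes "x \<notin> closure {x. f x \<noteq> 0}"
  shows "gradient f x = 0"
proof (rule gradient_eqI)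
  have "open (- closure {x. f x \<noteq> 0})" by (intro open_Compl closed_closure)
  then have "eventually (\<lambda>y. y \<in> - closure {x. f x \<noteq> 0}) (nhds x)"
    using assms by (intro eventually_nhds_in_open) auto
  then have ev: "eventually (\<lambda>y. f y = 0) (nhds x)"
    by eventually_elim (use closure_subset[of "{x. f x \<noteq> 0}"] in auto)
  have "f x = 0" using ev eventually_nhds_x_imp_x by blast
  moreover have "eventually (\<lambda>y. 0 = f y) (at x)"
    using ev unfolding eventually_at_filter by (auto elim: eventually_mono)
  ultimately show "GDERIV f x :> 0"
    unfolding gderiv_def
    by (intro has_derivative_transform_eventually[OF has_derivative_const[of 0, THEN has_derivative_eq_rhs]])
      auto
qed

lemma C1_line_DERIV:
  assumes "C1 f"
  shows "((\<lambda>t. f (x + t *\<^sub>R h)) has_real_derivative (gradient f (x + t *\<^sub>R h) \<bullet> h)) (at t)"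
proof -
  have "(f has_derivative (\<lambda>k. k \<bullet> gradient f (x + t *\<^sub>R h))) (at (x + t *\<^sub>R h))"
    using C1_GDERIV[OF assms] by (simp add: gderiv_def)
  moreover have "((\<lambda>t. x + t *\<^sub>R h) has_derivative (\<lambda>s. s *\<^sub>R h)) (at t)"
    by (auto intro!: derivative_eq_intros)
  ultimately have "((\<lambda>t. f (x + t *\<^sub>R h)) has_derivative (\<lambda>s. (s *\<^sub>R h) \<bullet> gradient f (x + t *\<^sub>R h))) (at t)"
    by (rule has_derivative_compose[rotated])
  then show ?thesis
    by (simp add: has_field_derivative_def inner_commute mult_commute_abs)
qed

lemma uniformly_continuous_compact_support:
  fixes f :: "real^'n \<Rightarrow> 'b::real_normed_vector"
  assumes "continuous_on UNIV f" "bounded {x. f x \<noteq> 0}" "e > 0"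
  obtains d where "d > 0" "\<And>x y. dist x y < d \<Longrightarrow> norm (f x - f y) < e"
proof -
  obtain R where R: "R > 0" "\<And>x. f x \<noteq> 0 \<Longrightarrow> norm x \<le> R"
    using assms(2) unfolding bounded_pos by auto
  have "uniformly_continuous_on (cball 0 (R+1)) f"
    using assms(1) by (intro compact_uniformly_continuous) (auto intro: continuous_on_subset)
  then obtain d where d: "d > 0" "\<And>x y. x \<in> cball 0 (R+1) \<Longrightarrow> y \<in> cball 0 (R+1) \<Longrightarrow> dist x y < d \<Longrightarrow> dist (f x) (f y) < e"
    using \<open>e > 0\<close> unfolding uniformly_continuous_on_def by (metis dist_commute)
  show thesis
  proof (rule that[of "min d 1"])
    fix x y :: "real^'n" assume xy: "dist x y < min d 1"
    show "norm (f x - f y) < e"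
    proof (cases "norm x \<le> R+1 \<and> norm y \<le> R + 1")
      case True then show ?thesis using d(2)[of x y] xy by (auto simp: dist_norm)
    next
      case False
      then have "norm x > R" "norm y > R" using xy norm_triangle_ineq2[of x y] norm_triangle_ineq2[of y x]
        by (auto simp: dist_norm norm_minus_commute)
      then have "f x = 0" "f y = 0" using R(2) by fastforce+
      then show ?thesis using \<open>e > 0\<close> by simp
    qed
  qed (use d in auto)
qed

lemma bounded_gradient_support:
  assumes "bounded {x. f x \<noteq> 0}"
  shows "bounded {x. gradient f x \<noteq> 0}"
proof -
  have "{x. gradient f x \<noteq> 0} \<subseteq> closure {x. f x \<noteq> 0}"
    using gradient_eq_0_off_support by blast
  then show ?thesis using assms bounded_closure bounded_subset by blast
qed

text \<open>
  The mean value theorem along the segment from \<open>x\<close> to \<open>x + h\<close> reduces this to the uniform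
  continuity of the gradient. Uniformity in \<open>x\<close> is what allows differentiation under the
  integral sign of a convolution with a merely integrable function.
\<close>

lemma C1_uniformly_differentiable:
  fixes f :: "real^'n \<Rightarrow> real"
  assumes "C1 f" "bounded {x. f x \<noteq> 0}" "e > 0"
  obtains d where "d > 0" "\<And>x h. norm h < d \<Longrightarrow> \<bar>f (x + h) - f x - h \<bullet> gradient f x\<bar> \<le> e * norm h"
proof -
  obtain d where d: "d > 0" "\<And>x y. dist x y < d \<Longrightarrow> norm (gradient f x - gradient f y) < e"
    using uniformly_continuous_compact_support[OF C1_continuous_gradient bounded_gradient_support] assms
    by metis
  show thesis
  proof (rule that[OF d(1)])
    fix x h :: "real^'n" assume h: "norm h < d"
    have "\<exists>t. 0 < t \<and> t < 1 \<and> f (x + 1 *\<^sub>R h) - f (x + 0 *\<^sub>R h)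
        = (1 - 0) * (gradient f (x + t *\<^sub>R h) \<bullet> h)"
      by (rule MVT2) (simp, rule C1_line_DERIV[OF assms(1)])
    then obtain t where t: "0 < t" "t < 1"
      "f (x + 1 *\<^sub>R h) - f (x + 0 *\<^sub>R h) = (1 - 0) * (gradient f (x + t *\<^sub>R h) \<bullet> h)"
      by blast
    have "norm (t *\<^sub>R h) \<le> norm h"
      using t mult_left_le_one_le[of "norm h" t] by simp
    then have "norm (t *\<^sub>R h) < d" using h by linarith
    then have "norm (gradient f (x + t *\<^sub>R h) - gradient f x) < e"
      by (intro d) (simp add: dist_norm)
    moreover have "f (x + h) - f x - h \<bullet> gradient f x = (gradient f (x + t *\<^sub>R h) - gradient f x) \<bullet> h"
      using t by (simp add: inner_diff_left inner_diff_right inner_commute)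
    moreover have "\<bar>(gradient f (x + t *\<^sub>R h) - gradient f x) \<bullet> h\<bar>
        \<le> norm (gradient f (x + t *\<^sub>R h) - gradient f x) * norm h"
      by (rule Cauchy_Schwarz_ineq2)
    moreover have "norm (gradient f (x + t *\<^sub>R h) - gradient f x) * norm h \<le> e * norm h"
      by (intro mult_right_mono) (use calculation(1) in auto)
    ultimately show "\<bar>f (x + h) - f x - h \<bullet> gradient f x\<bar> \<le> e * norm h"
      by linarith
  qed
qed

section \<open>Smoothness of all orders\<close>

lemma Ck_Suc_imp_Ck: "Ck (Suc k) f \<Longrightarrow> Ck k f"
proof (induction k arbitrary: f)
  case 0
  then show ?case using C1_iff_Ck[of f] C1_continuous[of f UNIV] by (simp only: Ck.simps(1))
qed auto

lemma Ck_const: "Ck k (\<lambda>x::real^'n. c)"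
proof (induction k arbitrary: c)
  case (Suc k)
  have "gradient (\<lambda>x::real^'n. c) = (\<lambda>x. 0)"
    by (rule ext, rule gradient_eqI, rule GDERIV_const)
  with Suc[of 0] show ?case by simp
qed simp

lemma Ck_add:
  fixes f :: "real^'n \<Rightarrow> real" shows "Ck k f \<Longrightarrow> Ck k g \<Longrightarrow> Ck k (\<lambda>x. f x + g x)"
proof (induction k arbitrary: f g)
  case (Suc k)
  have "gradient (\<lambda>x. f x + g x) x = gradient f x + gradient g x" for x
    using Suc.prems by (intro gradient_eqI GDERIV_add GDERIV_gradient) auto
  with Suc show ?case by (auto intro: derivative_intros)
qed (auto intro: continuous_intros)

lemma Ck_mult:
  fixes f :: "real^'n \<Rightarrow> real" shows "Ck k f \<Longrightarrow> Ck k g \<Longrightarrow> Ck k (\<lambda>x. f x * g x)"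
proof (induction k arbitrary: f g)
  case (Suc k)
  have "gradient (\<lambda>x. f x * g x) x = f x *\<^sub>R gradient g x + g x *\<^sub>R gradient f x" for x
    using Suc.prems by (intro gradient_eqI GDERIV_mult GDERIV_gradient) auto
  then have "Ck k (\<lambda>x. gradient (\<lambda>x. f x * g x) x $ i)" for i
    using Suc.prems Suc.IH Ck_Suc_imp_Ck[of k f] Ck_Suc_imp_Ck[of k g]
    by (auto intro!: Ck_add)
  with Suc.prems show ?case by (auto intro: derivative_intros)
qed (auto intro: continuous_intros)

lemma Ck_component: "Ck k (\<lambda>x::real^'n. x $ i)"
proof (cases k)
  case (Suc m)
  have g: "GDERIV (\<lambda>x::real^'n. x $ i) x :> axis i 1" for x
    unfolding gderiv_def
    by (rule has_derivative_eq_rhs, rule bounded_linear_imp_has_derivative[OF bounded_linear_vec_nth])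
      (auto simp: inner_axis)
  from gradient_eqI[OF g] GDERIV_differentiable[OF g] show ?thesis
    by (simp add: Suc Ck_const)
qed (auto intro: continuous_intros)

text \<open>
  The functions \<open>exp (- 1 / t) / t ^ m\<close>, continued by 0, form a family that is closed under
  differentiation up to linear combinations. This makes the smoothness of bump functions built
  from \<open>flat 0\<close> an induction over the order that treats all \<open>m\<close> at once.
\<close>

definition flat :: "nat \<Rightarrow> real \<Rightarrow> real" where
  "flat m t = (if t > 0 then exp (- (1 / t)) / t ^ m else 0)"

lemma flat_nonneg: "flat m t \<ge> 0" by (simp add: flat_def)

text \<open>
  One term of the exponential series for \<open>exp (1 / t)\<close> suffices. The bound is quadratic in order
  to give derivative 0 at the origin.
\<close>

lemma flat_le: "flat m t \<le> fact (m + 2) * t\<^sup>2"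
proof (cases "t > 0")
  case True
  have "(1/t) ^ (m+2) / fact (m+2) \<le> exp (1/t)"
  proof -
    have "(1/t) ^ (m+2) / fact (m+2) = (\<Sum>k\<in>{m+2}. (1/t) ^ k / fact k)" by simp
    also have "\<dots> \<le> (\<Sum>k\<le>m+2. (1/t) ^ k / fact k)"
      using True by (intro sum_mono2) auto
    also have "\<dots> = (\<Sum>k<Suc (m+2). (1/t) ^ k /\<^sub>R fact k)"
      by (simp only: lessThan_Suc_atMost) (simp add: field_simps)
    also have "\<dots> \<le> exp (1/t)"
      unfolding exp_def using True
      by (intro sum_le_suminf summable_exp_generic) auto
    finally show ?thesis .
  qed
  moreover define c :: real where "c = fact (m + 2)"
  ultimately have "1 / exp (1/t) \<le> c * t ^ (m+2)" "c > 0"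
    using True by (simp_all add: field_simps del: fact_Suc)
  then show ?thesis using True unfolding c_def[symmetric]
    by (simp add: flat_def exp_minus field_simps power_add power2_eq_square)
qed (simp add: flat_def)

lemma flat_DERIV: "(flat m has_real_derivative (flat (m+2) t - m * flat (m+1) t)) (at t)"
proof -
  consider "t > 0" | "t < 0" | "t = 0" by linarith
  then show ?thesis
  proof cases
    case 1
    have "((\<lambda>t. exp (- (1 / t)) / t ^ m) has_real_derivative (flat (m+2) t - m * flat (m+1) t)) (at t)"
    proof -
      have "((\<lambda>t. exp (- (1 / t)) / t ^ m) has_real_derivative
          (exp (- (1 / t)) * (1 / t\<^sup>2) * t ^ m - exp (- (1 / t)) * (real m * t ^ (m - 1))) / (t ^ m * t ^ m)) (at t)"
        using 1 by (intro derivative_eq_intros | simp add: power2_eq_square)+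
      moreover have "(exp (- (1 / t)) * (1 / t\<^sup>2) * t ^ m - exp (- (1 / t)) * (real m * t ^ (m - 1))) / (t ^ m * t ^ m)
         = flat (m+2) t - m * flat (m+1) t"
        using 1 by (cases m) (simp_all add: flat_def field_simps power2_eq_square)
      ultimately show ?thesis by simp
    qed
    moreover have "eventually (\<lambda>s. exp (- (1 / s)) / s ^ m = flat m s) (nhds t)"
      using eventually_nhds_in_open[of "{0<..}" t] 1 by (auto simp: flat_def elim!: eventually_mono)
    ultimately show ?thesis
      by (subst DERIV_cong_ev[OF refl _ refl, symmetric])
  next
    case 2
    have "eventually (\<lambda>s. 0 = flat m s) (nhds t)"
      using eventually_nhds_in_open[of "{..<0}" t] 2 by (auto simp: flat_def elim!: eventually_mono)
    then have "(flat m has_real_derivative 0) (at t)"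
      using DERIV_cong_ev[of t t "\<lambda>_. 0" "flat m" 0 0] by simp
    then show ?thesis using 2 by (simp add: flat_def)
  next
    case 3
    have "((\<lambda>h. flat m h / h) \<longlongrightarrow> 0) (at 0)"
    proof (rule Lim_null_comparison)
      show "eventually (\<lambda>h. norm (flat m h / h) \<le> fact (m+2) * \<bar>h\<bar>) (at 0)"
      proof (intro always_eventually allI)
        fix h :: real
        have "norm (flat m h / h) = flat m h / \<bar>h\<bar>"
          using flat_nonneg[of m h] by (simp add: abs_divide)
        also have "\<dots> \<le> fact (m+2) * h\<^sup>2 / \<bar>h\<bar>"
          by (intro divide_right_mono flat_le) auto
        also have "\<dots> = fact (m+2) * \<bar>h\<bar>"
          by (cases "h = 0") (simp_all add: power2_eq_square abs_if del: fact_Suc)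
        finally show "norm (flat m h / h) \<le> fact (m+2) * \<bar>h\<bar>" .
      qed
      show "((\<lambda>h. fact (m+2) * \<bar>h\<bar>) \<longlongrightarrow> (0::real)) (at 0)"
        by (auto intro!: tendsto_eq_intros)
    qed
    then have "(flat m has_real_derivative 0) (at 0)"
      by (simp add: DERIV_def flat_def)
    then show ?thesis using 3 by (simp add: flat_def)
  qed
qed

section \<open>Mollifiers\<close>

lemma Ck_flat_compose:
  fixes s :: "real^'n \<Rightarrow> real"
  assumes "\<And>k. Ck k s"
  shows "Ck k (\<lambda>x. flat m (s x))"
proof (induction k arbitrary: m)
  case 0
  have "continuous_on UNIV (flat m)"
    using flat_DERIV by (intro continuous_at_imp_continuous_on) (auto intro: DERIV_isCont)
  then show ?case
    using assms[of 0] by (auto intro: continuous_on_compose2)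
next
  case (Suc k)
  have "s differentiable (at x)" for x using assms[of "Suc 0"] by auto
  then have *: "GDERIV (\<lambda>x. flat m (s x)) x :>
      (flat (m+2) (s x) - m * flat (m+1) (s x)) *\<^sub>R gradient s x" for x
    by (intro GDERIV_DERIV_compose GDERIV_gradient flat_DERIV) auto
  have "Ck k (\<lambda>x. (flat (m+2) (s x) + (- real m) * flat (m+1) (s x)) * (gradient s x $ i))" for i
    using assms[of "Suc k"] by (intro Ck_mult Ck_add Ck_const Suc.IH) auto
  then show ?case
    using gradient_eqI[OF *] GDERIV_differentiable[OF *] by simp
qed

text \<open>
  Smoothness is expressed by \<open>Ck\<close> for every order, because this is what membership in
  \<open>test_functions\<close> requires.
\<close>

definition mollifier :: "real \<Rightarrow> (real^'n \<Rightarrow> real) \<Rightarrow> bool" where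
  "mollifier e \<rho> \<longleftrightarrow> (\<forall>k. Ck k \<rho>) \<and> (\<forall>x. \<rho> x \<ge> 0) \<and> (\<forall>x. norm x \<ge> e \<longrightarrow> \<rho> x = 0) \<and>
     integrable lborel \<rho> \<and> integral\<^sup>L lborel \<rho> = 1"

lemma integrable_compact_support:
  fixes f :: "real^'n \<Rightarrow> 'b::{banach, second_countable_topology}"
  assumes "continuous_on UNIV f" "bounded {x. f x \<noteq> 0}"
  shows "integrable lborel f"
proof -
  have "integrable lborel (\<lambda>x. indicator (closure {x. f x \<noteq> 0}) x *\<^sub>R f x)"
    using assms by (intro borel_integrable_compact) (auto intro: continuous_on_subset simp: compact_closure)
  moreover have "indicator (closure {x. f x \<noteq> 0}) x *\<^sub>R f x = f x" for x
    using closure_subset[of "{x. f x \<noteq> 0}"] by (auto simp: indicator_def)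
  ultimately show ?thesis by simp
qed

lemma exists_mollifier:
  assumes "e > 0"
  obtains \<rho> :: "real^'n \<Rightarrow> real" where "mollifier e \<rho>"
proof -
  define s :: "real^'n \<Rightarrow> real" where "s = (\<lambda>x. e\<^sup>2 - x \<bullet> x)"
  have gs: "GDERIV s x :> (-2) *\<^sub>R x" for x
    unfolding s_def gderiv_def by (auto intro!: derivative_eq_intros simp: inner_commute)
  have "Ck k s" for k
  proof (cases k)
    case 0
    then show ?thesis by (auto simp: s_def intro!: continuous_intros)
  next
    case (Suc m)
    have "Ck m (\<lambda>x::real^'n. (-2) * x $ i)" for i by (intro Ck_mult Ck_const Ck_component)
    then show ?thesis using Suc gradient_eqI[OF gs] GDERIV_differentiable[OF gs] by simp
  qed
  note Cks = this
  define r where "r = (\<lambda>x. flat 0 (s x))"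
  have C: "Ck k r" for k unfolding r_def by (rule Ck_flat_compose[OF Cks])
  have pos: "r x \<ge> 0" for x by (simp add: r_def flat_nonneg)
  have supp: "r x > 0 \<longleftrightarrow> norm x < e" for x
  proof -
    have "x \<bullet> x < e\<^sup>2 \<longleftrightarrow> norm x < e"
      using \<open>e > 0\<close> by (metis abs_norm_cancel abs_of_pos power2_norm_eq_inner real_sqrt_abs real_sqrt_less_iff)
    then show ?thesis by (auto simp: r_def flat_def s_def)
  qed
  have "bounded {x. r x \<noteq> 0}"
    by (rule bounded_subset[of "ball 0 e"]) (use supp pos in \<open>force simp: less_le\<close>)+
  moreover have "continuous_on UNIV r" using C[of 0] by simp
  ultimately have int: "integrable lborel r" by (intro integrable_compact_support)
  have "integral\<^sup>L lborel r \<noteq> 0"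
  proof
    assume "integral\<^sup>L lborel r = 0"
    then have "AE x in lborel. r x = 0"
      using integral_nonneg_eq_0_iff_AE[OF int] pos by simp
    then have "AE x in lborel. x \<notin> ball (0::real^'n) e"
      by eventually_elim (use supp in \<open>force\<close>)
    then have "emeasure lborel (ball (0::real^'n) e) = 0"
      by (subst (asm) AE_iff_measurable[OF _ refl]) (auto simp: ball_def)
    then show False using \<open>e > 0\<close> unit_ball_vol_pos[of "real CARD('n)"] by (simp add: emeasure_ball)
  qed
  moreover have "integral\<^sup>L lborel r \<ge> 0" using pos by simp
  ultimately have I: "integral\<^sup>L lborel r > 0" by simp
  define c where "c = 1 / integral\<^sup>L lborel r"
  have "mollifier e (\<lambda>x. c * r x)"
    unfolding mollifier_def
  proof (intro conjI allI impI)
    show "Ck k (\<lambda>x. c * r x)" for k by (intro Ck_mult Ck_const C)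
    show "0 \<le> c * r x" for x using I pos by (simp add: c_def)
    show "c * r x = 0" if "e \<le> norm x" for x using that supp[of x] pos[of x] by auto
    show "integrable lborel (\<lambda>x. c * r x)" using int by simp
    show "integral\<^sup>L lborel (\<lambda>x. c * r x) = 1" using I by (simp add: c_def)
  qed
  then show thesis by (rule that)
qed

lemma mollifier_bounded_support: "mollifier e \<rho> \<Longrightarrow> bounded {x. \<rho> x \<noteq> 0}"
  by (rule bounded_subset[of "ball 0 e"]) (auto simp: mollifier_def not_le[symmetric])

lemma mollifier_C1: "mollifier e \<rho> \<Longrightarrow> C1 \<rho>"
  unfolding C1_iff_Ck mollifier_def by blast

section \<open>Invariance of Lebesgue measure\<close>

lemma lborel_reflect: "distr lborel borel (\<lambda>y. x - y) = (lborel :: ('a::euclidean_space) measure)"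
proof -
  have "(lborel :: 'a measure) = density (distr lborel borel (\<lambda>u. x + (-1) *\<^sub>R u)) (\<lambda>_. ennreal (\<bar>-1\<bar>^DIM('a)))"
    by (rule lborel_affine) simp
  then show ?thesis by (simp add: density_1)
qed

lemma nn_integral_translate:
  fixes f :: "'a::euclidean_space \<Rightarrow> ennreal"
  assumes [measurable]: "f \<in> borel_measurable borel"
  shows "(\<integral>\<^sup>+ y. f (y + h) \<partial>lborel) = (\<integral>\<^sup>+ y. f y \<partial>lborel)"
  by (subst (2) lborel_distr_plus[of h, symmetric], subst nn_integral_distr) (auto simp: add.commute)

lemma integral_reflect_lborel:
  fixes f :: "'a::euclidean_space \<Rightarrow> 'b::{banach, second_countable_topology}"
  assumes [measurable]: "f \<in> borel_measurable borel"
  shows "integral\<^sup>L lborel (\<lambda>y. f (x - y)) = integral\<^sup>L lborel f"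
  by (subst (2) lborel_reflect[of x, symmetric], subst integral_distr) auto

lemma integrable_reflect_lborel:
  fixes f :: "'a::euclidean_space \<Rightarrow> 'b::{banach, second_countable_topology}"
  assumes [measurable]: "integrable lborel f"
  shows "integrable lborel (\<lambda>y. f (x - y))"
proof -
  have "integrable (distr lborel borel (\<lambda>y. x - y)) f"
    using assms by (simp add: lborel_reflect)
  then show ?thesis
    by (subst (asm) integrable_distr_eq) auto
qed

section \<open>Convolution with a mollifier\<close>

definition conv :: "(real^'n \<Rightarrow> real) \<Rightarrow> (real^'n \<Rightarrow> real) \<Rightarrow> real^'n \<Rightarrow> real" where
  "conv f \<rho> x = (\<integral> y. f y * \<rho> (x - y) \<partial>lborel)"

lemma integrable_scaleR_bounded:
  fixes f :: "real^'n \<Rightarrow> real" and k :: "real^'n \<Rightarrow> 'b::{banach, second_countable_topology}"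
  assumes f: "integrable lborel f" and k[measurable]: "k \<in> borel_measurable borel"
    and B: "\<And>x. norm (k x) \<le> B"
  shows "integrable lborel (\<lambda>x. f x *\<^sub>R k x)"
proof -
  have [measurable]: "f \<in> borel_measurable borel" using borel_measurable_integrable[OF f] by simp
  have "0 \<le> B" using B[of 0] norm_ge_zero order_trans by blast
  show ?thesis
  proof (rule Bochner_Integration.integrable_bound)
    show "integrable lborel (\<lambda>x. B * f x)" using f by simp
    show "AE x in lborel. norm (f x *\<^sub>R k x) \<le> norm (B * f x)"
      using B \<open>0 \<le> B\<close> by (auto simp: abs_mult mult.commute[of B] intro!: mult_left_mono)
  qed simp
qed

lemma bounded_range_compact_support:
  fixes f :: "real^'n \<Rightarrow> 'b::real_normed_vector"
  assumes "continuous_on UNIV f" "bounded {x. f x \<noteq> 0}"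
  obtains B where "B > 0" "\<And>x. norm (f x) \<le> B"
proof -
  have "compact (f ` closure {x. f x \<noteq> 0})"
    using assms by (intro compact_continuous_image) (auto intro: continuous_on_subset simp: compact_closure)
  then obtain B where B: "B > 0" "\<forall>y\<in>f ` closure {x. f x \<noteq> 0}. norm y \<le> B"
    using compact_imp_bounded bounded_pos by metis
  have "norm (f x) \<le> B" for x
    using B closure_subset[of "{x. f x \<noteq> 0}"] by (cases "f x = 0") auto
  with B show thesis by (intro that)
qed

lemma conv_integrand:
  fixes k :: "real^'n \<Rightarrow> 'b::{banach, second_countable_topology}"
  assumes "integrable lborel f" "continuous_on UNIV k" "bounded {x. k x \<noteq> 0}"
  shows "integrable lborel (\<lambda>y. f y *\<^sub>R k (x - y))"
proof -
  obtain B where B: "B > 0" "\<And>x. norm (k x) \<le> B"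
    using bounded_range_compact_support[OF assms(2,3)] by metis
  have [measurable]: "k \<in> borel_measurable borel"
    using assms(2) by (rule borel_measurable_continuous_onI)
  show ?thesis
    by (rule integrable_scaleR_bounded[OF assms(1)]) (use B in auto)
qed

lemma conv_commute:
  fixes f g :: "real^'n \<Rightarrow> real"
  assumes [measurable]: "f \<in> borel_measurable borel" "g \<in> borel_measurable borel"
  shows "conv f g = conv g f"
proof
  fix x
  have "conv f g x = (\<integral> y. f (x - y) * g (x - (x - y)) \<partial>lborel)"
    unfolding conv_def by (rule integral_reflect_lborel[symmetric]) measurable
  then show "conv f g x = conv g f x" by (simp add: conv_def mult.commute)
qed

lemma conv_GDERIV:
  fixes f \<rho> :: "real^'n \<Rightarrow> real"
  assumes f: "integrable lborel f" and \<rho>: "C1 \<rho>" "bounded {x. \<rho> x \<noteq> 0}"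
  shows "GDERIV (conv f \<rho>) x :> (\<integral> y. f y *\<^sub>R gradient \<rho> (x - y) \<partial>lborel)"
proof -
  let ?G = "\<integral> y. f y *\<^sub>R gradient \<rho> (x - y) \<partial>lborel"
  let ?N = "\<integral> y. \<bar>f y\<bar> \<partial>lborel"
  have i1: "integrable lborel (\<lambda>y. f y * \<rho> (z - y))" for z
    using conv_integrand[OF f C1_continuous[OF \<rho>(1)] \<rho>(2), of z] by simp
  have i2: "integrable lborel (\<lambda>y. f y *\<^sub>R gradient \<rho> (x - y))"
    by (rule conv_integrand[OF f C1_continuous_gradient[OF \<rho>(1)] bounded_gradient_support[OF \<rho>(2)]])
  have "?N \<ge> 0" by simp
  show ?thesis
    unfolding gderiv_def has_derivative_at_alt
  proof (intro conjI allI impI)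
    show "bounded_linear (\<lambda>h. h \<bullet> ?G)" by (rule bounded_linear_inner_left)
    fix e :: real assume "e > 0"
    then have "e / (1 + ?N) > 0" using \<open>?N \<ge> 0\<close> by (intro divide_pos_pos) linarith+
    then obtain d where d: "d > 0" "\<And>x h. norm h < d \<Longrightarrow>
        \<bar>\<rho> (x + h) - \<rho> x - h \<bullet> gradient \<rho> x\<bar> \<le> e / (1 + ?N) * norm h"
      using C1_uniformly_differentiable[OF \<rho>] by metis
    show "\<exists>d>0. \<forall>y. norm (y - x) < d \<longrightarrow>
        norm (conv f \<rho> y - conv f \<rho> x - (y - x) \<bullet> ?G) \<le> e * norm (y - x)"
    proof (intro exI conjI allI impI)
      fix z assume z: "norm (z - x) < d"
      have i3: "integrable lborel (\<lambda>y. (z - x) \<bullet> (f y *\<^sub>R gradient \<rho> (x - y)))"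
        using i2 by (rule integrable_inner_right)
      have "conv f \<rho> z - conv f \<rho> x - (z - x) \<bullet> ?G
          = (\<integral> y. f y * \<rho> (z - y) - f y * \<rho> (x - y) - (z - x) \<bullet> (f y *\<^sub>R gradient \<rho> (x - y)) \<partial>lborel)"
        unfolding conv_def integral_inner_right[OF i2, symmetric]
        by (subst Bochner_Integration.integral_diff Bochner_Integration.integral_diff[symmetric], use i1 i3 in auto)+
      also have "norm \<dots> \<le> (\<integral> y. \<bar>f y\<bar> * (e / (1 + ?N) * norm (z - x)) \<partial>lborel)"
      proof (rule Bochner_Integration.integral_norm_bound_integral)
        show "integrable lborel (\<lambda>y. f y * \<rho> (z - y) - f y * \<rho> (x - y) - (z - x) \<bullet> (f y *\<^sub>R gradient \<rho> (x - y)))"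
          using i1 i3 by auto
        show "integrable lborel (\<lambda>y. \<bar>f y\<bar> * (e / (1 + ?N) * norm (z - x)))" using f by auto
        fix y
        have "\<bar>\<rho> ((x - y) + (z - x)) - \<rho> (x - y) - (z - x) \<bullet> gradient \<rho> (x - y)\<bar> \<le> e / (1 + ?N) * norm (z - x)"
          by (rule d(2)[OF z])
        moreover have "f y * \<rho> (z - y) - f y * \<rho> (x - y) - (z - x) \<bullet> (f y *\<^sub>R gradient \<rho> (x - y))
          = f y * (\<rho> ((x - y) + (z - x)) - \<rho> (x - y) - (z - x) \<bullet> gradient \<rho> (x - y))"
          by (simp add: algebra_simps)
        ultimately show "norm (f y * \<rho> (z - y) - f y * \<rho> (x - y) - (z - x) \<bullet> (f y *\<^sub>R gradient \<rho> (x - y)))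
           \<le> \<bar>f y\<bar> * (e / (1 + ?N) * norm (z - x))"
          by (simp only: real_norm_def abs_mult) (intro mult_left_mono, auto)
      qed
      also have "\<dots> = (?N / (1 + ?N)) * (e * norm (z - x))" by simp
      also have "\<dots> \<le> 1 * (e * norm (z - x))"
      proof (intro mult_right_mono)
        show "?N / (1 + ?N) \<le> 1"
          using \<open>?N \<ge> 0\<close> by (subst divide_le_eq_1_pos; linarith)
      qed (use \<open>e > 0\<close> in simp)
      finally show "norm (conv f \<rho> z - conv f \<rho> x - (z - x) \<bullet> ?G) \<le> e * norm (z - x)" by simp
    qed (fact d)
  qed
qed

lemma conv_continuous:
  fixes f \<rho> :: "real^'n \<Rightarrow> real"
  assumes f: "integrable lborel f" and \<rho>: "continuous_on UNIV \<rho>" "bounded {x. \<rho> x \<noteq> 0}"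
  shows "continuous_on UNIV (conv f \<rho>)"
  unfolding continuous_on_iff
proof (intro ballI allI impI)
  let ?N = "\<integral> y. \<bar>f y\<bar> \<partial>lborel"
  fix x e assume "(e::real) > 0"
  have "?N \<ge> 0" by simp
  then have "e / (1 + ?N) > 0" using \<open>e > 0\<close> by (intro divide_pos_pos) linarith+
  then obtain d where d: "d > 0" "\<And>x y. dist x y < d \<Longrightarrow> norm (\<rho> x - \<rho> y) < e / (1 + ?N)"
    using uniformly_continuous_compact_support[OF \<rho>] by metis
  have i1: "integrable lborel (\<lambda>y. f y * \<rho> (z - y))" for z
    using conv_integrand[OF f \<rho>, of z] by simp
  show "\<exists>d>0. \<forall>x'\<in>UNIV. dist x' x < d \<longrightarrow> dist (conv f \<rho> x') (conv f \<rho> x) < e"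
  proof (intro exI conjI ballI impI)
    fix z assume z: "dist z x < d"
    have "conv f \<rho> z - conv f \<rho> x = (\<integral> y. f y * \<rho> (z - y) - f y * \<rho> (x - y) \<partial>lborel)"
      unfolding conv_def using i1 by simp
    also have "norm \<dots> \<le> (\<integral> y. \<bar>f y\<bar> * (e / (1 + ?N)) \<partial>lborel)"
    proof (rule Bochner_Integration.integral_norm_bound_integral)
      fix y
      have "norm (\<rho> (z - y) - \<rho> (x - y)) < e / (1 + ?N)"
        by (rule d(2)) (use z in \<open>simp add: dist_norm\<close>)
      then show "norm (f y * \<rho> (z - y) - f y * \<rho> (x - y)) \<le> \<bar>f y\<bar> * (e / (1 + ?N))"
        by (simp only: right_diff_distrib[symmetric] abs_mult real_norm_def) (intro mult_left_mono, auto)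
    qed (use f i1 in auto)
    also have "\<dots> = (?N / (1 + ?N)) * e" by simp
    also have "\<dots> < 1 * e"
    proof (intro mult_strict_right_mono)
      show "?N / (1 + ?N) < 1"
        using \<open>?N \<ge> 0\<close> by (subst divide_less_eq_1_pos; linarith)
    qed (fact \<open>e > 0\<close>)
    finally show "dist (conv f \<rho> z) (conv f \<rho> x) < e" by (simp add: dist_norm)
  qed (fact d)
qed

lemma conv_gradient:
  fixes f \<rho> :: "real^'n \<Rightarrow> real"
  assumes f: "integrable lborel f" and \<rho>: "C1 \<rho>" "bounded {x. \<rho> x \<noteq> 0}"
  shows "gradient (conv f \<rho>) x $ i = conv f (\<lambda>z. gradient \<rho> z $ i) x"
proof -
  have "integrable lborel (\<lambda>y. f y *\<^sub>R gradient \<rho> (x - y))"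
    by (rule conv_integrand[OF f C1_continuous_gradient[OF \<rho>(1)] bounded_gradient_support[OF \<rho>(2)]])
  from integral_bounded_linear[OF bounded_linear_vec_nth[of i] this] show ?thesis
    by (simp add: gradient_eqI[OF conv_GDERIV[OF assms]] conv_def)
qed

text \<open>
  A derivative of a convolution falls on the kernel, and a partial derivative of the kernel is a
  kernel again; hence the generalisation over \<open>\<rho>\<close> in the induction.
\<close>

lemma Ck_conv:
  fixes f \<rho> :: "real^'n \<Rightarrow> real"
  assumes f: "integrable lborel f"
  shows "Ck k \<rho> \<Longrightarrow> bounded {x. \<rho> x \<noteq> 0} \<Longrightarrow> Ck k (conv f \<rho>)"
proof (induction k arbitrary: \<rho>)
  case 0
  then show ?case using conv_continuous[OF f] by simp
next
  case (Suc k)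
  have "Ck (Suc 0) \<rho>" using Suc.prems(1)
  proof (induction k)
    case (Suc k)
    then show ?case using Ck_Suc_imp_Ck[of "Suc k" \<rho>] by (simp only:)
  qed
  then have C: "C1 \<rho>" by (simp only: C1_iff_Ck)
  have "Ck k (conv f (\<lambda>z. gradient \<rho> z $ i))" for i
  proof (rule Suc.IH)
    show "bounded {x. gradient \<rho> x $ i \<noteq> 0}"
      by (rule bounded_subset[OF bounded_gradient_support[OF Suc.prems(2)]]) auto
  qed (use Suc.prems in auto)
  moreover have "(\<lambda>x. gradient (conv f \<rho>) x $ i) = conv f (\<lambda>z. gradient \<rho> z $ i)" for i
    using conv_gradient[OF f C Suc.prems(2)] by auto
  ultimately show ?case
    using GDERIV_differentiable[OF conv_GDERIV[OF f C Suc.prems(2)]] by simp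
qed

lemma conv_mollifier_ge:
  fixes f :: "real^'n \<Rightarrow> real"
  assumes f: "integrable lborel f" and m: "mollifier e \<rho>"
    and ge: "\<And>y. dist x y < e \<Longrightarrow> a \<le> f y"
  shows "a \<le> conv f \<rho> x"
proof -
  have i: "integrable lborel \<rho>" "integral\<^sup>L lborel \<rho> = 1" using m by (auto simp: mollifier_def)
  have [measurable]: "\<rho> \<in> borel_measurable borel" using borel_measurable_integrable[OF i(1)] by simp
  have ir: "integrable lborel (\<lambda>y. \<rho> (x - y))" by (rule integrable_reflect_lborel[OF i(1)])
  have i1: "integrable lborel (\<lambda>y. f y * \<rho> (x - y))"
    using conv_integrand[OF f C1_continuous[OF mollifier_C1[OF m]] mollifier_bounded_support[OF m], of x] by simp
  have "a = (\<integral> y. a * \<rho> (x - y) \<partial>lborel)"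
    using i(2) by (simp add: integral_reflect_lborel)
  also have "\<dots> \<le> conv f \<rho> x"
    unfolding conv_def
  proof (rule integral_mono)
    fix y
    show "a * \<rho> (x - y) \<le> f y * \<rho> (x - y)"
      using ge[of y] m by (cases "dist x y < e") (auto simp: mollifier_def dist_norm intro: mult_right_mono)
  qed (use i1 ir in auto)
  finally show ?thesis .
qed

lemma conv_mollifier_le:
  fixes f :: "real^'n \<Rightarrow> real"
  assumes f: "integrable lborel f" and m: "mollifier e \<rho>"
    and le: "\<And>y. dist x y < e \<Longrightarrow> f y \<le> a"
  shows "conv f \<rho> x \<le> a"
proof -
  have "- a \<le> conv (\<lambda>y. - f y) \<rho> x"
    by (rule conv_mollifier_ge[OF _ m]) (use f le in auto)
  then show ?thesis by (simp add: conv_def)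
qed

text \<open>
  A mollification at \<open>x\<close> is a weighted mean of values at distance less than \<open>e\<close>.
\<close>

lemma conv_mollifier_near:
  fixes f :: "real^'n \<Rightarrow> real"
  assumes f: "integrable lborel f" and m: "mollifier e \<rho>"
    and near: "\<And>y. dist x y < e \<Longrightarrow> \<bar>f y - c\<bar> \<le> \<eta>"
  shows "\<bar>conv f \<rho> x - c\<bar> \<le> \<eta>"
proof -
  have "c - \<eta> \<le> conv f \<rho> x"
    by (rule conv_mollifier_ge[OF f m]) (use near in \<open>auto simp: abs_le_iff algebra_simps\<close>)
  moreover have "conv f \<rho> x \<le> c + \<eta>"
    by (rule conv_mollifier_le[OF f m]) (use near in \<open>auto simp: abs_le_iff algebra_simps\<close>)
  ultimately show ?thesis by (simp add: abs_le_iff algebra_simps)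
qed

lemma Ck_reflect: "Ck k f \<Longrightarrow> Ck k (\<lambda>y. f (x - y))" 
  and gradient_reflect: "f differentiable (at (x - y)) \<Longrightarrow> gradient (\<lambda>y. f (x - y)) y = - gradient f (x - y)"
  for f :: "real^'n \<Rightarrow> real"
proof -
  have *: "GDERIV (\<lambda>y. f (x - y)) y :> - gradient f (x - y)" if "f differentiable (at (x - y))"
    for f :: "real^'n \<Rightarrow> real" and y
  proof -
    have "(f has_derivative (\<lambda>h. h \<bullet> gradient f (x - y))) (at (x - y))"
      using GDERIV_gradient[OF that] by (simp add: gderiv_def)
    moreover have "((\<lambda>y. x - y) has_derivative (\<lambda>h. - h)) (at y)"
      by (auto intro!: derivative_eq_intros)
    ultimately have "((\<lambda>y. f (x - y)) has_derivative (\<lambda>h. (- h) \<bullet> gradient f (x - y))) (at y)"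
      by (rule has_derivative_compose[rotated])
    then show ?thesis by (simp add: gderiv_def)
  qed
  show "Ck k f \<Longrightarrow> Ck k (\<lambda>y. f (x - y))"
  proof (induction k arbitrary: f)
    case 0
    then show ?case by (auto intro!: continuous_on_compose2[of UNIV f] continuous_intros)
  next
    case (Suc k)
    have d: "f differentiable (at z)" for z using Suc.prems by auto
    have "Ck k (\<lambda>y. (-1) * gradient f (x - y) $ i)" for i
      using Suc by (intro Ck_mult Ck_const) auto
    then show ?case using gradient_eqI[OF *[OF d]] GDERIV_differentiable[OF *[OF d]] by simp
  qed
  show "f differentiable (at (x - y)) \<Longrightarrow> gradient (\<lambda>y. f (x - y)) y = - gradient f (x - y)"
    by (rule gradient_eqI[OF *])
qed

section \<open>Convergence of mollifications\<close>

lemma ball_borel [measurable]: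
  fixes x :: "'a::metric_space"
  shows "ball x r \<in> sets borel" "cball x r \<in> sets borel"
  by (simp_all add: borel_open borel_closed)

text \<open>
  Pointwise, the square of a weighted mean is at most the mean of the squares; the result then
  follows by exchanging the order of integration.
\<close>

lemma conv_square_integral_le:
  fixes k :: "real^'n \<Rightarrow> real"
  assumes k: "integrable lborel k" "integrable lborel (\<lambda>x. (k x)\<^sup>2)" and m: "mollifier e \<rho>"
  shows "(\<integral>\<^sup>+ x. ennreal ((conv k \<rho> x)\<^sup>2) \<partial>lborel) \<le> (\<integral>\<^sup>+ x. ennreal ((k x)\<^sup>2) \<partial>lborel)"
proof -
  have i: "integrable lborel \<rho>" "integral\<^sup>L lborel \<rho> = 1" and pos: "\<And>x. \<rho> x \<ge> 0"
    using m by (auto simp: mollifier_def)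
  have [measurable]: "\<rho> \<in> borel_measurable borel" "k \<in> borel_measurable borel"
    using borel_measurable_integrable[OF i(1)] borel_measurable_integrable[OF k(1)] by simp_all
  note C = C1_continuous[OF mollifier_C1[OF m]] mollifier_bounded_support[OF m]
  have n1: "(\<integral>\<^sup>+ x. ennreal (\<rho> x) \<partial>lborel) = 1"
    using nn_integral_eq_integral[OF i(1)] i(2) pos by simp
  have "ennreal ((conv k \<rho> x)\<^sup>2) \<le> (\<integral>\<^sup>+ y. ennreal ((k y)\<^sup>2 * \<rho> (x - y)) \<partial>lborel)" for x
  proof -
    define c where "c = conv k \<rho> x"
    have ir: "integrable lborel (\<lambda>y. \<rho> (x - y))" by (rule integrable_reflect_lborel[OF i(1)])
    have r1: "(\<integral> y. \<rho> (x - y) \<partial>lborel) = 1" using i(2) by (subst integral_reflect_lborel) auto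
    have i1: "integrable lborel (\<lambda>y. k y * \<rho> (x - y))" using conv_integrand[OF k(1) C, of x] by simp
    have i2: "integrable lborel (\<lambda>y. (k y)\<^sup>2 * \<rho> (x - y))" using conv_integrand[OF k(2) C, of x] by simp
    \<comment> \<open>Jensen's inequality in the form that a variance is nonnegative.\<close>
    have "0 \<le> (\<integral> y. (k y - c)\<^sup>2 * \<rho> (x - y) \<partial>lborel)" using pos by simp
    also have "\<dots> = (\<integral> y. (k y)\<^sup>2 * \<rho> (x - y) - (2 * c) * (k y * \<rho> (x - y)) + c\<^sup>2 * \<rho> (x - y) \<partial>lborel)"
      by (simp add: power2_eq_square algebra_simps)
    also have "\<dots> = (\<integral> y. (k y)\<^sup>2 * \<rho> (x - y) \<partial>lborel) - (2 * c) * c + c\<^sup>2 * 1"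
      using i1 i2 ir r1 by (simp add: c_def conv_def)
    finally have "c\<^sup>2 \<le> (\<integral> y. (k y)\<^sup>2 * \<rho> (x - y) \<partial>lborel)" by (simp add: power2_eq_square)
    then have "ennreal (c\<^sup>2) \<le> ennreal (\<integral> y. (k y)\<^sup>2 * \<rho> (x - y) \<partial>lborel)"
      by (rule ennreal_leI)
    also have "\<dots> = (\<integral>\<^sup>+ y. ennreal ((k y)\<^sup>2 * \<rho> (x - y)) \<partial>lborel)"
      using nn_integral_eq_integral[OF i2] pos by simp
    finally show ?thesis by (simp add: c_def)
  qed
  then have "(\<integral>\<^sup>+ x. ennreal ((conv k \<rho> x)\<^sup>2) \<partial>lborel)
      \<le> (\<integral>\<^sup>+ x. \<integral>\<^sup>+ y. ennreal ((k y)\<^sup>2 * \<rho> (x - y)) \<partial>lborel \<partial>lborel)"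
    by (intro nn_integral_mono)
  also have "\<dots> = (\<integral>\<^sup>+ y. \<integral>\<^sup>+ x. ennreal ((k y)\<^sup>2 * \<rho> (x - y)) \<partial>lborel \<partial>lborel)"
    by (rule lborel_pair.Fubini'[symmetric]) measurable
  also have "\<dots> = (\<integral>\<^sup>+ y. ennreal ((k y)\<^sup>2) \<partial>lborel)"
  proof (intro nn_integral_cong)
    fix y
    have "(\<integral>\<^sup>+ x. ennreal ((k y)\<^sup>2 * \<rho> (x - y)) \<partial>lborel) = ennreal ((k y)\<^sup>2) * (\<integral>\<^sup>+ x. ennreal (\<rho> (x + (- y))) \<partial>lborel)"
      using pos by (simp add: ennreal_mult' nn_integral_cmult)
    also have "(\<integral>\<^sup>+ x. ennreal (\<rho> (x + (- y))) \<partial>lborel) = 1"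
      using n1 by (subst nn_integral_translate) auto
    finally show "(\<integral>\<^sup>+ x. ennreal ((k y)\<^sup>2 * \<rho> (x - y)) \<partial>lborel) = ennreal ((k y)\<^sup>2)" by simp
  qed
  finally show ?thesis .
qed

lemma borel_pointwise_limit_continuous:
  fixes g :: "real^'n \<Rightarrow> real"
  assumes "g \<in> borel_measurable borel"
  obtains h where "\<And>n::nat. continuous_on UNIV (h n)" "AE x in lborel. (\<lambda>n. h n x) \<longlonglongrightarrow> g x"
proof -
  have "g \<in> borel_measurable (lebesgue_on UNIV)"
    using assms by (auto intro: measurable_completion simp: lebesgue_on_UNIV_eq)
  then have "g measurable_on UNIV" by (simp add: measurable_on_iff_borel_measurable)
  then obtain N h where N: "negligible N" "\<And>n. continuous_on UNIV (h n)"
      "\<And>x. x \<notin> N \<Longrightarrow> (\<lambda>n. h n x) \<longlonglongrightarrow> g x"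
    unfolding measurable_on_def by auto
  have "AE x in lebesgue. x \<notin> N"
    using N(1) by (intro AE_not_in) (simp add: negligible_iff_null_sets)
  then have "AE x in lborel. x \<notin> N"
    by (simp add: AE_completion_iff)
  then have "AE x in lborel. (\<lambda>n. h n x) \<longlonglongrightarrow> g x"
    by eventually_elim (rule N(3))
  with N(2) show thesis by (rule that)
qed

text \<open>
  A Borel function is almost everywhere a limit of continuous functions. Truncating \<open>g\<close> and the
  approximating functions at the same height \<open>N\<close> gives a constant majorant on the ball, so that
  dominated convergence applies.
\<close>

lemma square_integrable_approx_continuous:
  fixes g :: "real^'n \<Rightarrow> real"
  assumes [measurable]: "g \<in> borel_measurable borel" and fin: "(\<integral>\<^sup>+ x. ennreal ((g x)\<^sup>2) \<partial>lborel) < \<infinity>"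
    and e: "(e::real) > 0"
  obtains h where "continuous_on UNIV h" "(\<integral>\<^sup>+ x\<in>cball 0 R. ennreal ((g x - h x)\<^sup>2) \<partial>lborel) \<le> ennreal e"
proof -
  define cl where "cl = (\<lambda>(N::nat) (t::real). max (- real N) (min (real N) t))"
  have cl_cont: "continuous_on UNIV (cl N)" for N unfolding cl_def by (intro continuous_intros)
  have [measurable]: "cl N \<in> borel_measurable borel" for N by (rule borel_measurable_continuous_onI[OF cl_cont])
  have cl_bd: "\<bar>cl N t\<bar> \<le> N" for N t by (auto simp: cl_def)
  have cl_le: "\<bar>t - cl N t\<bar> \<le> \<bar>t\<bar>" for N t by (auto simp: cl_def)
  have cl_eq: "cl N t = t" if "real N \<ge> \<bar>t\<bar>" for N t using that by (auto simp: cl_def)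
  have "(\<lambda>N. \<integral>\<^sup>+ x. ennreal ((g x - cl N (g x))\<^sup>2) \<partial>lborel) \<longlonglongrightarrow> (\<integral>\<^sup>+ x. 0 \<partial>(lborel :: (real^'n) measure))"
  proof (rule nn_integral_dominated_convergence[where w="\<lambda>x. ennreal ((g x)\<^sup>2)"])
    show "AE x in lborel. ennreal ((g x - cl j (g x))\<^sup>2) \<le> ennreal ((g x)\<^sup>2)" for j
      by (intro AE_I2 ennreal_leI) (use cl_le in \<open>auto simp: abs_le_square_iff[symmetric]\<close>)
    show "AE x in lborel. (\<lambda>i. ennreal ((g x - cl i (g x))\<^sup>2)) \<longlonglongrightarrow> 0"
    proof (intro AE_I2 tendsto_eventually)
      fix x
      show "eventually (\<lambda>i. ennreal ((g x - cl i (g x))\<^sup>2) = 0) sequentially"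
        using eventually_ge_at_top[of "nat \<lceil>\<bar>g x\<bar>\<rceil>"]
        by eventually_elim (subst cl_eq, linarith, simp)
    qed
  qed (use fin in auto)
  then have "eventually (\<lambda>N. (\<integral>\<^sup>+ x. ennreal ((g x - cl N (g x))\<^sup>2) \<partial>lborel) < ennreal (e/4)) sequentially"
    using e by (intro order_tendstoD) auto
  then obtain N where N: "(\<integral>\<^sup>+ x. ennreal ((g x - cl N (g x))\<^sup>2) \<partial>lborel) < ennreal (e/4)"
    by (auto simp: eventually_sequentially)
  obtain h where h: "\<And>n::nat. continuous_on UNIV (h n)" and lim: "AE x in lborel. (\<lambda>n. h n x) \<longlonglongrightarrow> g x"
    using borel_pointwise_limit_continuous[of g] by auto
  have [measurable]: "h n \<in> borel_measurable borel" for n by (rule borel_measurable_continuous_onI[OF h])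
  have "(\<lambda>n. \<integral>\<^sup>+ x\<in>cball 0 R. ennreal ((cl N (g x) - cl N (h n x))\<^sup>2) \<partial>lborel) \<longlonglongrightarrow> (\<integral>\<^sup>+ x. 0 \<partial>(lborel :: (real^'n) measure))"
  proof (rule nn_integral_dominated_convergence[where w="\<lambda>x. ennreal ((2 * real N)\<^sup>2) * indicator (cball 0 R) x"])
    show "AE x in lborel. ennreal ((cl N (g x) - cl N (h j x))\<^sup>2) * indicator (cball 0 R) x
       \<le> ennreal ((2 * real N)\<^sup>2) * indicator (cball 0 R) x" for j
    proof (intro AE_I2 mult_right_mono ennreal_leI)
      fix x
      have "\<bar>cl N (g x) - cl N (h j x)\<bar> \<le> \<bar>2 * real N\<bar>"
        using cl_bd[of N "g x"] cl_bd[of N "h j x"] by linarith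
      then show "(cl N (g x) - cl N (h j x))\<^sup>2 \<le> (2 * real N)\<^sup>2"
        by (simp only: abs_le_square_iff)
    qed auto
    have "(\<integral>\<^sup>+ x. ennreal ((2 * real N)\<^sup>2) * indicator (cball (0::real^'n) R) x \<partial>lborel)
        = ennreal ((2 * real N)\<^sup>2) * emeasure lborel (cball (0::real^'n) R)"
      by (rule nn_integral_cmult_indicator) simp
    then show "(\<integral>\<^sup>+ x. ennreal ((2 * real N)\<^sup>2) * indicator (cball (0::real^'n) R) x \<partial>lborel) < \<infinity>"
      using emeasure_bounded_finite[of "cball (0::real^'n) R"] by (simp add: ennreal_mult_less_top)
    show "AE x in lborel. (\<lambda>i. ennreal ((cl N (g x) - cl N (h i x))\<^sup>2) * indicator (cball 0 R) x) \<longlonglongrightarrow> 0"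
      using lim
    proof eventually_elim
      case (elim x)
      have "isCont (cl N) (g x)" using cl_cont continuous_on_eq_continuous_at[OF open_UNIV, of "cl N"] by auto
      then have "(\<lambda>i. cl N (h i x)) \<longlonglongrightarrow> cl N (g x)"
        using elim by (rule isCont_tendsto_compose)
      then have "(\<lambda>i. (cl N (g x) - cl N (h i x))\<^sup>2) \<longlonglongrightarrow> (cl N (g x) - cl N (g x))\<^sup>2"
        by (intro tendsto_intros)
      then have "(\<lambda>i. ennreal ((cl N (g x) - cl N (h i x))\<^sup>2)) \<longlonglongrightarrow> ennreal 0"
        by (intro tendsto_ennrealI) simp
      then show ?case by (cases "x \<in> cball 0 R") (auto simp: indicator_def)
    qed
  qed auto
  then have "eventually (\<lambda>n. (\<integral>\<^sup>+ x\<in>cball 0 R. ennreal ((cl N (g x) - cl N (h n x))\<^sup>2) \<partial>lborel) < ennreal (e/4)) sequentially"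
    using e by (intro order_tendstoD) auto
  then obtain n where n: "(\<integral>\<^sup>+ x\<in>cball 0 R. ennreal ((cl N (g x) - cl N (h n x))\<^sup>2) \<partial>lborel) < ennreal (e/4)"
    by (auto simp: eventually_sequentially)
  define k where "k = (\<lambda>x. cl N (h n x))"
  have [measurable]: "k \<in> borel_measurable borel" unfolding k_def by measurable
  have "(\<integral>\<^sup>+ x\<in>cball 0 R. ennreal ((g x - k x)\<^sup>2) \<partial>lborel)
     \<le> (\<integral>\<^sup>+ x. 2 * ennreal ((g x - cl N (g x))\<^sup>2) + 2 * (ennreal ((cl N (g x) - k x)\<^sup>2) * indicator (cball 0 R) x) \<partial>lborel)"
  proof (intro nn_integral_mono)
    fix x
    have "(g x - k x)\<^sup>2 \<le> 2 * (g x - cl N (g x))\<^sup>2 + 2 * (cl N (g x) - k x)\<^sup>2"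
      using sum_squares_ge_zero[of "(g x - cl N (g x)) - (cl N (g x) - k x)" 0]
      by (simp add: power2_eq_square algebra_simps)
    then have "ennreal ((g x - k x)\<^sup>2) \<le> ennreal (2 * (g x - cl N (g x))\<^sup>2 + 2 * (cl N (g x) - k x)\<^sup>2)"
      by (rule ennreal_leI)
    also have "\<dots> = 2 * ennreal ((g x - cl N (g x))\<^sup>2) + 2 * ennreal ((cl N (g x) - k x)\<^sup>2)"
      by (simp add: ennreal_plus ennreal_mult')
    finally show "ennreal ((g x - k x)\<^sup>2) * indicator (cball 0 R) x
      \<le> 2 * ennreal ((g x - cl N (g x))\<^sup>2) + 2 * (ennreal ((cl N (g x) - k x)\<^sup>2) * indicator (cball 0 R) x)"
      by (cases "x \<in> cball 0 R") (auto simp: indicator_def)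
  qed
  also have "\<dots> = 2 * (\<integral>\<^sup>+ x. ennreal ((g x - cl N (g x))\<^sup>2) \<partial>lborel)
      + 2 * (\<integral>\<^sup>+ x\<in>cball 0 R. ennreal ((cl N (g x) - k x)\<^sup>2) \<partial>lborel)"
    by (simp add: nn_integral_add nn_integral_cmult)
  also have "\<dots> \<le> 2 * ennreal (e/4) + 2 * ennreal (e/4)"
    using N n by (intro add_mono mult_left_mono) (auto simp: k_def)
  also have "\<dots> = ennreal (2 * (e/4) + 2 * (e/4))"
    using e ennreal_mult[of 2 "e/4"] by (subst ennreal_plus) auto
  also have "\<dots> = ennreal e" by simp
  finally have "(\<integral>\<^sup>+ x\<in>cball 0 R. ennreal ((g x - k x)\<^sup>2) \<partial>lborel) \<le> ennreal e" .
  moreover have "continuous_on UNIV k"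
    unfolding k_def using continuous_on_compose2[OF cl_cont h] by auto
  ultimately show thesis by (intro that)
qed

lemma nn_integral_three_squares:
  fixes a b c :: "real^'n \<Rightarrow> real"
  assumes [measurable]: "a \<in> borel_measurable borel" "b \<in> borel_measurable borel" "c \<in> borel_measurable borel"
    and [measurable]: "K \<in> sets borel"
  shows "(\<integral>\<^sup>+ x\<in>K. ennreal ((a x + b x + c x)\<^sup>2) \<partial>lborel)
    \<le> 3 * ((\<integral>\<^sup>+ x\<in>K. ennreal ((a x)\<^sup>2) \<partial>lborel) + (\<integral>\<^sup>+ x\<in>K. ennreal ((b x)\<^sup>2) \<partial>lborel)
        + (\<integral>\<^sup>+ x\<in>K. ennreal ((c x)\<^sup>2) \<partial>lborel))"
proof -
  have "ennreal ((a x + b x + c x)\<^sup>2) \<le> 3 * (ennreal ((a x)\<^sup>2) + ennreal ((b x)\<^sup>2) + ennreal ((c x)\<^sup>2))" for x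
  proof -
    have "0 \<le> (a x - b x)\<^sup>2 + (b x - c x)\<^sup>2 + (a x - c x)\<^sup>2" by simp
    then have "(a x + b x + c x)\<^sup>2 \<le> 3 * ((a x)\<^sup>2 + (b x)\<^sup>2 + (c x)\<^sup>2)"
      by (simp add: power2_eq_square algebra_simps)
    then have "ennreal ((a x + b x + c x)\<^sup>2) \<le> ennreal (3 * ((a x)\<^sup>2 + (b x)\<^sup>2 + (c x)\<^sup>2))"
      by (rule ennreal_leI)
    then show ?thesis by (simp add: ennreal_mult' ennreal_plus)
  qed
  then have "(\<integral>\<^sup>+ x\<in>K. ennreal ((a x + b x + c x)\<^sup>2) \<partial>lborel)
      \<le> (\<integral>\<^sup>+ x. 3 * (ennreal ((a x)\<^sup>2) * indicator K x + ennreal ((b x)\<^sup>2) * indicator K x + ennreal ((c x)\<^sup>2) * indicator K x) \<partial>lborel)"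
    by (intro nn_integral_mono) (simp add: indicator_def)
  then show ?thesis by (simp add: nn_integral_add nn_integral_cmult)
qed

lemma integrable_of_square_integrable:
  fixes g :: "real^'n \<Rightarrow> real"
  assumes [measurable]: "g \<in> borel_measurable borel" and fin: "(\<integral>\<^sup>+ x. ennreal ((g x)\<^sup>2) \<partial>lborel) < \<infinity>"
    and supp: "\<And>x. x \<notin> cball 0 R \<Longrightarrow> g x = 0"
  shows "integrable lborel g" "integrable lborel (\<lambda>x. (g x)\<^sup>2)"
proof -
  show i2: "integrable lborel (\<lambda>x. (g x)\<^sup>2)"
    by (rule integrableI_bounded) (use fin in auto)
  have "integrable lborel (indicator (cball 0 R) :: real^'n \<Rightarrow> real)"
    using emeasure_bounded_finite[of "cball (0::real^'n) R"] by (simp add: integrable_indicator_iff)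
  then have "integrable lborel (\<lambda>x. (g x)\<^sup>2 + indicator (cball 0 R) x)"
    using i2 by (rule Bochner_Integration.integrable_add[rotated])
  then show "integrable lborel g"
  proof (rule Bochner_Integration.integrable_bound)
    show "AE x in lborel. norm (g x) \<le> norm ((g x)\<^sup>2 + indicat_real (cball 0 R) x)"
    proof (intro AE_I2)
      fix x
      have "\<bar>g x\<bar> \<le> (g x)\<^sup>2 + 1"
      proof -
        have "0 \<le> (\<bar>g x\<bar> - 1)\<^sup>2 + \<bar>g x\<bar>" by simp
        then show ?thesis by (simp add: power2_eq_square algebra_simps)
      qed
      then show "norm (g x) \<le> norm ((g x)\<^sup>2 + indicat_real (cball 0 R) x)"
        using supp[of x] by (cases "x \<in> cball 0 R") auto
    qed
  qed simp
qed

text \<open>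
  Replace \<open>g\<close> by a continuous function \<open>h\<close> close to it in mean square, for which the mollifications
  converge uniformly; the error is not increased by mollification (\<open>conv_square_integral_le\<close>).
  The ball of radius \<open>R + 1\<close> is used because mollifying looks beyond the ball of radius \<open>R\<close>.
\<close>

lemma conv_mean_square_limit:
  fixes g :: "real^'n \<Rightarrow> real"
  assumes g[measurable]: "g \<in> borel_measurable borel" and fin: "(\<integral>\<^sup>+ x. ennreal ((g x)\<^sup>2) \<partial>lborel) < \<infinity>"
    and supp: "\<And>x. x \<notin> cball 0 R \<Longrightarrow> g x = 0" and e: "(e::real) > 0"
  obtains d where "d > 0" "\<And>\<epsilon> \<rho>. \<epsilon> \<le> d \<Longrightarrow> mollifier \<epsilon> \<rho> \<Longrightarrow>
    (\<integral>\<^sup>+ x\<in>cball 0 R. ennreal ((conv g \<rho> x - g x)\<^sup>2) \<partial>lborel) \<le> ennreal e"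
proof -
  define V where "V = measure lborel (cball (0::real^'n) R)"
  have "V \<ge> 0" by (simp add: V_def)
  have emV: "emeasure lborel (cball (0::real^'n) R) = ennreal V"
    unfolding V_def using emeasure_bounded_finite[of "cball (0::real^'n) R"]
    by (intro emeasure_eq_ennreal_measure) auto
  define \<eta> where "\<eta> = sqrt (e / (9 * (V + 1)))"
  have \<eta>: "\<eta> > 0" "\<eta>\<^sup>2 * V \<le> e / 9"
    using e \<open>V \<ge> 0\<close> by (auto simp: \<eta>_def field_simps)
  obtain h where h: "continuous_on UNIV h"
      and hle: "(\<integral>\<^sup>+ x\<in>cball 0 (R+1). ennreal ((g x - h x)\<^sup>2) \<partial>lborel) \<le> ennreal (e/9)"
    using square_integrable_approx_continuous[OF g fin, of "e/9" "R+1"] e by auto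
  have [measurable]: "h \<in> borel_measurable borel" by (rule borel_measurable_continuous_onI[OF h])
  have "uniformly_continuous_on (cball 0 (R+1)) h"
    by (intro compact_uniformly_continuous) (auto intro: continuous_on_subset[OF h])
  then obtain d where d: "d > 0" "\<And>x y. x \<in> cball 0 (R+1) \<Longrightarrow> y \<in> cball 0 (R+1) \<Longrightarrow> dist x y < d \<Longrightarrow> \<bar>h y - h x\<bar> < \<eta>"
    using \<eta>(1) unfolding uniformly_continuous_on_def by (metis dist_commute dist_real_def)
  let ?I = "indicat_real (cball 0 (R+1))"
  define k where "k = (\<lambda>x. (g x - h x) * ?I x)"
  define h' where "h' = (\<lambda>x. h x * ?I x)"
  have [measurable]: "k \<in> borel_measurable borel" "h' \<in> borel_measurable borel" unfolding k_def h'_def by measurable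
  have kh: "g = (\<lambda>x. k x + h' x)"
  proof
    fix x show "g x = k x + h' x"
      using supp[of x] by (cases "x \<in> cball 0 (R+1)") (auto simp: k_def h'_def)
  qed
  have k2: "(\<integral>\<^sup>+ x. ennreal ((k x)\<^sup>2) \<partial>lborel) \<le> ennreal (e/9)"
  proof -
    have "(\<integral>\<^sup>+ x. ennreal ((k x)\<^sup>2) \<partial>lborel) = (\<integral>\<^sup>+ x\<in>cball 0 (R+1). ennreal ((g x - h x)\<^sup>2) \<partial>lborel)"
      by (intro nn_integral_cong) (auto simp: k_def indicator_def)
    with hle show ?thesis by simp
  qed
  have kfin: "(\<integral>\<^sup>+ x. ennreal ((k x)\<^sup>2) \<partial>lborel) < \<infinity>" using k2 by (simp add: order.strict_trans1)
  have ik: "integrable lborel k" "integrable lborel (\<lambda>x. (k x)\<^sup>2)"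
    by (rule integrable_of_square_integrable[where R="R+1", OF _ kfin]; simp add: k_def)+
  have ih: "integrable lborel h'"
    using borel_integrable_compact[of "cball 0 (R+1)" h] continuous_on_subset[OF h]
    by (simp add: h'_def mult.commute)
  show thesis
  proof (rule that[of "min d 1"])
    fix \<epsilon> :: real and \<rho> :: "real^'n \<Rightarrow> real"
    assume \<epsilon>: "\<epsilon> \<le> min d 1" and m: "mollifier \<epsilon> \<rho>"
    note C = C1_continuous[OF mollifier_C1[OF m]] mollifier_bounded_support[OF m]
    have [measurable]: "conv k \<rho> \<in> borel_measurable borel" "conv h' \<rho> \<in> borel_measurable borel"
      by (rule borel_measurable_continuous_onI[OF conv_continuous[OF _ C]]; fact)+
    have add: "conv g \<rho> x = conv k \<rho> x + conv h' \<rho> x" for x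
      using conv_integrand[OF ik(1) C, of x] conv_integrand[OF ih C, of x]
      by (simp add: kh conv_def ring_distribs)
    have eq: "conv g \<rho> x - g x = conv k \<rho> x + (conv h' \<rho> x - h' x) + (- k x)" for x
      using add[of x] kh by (metis (no_types, lifting) add_diff_eq diff_add_eq diff_diff_eq2 uminus_add_conv_diff add.commute)
    have "(\<integral>\<^sup>+ x\<in>cball 0 R. ennreal ((conv g \<rho> x - g x)\<^sup>2) \<partial>lborel)
      \<le> 3 * ((\<integral>\<^sup>+ x\<in>cball 0 R. ennreal ((conv k \<rho> x)\<^sup>2) \<partial>lborel) + (\<integral>\<^sup>+ x\<in>cball 0 R. ennreal ((conv h' \<rho> x - h' x)\<^sup>2) \<partial>lborel)
        + (\<integral>\<^sup>+ x\<in>cball 0 R. ennreal ((- k x)\<^sup>2) \<partial>lborel))"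
      unfolding eq by (rule nn_integral_three_squares) measurable
    also have "\<dots> \<le> 3 * (ennreal (e/9) + ennreal (e/9) + ennreal (e/9))"
    proof (intro mult_left_mono add_mono)
      have "(\<integral>\<^sup>+ x\<in>cball 0 R. ennreal ((conv k \<rho> x)\<^sup>2) \<partial>lborel) \<le> (\<integral>\<^sup>+ x. ennreal ((conv k \<rho> x)\<^sup>2) \<partial>lborel)"
        by (intro nn_integral_mono) (simp add: indicator_def)
      also have "\<dots> \<le> ennreal (e/9)" using conv_square_integral_le[OF ik m] k2 by (rule order_trans)
      finally show "(\<integral>\<^sup>+ x\<in>cball 0 R. ennreal ((conv k \<rho> x)\<^sup>2) \<partial>lborel) \<le> ennreal (e/9)" .
      have "(\<integral>\<^sup>+ x\<in>cball 0 R. ennreal ((- k x)\<^sup>2) \<partial>lborel) \<le> (\<integral>\<^sup>+ x. ennreal ((k x)\<^sup>2) \<partial>lborel)"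
        by (intro nn_integral_mono) (simp add: indicator_def)
      also note k2
      finally show "(\<integral>\<^sup>+ x\<in>cball 0 R. ennreal ((- k x)\<^sup>2) \<partial>lborel) \<le> ennreal (e/9)" .
      have "(\<integral>\<^sup>+ x\<in>cball 0 R. ennreal ((conv h' \<rho> x - h' x)\<^sup>2) \<partial>lborel) \<le> (\<integral>\<^sup>+ x\<in>cball (0::real^'n) R. ennreal (\<eta>\<^sup>2) \<partial>lborel)"
      proof (intro nn_integral_mono)
        fix x :: "real^'n"
        show "ennreal ((conv h' \<rho> x - h' x)\<^sup>2) * indicator (cball 0 R) x \<le> ennreal (\<eta>\<^sup>2) * indicator (cball 0 R) x"
        proof (cases "x \<in> cball 0 R")
          case True
          have "\<bar>conv h' \<rho> x - h' x\<bar> \<le> \<eta>"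
          proof (rule conv_mollifier_near[OF ih m])
            fix y assume y: "dist x y < \<epsilon>"
            then have "y \<in> cball 0 (R+1)" "x \<in> cball 0 (R+1)"
              using True \<epsilon> norm_triangle_ineq2[of y x] by (auto simp: dist_norm norm_minus_commute)
            then show "\<bar>h' y - h' x\<bar> \<le> \<eta>"
              using d(2)[of x y] y \<epsilon> by (simp add: h'_def)
          qed
          then have "(conv h' \<rho> x - h' x)\<^sup>2 \<le> \<eta>\<^sup>2"
            using \<eta>(1) by (simp add: abs_le_square_iff[symmetric])
          then show ?thesis by (intro mult_right_mono ennreal_leI) auto
        qed (simp add: indicator_def)
      qed
      also have "\<dots> = ennreal (\<eta>\<^sup>2) * emeasure lborel (cball (0::real^'n) R)"
        by (rule nn_integral_cmult_indicator) simp
      also have "\<dots> = ennreal (\<eta>\<^sup>2 * V)" using \<open>V \<ge> 0\<close> by (simp add: emV ennreal_mult)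
      also have "\<dots> \<le> ennreal (e/9)" by (rule ennreal_leI[OF \<eta>(2)])
      finally show "(\<integral>\<^sup>+ x\<in>cball 0 R. ennreal ((conv h' \<rho> x - h' x)\<^sup>2) \<partial>lborel) \<le> ennreal (e/9)" .
    qed simp
    also have "\<dots> = ennreal (3 * (e/9 + e/9 + e/9))"
      using e by (simp only: ennreal_plus[symmetric] ennreal_mult' ennreal_numeral[symmetric])
    also have "\<dots> = ennreal e" by simp
    finally show "(\<integral>\<^sup>+ x\<in>cball 0 R. ennreal ((conv g \<rho> x - g x)\<^sup>2) \<partial>lborel) \<le> ennreal e" .
  qed (use d in auto)
qed

text \<open>
  By commutativity the derivative may be moved to \<open>\<phi>\<close>, so the gradient of the mollification is the
  mollification of the gradient, which is uniformly continuous.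
\<close>

lemma conv_gradient_uniform_limit:
  fixes \<phi> :: "real^'n \<Rightarrow> real"
  assumes \<phi>: "C1 \<phi>" "bounded {x. \<phi> x \<noteq> 0}" and \<eta>: "\<eta> > 0"
  obtains d where "d > 0" "\<And>\<epsilon> \<rho> x. \<epsilon> \<le> d \<Longrightarrow> mollifier \<epsilon> \<rho> \<Longrightarrow>
    norm (gradient (conv \<phi> \<rho>) x - gradient \<phi> x) \<le> \<eta>"
proof -
  let ?n = "real CARD('n)"
  have n: "?n > 0" by simp
  obtain d where d: "d > 0" "\<And>x y. dist x y < d \<Longrightarrow> norm (gradient \<phi> x - gradient \<phi> y) < \<eta> / ?n"
    using uniformly_continuous_compact_support[OF C1_continuous_gradient[OF \<phi>(1)] bounded_gradient_support[OF \<phi>(2)], of "\<eta> / ?n"]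
      \<eta> n by (metis divide_pos_pos)
  show thesis
  proof (rule that[OF d(1)])
    fix \<epsilon> :: real and \<rho> :: "real^'n \<Rightarrow> real" and x assume \<epsilon>: "\<epsilon> \<le> d" and m: "mollifier \<epsilon> \<rho>"
    have i\<rho>: "integrable lborel \<rho>" using m by (simp add: mollifier_def)
    have i\<phi>: "integrable lborel \<phi>" by (rule integrable_compact_support[OF C1_continuous[OF \<phi>(1)] \<phi>(2)])
    have meas: "\<rho> \<in> borel_measurable borel" "\<phi> \<in> borel_measurable borel"
      using borel_measurable_integrable[OF i\<rho>] borel_measurable_integrable[OF i\<phi>] by simp_all
    have *: "\<bar>(gradient (conv \<phi> \<rho>) x - gradient \<phi> x) $ i\<bar> \<le> \<eta> / ?n" for i
    proof -
      let ?p = "\<lambda>z. gradient \<phi> z $ i"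
      have c: "continuous_on UNIV ?p" using C1_continuous_gradient[OF \<phi>(1)] by (intro continuous_intros)
      have ip: "integrable lborel ?p"
        by (rule integrable_compact_support[OF c], rule bounded_subset[OF bounded_gradient_support[OF \<phi>(2)]]) auto
      have "gradient (conv \<phi> \<rho>) x $ i = gradient (conv \<rho> \<phi>) x $ i"
        by (simp add: conv_commute[OF meas])
      also have "\<dots> = conv \<rho> ?p x" by (rule conv_gradient[OF i\<rho> \<phi>])
      also have "\<dots> = conv ?p \<rho> x"
        using conv_commute[OF meas(1), of ?p] borel_measurable_integrable[OF ip] by simp
      finally have eq: "gradient (conv \<phi> \<rho>) x $ i = conv ?p \<rho> x" .
      have "\<bar>conv ?p \<rho> x - ?p x\<bar> \<le> \<eta> / ?n"
      proof (rule conv_mollifier_near[OF ip m])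
        fix y assume "dist x y < \<epsilon>"
        then have "norm (gradient \<phi> y - gradient \<phi> x) < \<eta> / ?n" using \<epsilon> by (intro d) (simp add: dist_commute)
        then show "\<bar>?p y - ?p x\<bar> \<le> \<eta> / ?n"
          using component_le_norm_cart[of "gradient \<phi> y - gradient \<phi> x" i] by simp
      qed
      then show ?thesis by (simp add: eq)
    qed
    have "norm (gradient (conv \<phi> \<rho>) x - gradient \<phi> x) \<le> (\<Sum>i\<in>UNIV. \<bar>(gradient (conv \<phi> \<rho>) x - gradient \<phi> x) $ i\<bar>)"
      by (rule norm_le_l1_cart)
    also have "\<dots> \<le> (\<Sum>i\<in>(UNIV::'n set). \<eta> / ?n)" by (intro sum_mono *)
    also have "\<dots> = \<eta>" by simp
    finally show "norm (gradient (conv \<phi> \<rho>) x - gradient \<phi> x) \<le> \<eta>" .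
  qed
qed

lemma conv_support:
  assumes m: "mollifier \<epsilon> \<rho>" and "conv \<phi> \<rho> x \<noteq> 0"
  obtains y where "\<phi> y \<noteq> 0" "dist x y < \<epsilon>"
proof -
  have "\<exists>y. \<phi> y * \<rho> (x - y) \<noteq> 0"
  proof (rule ccontr)
    assume "\<not> ?thesis"
    then have "(\<lambda>y. \<phi> y * \<rho> (x - y)) = (\<lambda>_. 0)" by blast
    then have "conv \<phi> \<rho> x = 0" by (simp add: conv_def)
    with assms show False by simp
  qed
  then obtain y where "\<phi> y \<noteq> 0" "\<rho> (x - y) \<noteq> 0" by auto
  with m that show thesis by (force simp: mollifier_def dist_norm not_le[symmetric])
qed

section \<open>Test functions of class C1\<close>

lemma C1_borel: "C1 f \<Longrightarrow> f \<in> borel_measurable borel" "C1 f \<Longrightarrow> gradient f \<in> borel_measurable borel"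
  for f :: "real^'n \<Rightarrow> real"
  by (auto intro!: borel_measurable_continuous_onI C1_continuous C1_continuous_gradient)

lemma integrable_inner_gradient:
  fixes F :: "real^'n \<Rightarrow> real^'n"
  assumes F: "integrable lborel F" and \<phi>: "C1 \<phi>" "bounded {x. \<phi> x \<noteq> 0}"
  shows "integrable lborel (\<lambda>x. F x \<bullet> gradient \<phi> x)"
proof -
  obtain B where B: "B > 0" "\<And>x. norm (gradient \<phi> x) \<le> B"
    using bounded_range_compact_support[OF C1_continuous_gradient[OF \<phi>(1)] bounded_gradient_support[OF \<phi>(2)]] by metis
  show ?thesis
  proof (rule Bochner_Integration.integrable_bound)
  show "integrable lborel (\<lambda>x. B * norm (F x))" using F by auto
  show "AE x in lborel. norm (F x \<bullet> gradient \<phi> x) \<le> norm (B * norm (F x))"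
  proof (intro AE_I2)
    fix x
    have "\<bar>F x \<bullet> gradient \<phi> x\<bar> \<le> norm (F x) * norm (gradient \<phi> x)" by (rule Cauchy_Schwarz_ineq2)
    also have "\<dots> \<le> norm (F x) * B" using B by (intro mult_left_mono) auto
    finally show "norm (F x \<bullet> gradient \<phi> x) \<le> norm (B * norm (F x))" using B by (simp add: mult.commute)
  qed
  have [measurable]: "F \<in> borel_measurable borel" "gradient \<phi> \<in> borel_measurable borel"
    using borel_measurable_integrable[OF F] C1_borel[OF \<phi>(1)] by simp_all
  show "(\<lambda>x. F x \<bullet> gradient \<phi> x) \<in> borel_measurable lborel" by measurable
  qed
qed

lemma compact_in_open_margin:
  fixes K :: "(real^'n) set"
  assumes "compact K" "open U" "K \<subseteq> U"
  obtains d where "d > 0" "\<And>x y. x \<in> K \<Longrightarrow> dist x y < d \<Longrightarrow> y \<in> U"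
proof (cases "K = {} \<or> U = UNIV")
  case True
  then show thesis using assms by (intro that[of 1]) auto
next
  case False
  have "0 < setdist K (- U)"
    using assms False setdist_gt_0_compact_closed[of K "- U"] by auto
  moreover have "y \<in> U" if "x \<in> K" "dist x y < setdist K (- U)" for x y
    using that setdist_le_dist[of x K y "- U"] by force
  ultimately show thesis by (intro that)
qed

text \<open>
  Mollifying a C1 function with compact support in \<open>U\<close> gives admissible test functions whose
  gradients converge uniformly, and \<open>F\<close> is integrable. The chain rule applied to approximate
  solutions produces C1 functions only, so smooth test functions would not be enough.
\<close>

lemma weak_equation_C1_test:
  fixes F :: "real^'n \<Rightarrow> real^'n"
  assumes F: "integrable lborel F" and U: "open U"
    and eq: "\<And>\<phi>. \<phi> \<in> test_functions U \<Longrightarrow> (\<integral> x. F x \<bullet> gradient \<phi> x \<partial>lborel) = 0"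
    and \<phi>: "C1 \<phi>" and K: "compact K" "K \<subseteq> U" "\<And>x. x \<notin> K \<Longrightarrow> \<phi> x = 0"
  shows "(\<integral> x. F x \<bullet> gradient \<phi> x \<partial>lborel) = 0"
proof -
  have supp: "bounded {x. \<phi> x \<noteq> 0}"
    by (rule bounded_subset[OF compact_imp_bounded[OF K(1)]]) (use K in auto)
  have i\<phi>: "integrable lborel \<phi>" by (rule integrable_compact_support[OF C1_continuous[OF \<phi>] supp])
  obtain r where r: "r > 0" "\<And>x y. x \<in> K \<Longrightarrow> dist x y < r \<Longrightarrow> y \<in> U"
    using compact_in_open_margin[OF K(1) U K(2)] by metis
  let ?N = "\<integral> x. norm (F x) \<partial>lborel"
  have bound: "\<bar>\<integral> x. F x \<bullet> gradient \<phi> x \<partial>lborel\<bar> \<le> \<eta> * ?N" if \<eta>: "\<eta> > 0" for \<eta>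
  proof -
    obtain d where d: "d > 0" "\<And>\<epsilon> \<rho> x. \<epsilon> \<le> d \<Longrightarrow> mollifier \<epsilon> \<rho> \<Longrightarrow>
        norm (gradient (conv \<phi> \<rho>) x - gradient \<phi> x) \<le> \<eta>"
      using conv_gradient_uniform_limit[OF \<phi> supp \<eta>] by blast
    define \<epsilon> where "\<epsilon> = min d (r/2)"
    have \<epsilon>: "\<epsilon> > 0" "\<epsilon> \<le> d" "\<epsilon> < r" using d r by (auto simp: \<epsilon>_def)
    obtain \<rho> :: "real^'n \<Rightarrow> real" where m: "mollifier \<epsilon> \<rho>" using exists_mollifier[OF \<epsilon>(1)] by blast
    let ?p = "conv \<phi> \<rho>"
    have Ck: "Ck k ?p" for k
      by (rule Ck_conv[OF i\<phi> _ mollifier_bounded_support[OF m]]) (use m in \<open>simp add: mollifier_def\<close>)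
    have sub: "{x. ?p x \<noteq> 0} \<subseteq> (\<Union>x\<in>K. \<Union>y\<in>cball 0 \<epsilon>. {x + y})"
    proof
      fix x assume "x \<in> {x. ?p x \<noteq> 0}"
      then obtain y where "\<phi> y \<noteq> 0" "dist x y < \<epsilon>" using conv_support[OF m] by blast
      then have "y \<in> K" "x = y + (x - y)" "x - y \<in> cball 0 \<epsilon>" using K(3)[of y] by (auto simp: dist_norm norm_minus_commute)
      then show "x \<in> (\<Union>x\<in>K. \<Union>y\<in>cball 0 \<epsilon>. {x + y})" by blast
    qed
    have comp: "compact (\<Union>x\<in>K. \<Union>y\<in>cball 0 \<epsilon>. {x + y})" by (rule compact_sums'[OF K(1) compact_cball])
    have cl: "closure {x. ?p x \<noteq> 0} \<subseteq> (\<Union>x\<in>K. \<Union>y\<in>cball 0 \<epsilon>. {x + y})"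
      by (rule closure_minimal[OF sub compact_imp_closed[OF comp]])
    have bp: "bounded {x. ?p x \<noteq> 0}" by (rule bounded_subset[OF compact_imp_bounded[OF comp] sub])
    have "(\<Union>x\<in>K. \<Union>y\<in>cball 0 \<epsilon>. {x + y}) \<subseteq> U"
      using r \<epsilon> by (force simp: dist_norm)
    then have "?p \<in> test_functions U"
      unfolding test_functions_def using Ck cl bp by (auto simp: compact_closure)
    then have e0: "(\<integral> x. F x \<bullet> gradient ?p x \<partial>lborel) = 0" by (rule eq)
    have Cp: "C1 ?p" using Ck[of "Suc 0"] by (simp only: C1_iff_Ck)
    note int = integrable_inner_gradient[OF F]
    have "(\<integral> x. F x \<bullet> gradient \<phi> x \<partial>lborel) = (\<integral> x. F x \<bullet> gradient \<phi> x - F x \<bullet> gradient ?p x \<partial>lborel)"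
      using int[OF \<phi> supp] int[OF Cp bp] e0 by simp
    also have "norm \<dots> \<le> (\<integral> x. \<eta> * norm (F x) \<partial>lborel)"
    proof (rule Bochner_Integration.integral_norm_bound_integral)
      fix x
      have "\<bar>F x \<bullet> (gradient \<phi> x - gradient ?p x)\<bar> \<le> norm (F x) * norm (gradient \<phi> x - gradient ?p x)"
        by (rule Cauchy_Schwarz_ineq2)
      also have "\<dots> \<le> norm (F x) * \<eta>"
        using d(2)[OF \<epsilon>(2) m, of x] by (intro mult_left_mono) (auto simp: norm_minus_commute)
      finally show "norm (F x \<bullet> gradient \<phi> x - F x \<bullet> gradient ?p x) \<le> \<eta> * norm (F x)"
        by (simp add: inner_diff_right mult.commute)
    qed (use int[OF \<phi> supp] int[OF Cp bp] F in auto)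
    finally show ?thesis by simp
  qed
  show ?thesis
  proof (rule ccontr)
    assume n: "(\<integral> x. F x \<bullet> gradient \<phi> x \<partial>lborel) \<noteq> 0"
    define I N where "I = \<bar>\<integral> x. F x \<bullet> gradient \<phi> x \<partial>lborel\<bar>" and "N = ?N"
    have N: "N \<ge> 0" by (simp add: N_def)
    have I: "I > 0" using n by (simp add: I_def)
    have "I / (2 * (N + 1)) > 0" using I N by (intro divide_pos_pos) auto
    then have "I \<le> (I / (2 * (N + 1))) * N" using bound by (simp only: I_def N_def)
    moreover have "(I / (2 * (N + 1))) * N < I"
      using N I by (simp add: field_simps) (smt (verit) mult_nonneg_nonneg)
    ultimately show False by simp
  qed
qed

text \<open>
  Capacity is defined by smooth functions, but mollification makes competitors of class C1
  equally good. Requiring \<open>\<phi> \<ge> 1\<close> within distance \<open>\<delta>\<close> of \<open>K\<close> leaves room to mollify.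
\<close>

lemma cap2_le_C1:
  fixes \<phi> :: "real^'n \<Rightarrow> real"
  assumes \<phi>: "C1 \<phi>" "bounded {x. \<phi> x \<noteq> 0}" and \<delta>: "\<delta> > 0"
    and ge: "\<And>x y. y \<in> K \<Longrightarrow> dist x y < \<delta> \<Longrightarrow> \<phi> x \<ge> 1"
  shows "cap2 K \<le> (\<integral>\<^sup>+ x. ennreal ((norm (gradient \<phi> x))\<^sup>2) \<partial>lborel)"
proof -
  have i\<phi>: "integrable lborel \<phi>" by (rule integrable_compact_support[OF C1_continuous[OF \<phi>(1)] \<phi>(2)])
  obtain B where B: "B > 0" "\<And>x. norm (gradient \<phi> x) \<le> B"
    using bounded_range_compact_support[OF C1_continuous_gradient[OF \<phi>(1)] bounded_gradient_support[OF \<phi>(2)]] by metis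
  have [measurable]: "gradient \<phi> \<in> borel_measurable borel" using C1_borel[OF \<phi>(1)] by simp
  obtain R where R: "R > 0" "\<And>x. \<phi> x \<noteq> 0 \<Longrightarrow> norm x \<le> R" using \<phi>(2) unfolding bounded_pos by auto
  define V where "V = measure lborel (cball (0::real^'n) (R+1))"
  have "V \<ge> 0" by (simp add: V_def)
  have emV: "emeasure lborel (cball (0::real^'n) (R+1)) = ennreal V"
    unfolding V_def using emeasure_bounded_finite[of "cball (0::real^'n) (R+1)"]
    by (intro emeasure_eq_ennreal_measure) auto
  let ?J = "\<integral>\<^sup>+ x. ennreal ((norm (gradient \<phi> x))\<^sup>2) \<partial>lborel"
  have bound: "cap2 K \<le> ?J + ennreal ((2 * B * \<eta> + \<eta>\<^sup>2) * V)" if \<eta>: "\<eta> > 0" for \<eta>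
  proof -
    obtain d where d: "d > 0" "\<And>\<epsilon> \<rho> x. \<epsilon> \<le> d \<Longrightarrow> mollifier \<epsilon> \<rho> \<Longrightarrow>
        norm (gradient (conv \<phi> \<rho>) x - gradient \<phi> x) \<le> \<eta>"
      using conv_gradient_uniform_limit[OF \<phi> \<eta>] by blast
    define \<epsilon> where "\<epsilon> = min d (min 1 (\<delta>/2))"
    have \<epsilon>: "\<epsilon> > 0" "\<epsilon> \<le> d" "\<epsilon> \<le> \<delta>/2" "\<epsilon> \<le> 1" using d \<delta> by (auto simp: \<epsilon>_def)
    obtain \<rho> :: "real^'n \<Rightarrow> real" where m: "mollifier \<epsilon> \<rho>" using exists_mollifier[OF \<epsilon>(1)] by blast
    let ?p = "conv \<phi> \<rho>"
    have Ck: "Ck k ?p" for k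
      by (rule Ck_conv[OF i\<phi> _ mollifier_bounded_support[OF m]]) (use m in \<open>simp add: mollifier_def\<close>)
    have sub: "{x. ?p x \<noteq> 0} \<subseteq> cball 0 (R+1)"
    proof
      fix x assume "x \<in> {x. ?p x \<noteq> 0}"
      then obtain y where "\<phi> y \<noteq> 0" "dist x y < \<epsilon>" using conv_support[OF m] by blast
      then show "x \<in> cball 0 (R+1)" using R(2)[of y] \<epsilon> norm_triangle_ineq2[of x y] by (auto simp: dist_norm)
    qed
    have cl: "closure {x. ?p x \<noteq> 0} \<subseteq> cball 0 (R+1)" by (rule closure_minimal[OF sub]) simp
    have bp: "bounded {x. ?p x \<noteq> 0}" by (rule bounded_subset[OF _ sub]) simp
    have T: "?p \<in> test_functions UNIV"
      unfolding test_functions_def using Ck bp by (auto simp: compact_closure)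
    have "K \<subseteq> interior {x. ?p x \<ge> 1}"
    proof (rule subsetI, rule interiorI)
      fix y assume y: "y \<in> K"
      show "ball y (\<delta>/2) \<subseteq> {x. ?p x \<ge> 1}"
      proof safe
        fix x assume x: "x \<in> ball y (\<delta>/2)"
        show "1 \<le> ?p x"
        proof (rule conv_mollifier_ge[OF i\<phi> m])
          fix z assume "dist x z < \<epsilon>"
          then have "dist z y < \<delta>" using x \<epsilon> dist_triangle[of z y x] by (auto simp: dist_commute)
          then show "1 \<le> \<phi> z" by (rule ge[OF y])
        qed
      qed
    qed (use \<delta> in auto)
    then have "cap2 K \<le> (\<integral>\<^sup>+ x. ennreal ((norm (gradient ?p x))\<^sup>2) \<partial>lborel)"
      unfolding cap2_def using T by (intro INF_lower) auto
    also have "\<dots> \<le> (\<integral>\<^sup>+ x. ennreal ((norm (gradient \<phi> x))\<^sup>2) + ennreal (2 * B * \<eta> + \<eta>\<^sup>2) * indicator (cball 0 (R+1)) x \<partial>lborel)"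
    proof (intro nn_integral_mono)
      fix x
      show "ennreal ((norm (gradient ?p x))\<^sup>2) \<le> ennreal ((norm (gradient \<phi> x))\<^sup>2) + ennreal (2 * B * \<eta> + \<eta>\<^sup>2) * indicator (cball 0 (R+1)) x"
      proof (cases "x \<in> cball 0 (R+1)")
        case True
        have "norm (gradient ?p x) \<le> norm (gradient \<phi> x) + \<eta>"
          using d(2)[OF \<epsilon>(2) m, of x] norm_triangle_ineq2[of "gradient ?p x" "gradient \<phi> x"] by linarith
        then have "(norm (gradient ?p x))\<^sup>2 \<le> (norm (gradient \<phi> x) + \<eta>)\<^sup>2" by (intro power_mono) auto
        also have "\<dots> = (norm (gradient \<phi> x))\<^sup>2 + (2 * norm (gradient \<phi> x) * \<eta> + \<eta>\<^sup>2)"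
          by (simp add: power2_eq_square algebra_simps)
        also have "\<dots> \<le> (norm (gradient \<phi> x))\<^sup>2 + (2 * B * \<eta> + \<eta>\<^sup>2)"
          using B(2)[of x] \<eta> by (intro add_mono mult_right_mono mult_left_mono) auto
        finally have "ennreal ((norm (gradient ?p x))\<^sup>2) \<le> ennreal ((norm (gradient \<phi> x))\<^sup>2 + (2 * B * \<eta> + \<eta>\<^sup>2))"
          by (rule ennreal_leI)
        then show ?thesis using True \<eta> B by (simp add: ennreal_plus)
      next
        case False
        then have "gradient ?p x = 0" using cl by (intro gradient_eq_0_off_support) auto
        then show ?thesis by simp
      qed
    qed
    also have "\<dots> = ?J + ennreal (2 * B * \<eta> + \<eta>\<^sup>2) * emeasure lborel (cball (0::real^'n) (R+1))"
      by (subst nn_integral_add) (auto simp: nn_integral_cmult_indicator)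
    also have "\<dots> = ?J + ennreal ((2 * B * \<eta> + \<eta>\<^sup>2) * V)"
      using \<open>V \<ge> 0\<close> \<eta> B by (simp add: emV ennreal_mult)
    finally show ?thesis .
  qed
  show ?thesis
  proof (rule ennreal_le_epsilon)
    fix e :: real assume e: "e > 0"
    define P where "P = (2 * B + 1) * (V + 1)"
    have P: "P > 0" unfolding P_def using B \<open>V \<ge> 0\<close> by (intro mult_pos_pos) auto
    define \<eta> where "\<eta> = min 1 (e / P)"
    have \<eta>: "\<eta> > 0" "\<eta> \<le> 1" using e P by (auto simp: \<eta>_def)
    have "\<eta> \<le> e / P" by (simp add: \<eta>_def)
    then have \<eta>P: "\<eta> * P \<le> e" using P by (simp add: pos_le_divide_eq)
    have "(2 * B * \<eta> + \<eta>\<^sup>2) * V \<le> (\<eta> * (2 * B + 1)) * (V + 1)"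
      using \<eta> B \<open>V \<ge> 0\<close> mult_left_mono[OF \<eta>(2), of \<eta>]
      by (intro mult_mono) (auto simp: power2_eq_square algebra_simps)
    also have "\<dots> \<le> e" using \<eta>P by (simp only: mult.assoc P_def)
    finally have "ennreal ((2 * B * \<eta> + \<eta>\<^sup>2) * V) \<le> ennreal e" by (rule ennreal_leI)
    then show "cap2 K \<le> ?J + ennreal e"
      using bound[OF \<eta>(1)] by (meson add_left_mono order_trans)
  qed
qed

section \<open>Translation, Faber-Krahn and Poincare inequalities\<close>

text \<open>
  The increment is the integral of the directional derivative along the segment from \<open>x\<close> to
  \<open>x + h\<close>, which stays in the convex set. By Jensen's inequality and Fubini's theorem the claim
  reduces to the invariance of Lebesgue measure under the translations by \<open>t *\<^sub>R h\<close>.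
\<close>

lemma translation_increment_le:
  fixes f :: "real^'n \<Rightarrow> real"
  assumes f: "C1 f" and S: "convex S" and [measurable]: "S \<in> sets borel"
  shows "(\<integral>\<^sup>+ x. ennreal ((f (x + h) - f x)\<^sup>2) * indicator S x * indicator S (x + h) \<partial>lborel)
     \<le> ennreal ((norm h)\<^sup>2) * (\<integral>\<^sup>+ x\<in>S. ennreal ((norm (gradient f x))\<^sup>2) \<partial>lborel)"
proof -
  have [measurable]: "f \<in> borel_measurable borel" "gradient f \<in> borel_measurable borel"
    using C1_borel[OF f] by simp_all
  have line: "ennreal ((f (x + h) - f x)\<^sup>2) \<le> (\<integral>\<^sup>+ t\<in>{0..1}. ennreal ((norm h)\<^sup>2 * (norm (gradient f (x + t *\<^sub>R h)))\<^sup>2) \<partial>lborel)" for x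
  proof -
    define a where "a = (\<lambda>t. gradient f (x + t *\<^sub>R h) \<bullet> h)"
    define c where "c = f (x + h) - f x"
    have ca: "continuous_on UNIV a" unfolding a_def
      by (intro continuous_intros continuous_on_compose2[OF C1_continuous_gradient[OF f, of UNIV]]) auto
    let ?i = "indicat_real {0..1::real}"
    have Ic: "(\<integral> t. a t * ?i t \<partial>lborel) = f (x + 1 *\<^sub>R h) - f (x + 0 *\<^sub>R h)"
      by (rule integral_FTC_Icc_real) (use C1_line_DERIV[OF f] ca in \<open>auto simp: a_def continuous_on_eq_continuous_at\<close>)
    have int: "integrable lborel (\<lambda>t. k t * ?i t)" if "continuous_on UNIV k" for k :: "real \<Rightarrow> real"
      using borel_integrable_compact[of "{0..1}" k] continuous_on_subset[OF that] by (simp add: mult.commute)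
    have i1: "integrable lborel (\<lambda>t. a t * ?i t)" by (rule int[OF ca])
    have i2: "integrable lborel (\<lambda>t. (a t)\<^sup>2 * ?i t)" by (rule int) (intro continuous_intros ca)
    have i3: "integrable lborel (\<lambda>t. 1 * ?i t)" by (rule int) (intro continuous_intros)
    have I3: "(\<integral> t. ?i t \<partial>lborel) = 1" by simp
    \<comment> \<open>Jensen's inequality again: \<open>c\<close> is the mean of \<open>a\<close> over \<open>{0..1}\<close>.\<close>
    have "0 \<le> (\<integral> t. (a t - c)\<^sup>2 * ?i t \<partial>lborel)" by simp
    also have "\<dots> = (\<integral> t. (a t)\<^sup>2 * ?i t - (2 * c) * (a t * ?i t) + c\<^sup>2 * ?i t \<partial>lborel)"
      by (simp add: power2_eq_square algebra_simps)
    also have "\<dots> = (\<integral> t. (a t)\<^sup>2 * ?i t \<partial>lborel) - (2 * c) * c + c\<^sup>2 * 1"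
      using i1 i2 i3 Ic I3 by (simp add: c_def)
    finally have "c\<^sup>2 \<le> (\<integral> t. (a t)\<^sup>2 * ?i t \<partial>lborel)" by (simp add: power2_eq_square)
    then have "ennreal (c\<^sup>2) \<le> ennreal (\<integral> t. (a t)\<^sup>2 * ?i t \<partial>lborel)" by (rule ennreal_leI)
    also have "\<dots> = (\<integral>\<^sup>+ t. ennreal ((a t)\<^sup>2 * ?i t) \<partial>lborel)" using nn_integral_eq_integral[OF i2] by simp
    also have "\<dots> \<le> (\<integral>\<^sup>+ t\<in>{0..1}. ennreal ((norm h)\<^sup>2 * (norm (gradient f (x + t *\<^sub>R h)))\<^sup>2) \<partial>lborel)"
    proof (intro nn_integral_mono)
      fix t :: real
      have "\<bar>a t\<bar> \<le> \<bar>norm (gradient f (x + t *\<^sub>R h)) * norm h\<bar>"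
        unfolding a_def using Cauchy_Schwarz_ineq2[of "gradient f (x + t *\<^sub>R h)" h] by simp
      then have "(a t)\<^sup>2 \<le> (norm (gradient f (x + t *\<^sub>R h)) * norm h)\<^sup>2" by (simp only: abs_le_square_iff)
      then have "(a t)\<^sup>2 \<le> (norm h)\<^sup>2 * (norm (gradient f (x + t *\<^sub>R h)))\<^sup>2" by (simp add: power_mult_distrib mult.commute)
      then show "ennreal ((a t)\<^sup>2 * ?i t) \<le> ennreal ((norm h)\<^sup>2 * (norm (gradient f (x + t *\<^sub>R h)))\<^sup>2) * indicator {0..1} t"
        by (cases "t \<in> {0..1}") (auto intro: ennreal_leI)
    qed
    finally show ?thesis by (simp add: c_def)
  qed
  have "(\<integral>\<^sup>+ x. ennreal ((f (x + h) - f x)\<^sup>2) * indicator S x * indicator S (x + h) \<partial>lborel)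
    \<le> (\<integral>\<^sup>+ x. (\<integral>\<^sup>+ t. indicator {0..1} t * (ennreal ((norm h)\<^sup>2) * (ennreal ((norm (gradient f (x + t *\<^sub>R h)))\<^sup>2) * indicator S (x + t *\<^sub>R h))) \<partial>lborel) \<partial>lborel)"
  proof (intro nn_integral_mono)
    fix x
    show "ennreal ((f (x + h) - f x)\<^sup>2) * indicator S x * indicator S (x + h)
      \<le> (\<integral>\<^sup>+ t. indicator {0..1} t * (ennreal ((norm h)\<^sup>2) * (ennreal ((norm (gradient f (x + t *\<^sub>R h)))\<^sup>2) * indicator S (x + t *\<^sub>R h))) \<partial>lborel)"
    proof (cases "x \<in> S \<and> x + h \<in> S")
      case True
      have "x + t *\<^sub>R h \<in> S" if "t \<in> {0..1}" for t
      proof -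
        have "(1 - t) *\<^sub>R x + t *\<^sub>R (x + h) \<in> S" using S True that by (intro convexD) auto
        then show ?thesis by (simp add: algebra_simps)
      qed
      then have "(\<integral>\<^sup>+ t\<in>{0..1}. ennreal ((norm h)\<^sup>2 * (norm (gradient f (x + t *\<^sub>R h)))\<^sup>2) \<partial>lborel)
         = (\<integral>\<^sup>+ t. indicator {0..1} t * (ennreal ((norm h)\<^sup>2) * (ennreal ((norm (gradient f (x + t *\<^sub>R h)))\<^sup>2) * indicator S (x + t *\<^sub>R h))) \<partial>lborel)"
        by (intro nn_integral_cong) (auto simp: indicator_def ennreal_mult)
      with line[of x] True show ?thesis by simp
    qed auto
  qed
  also have "\<dots> = (\<integral>\<^sup>+ t. (\<integral>\<^sup>+ x. indicator {0..1} t * (ennreal ((norm h)\<^sup>2) * (ennreal ((norm (gradient f (x + t *\<^sub>R h)))\<^sup>2) * indicator S (x + t *\<^sub>R h))) \<partial>lborel) \<partial>(lborel :: real measure))"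
    by (rule lborel_pair.Fubini'[symmetric]) measurable
  also have "\<dots> = (\<integral>\<^sup>+ t. indicator {0..1::real} t * (ennreal ((norm h)\<^sup>2) * (\<integral>\<^sup>+ x\<in>S. ennreal ((norm (gradient f x))\<^sup>2) \<partial>lborel)) \<partial>lborel)"
  proof (intro nn_integral_cong)
    fix t :: real
    have "(\<integral>\<^sup>+ x. ennreal ((norm (gradient f (x + t *\<^sub>R h)))\<^sup>2) * indicator S (x + t *\<^sub>R h) \<partial>lborel)
       = (\<integral>\<^sup>+ x\<in>S. ennreal ((norm (gradient f x))\<^sup>2) \<partial>lborel)"
      by (rule nn_integral_translate[of "\<lambda>x. ennreal ((norm (gradient f x))\<^sup>2) * indicator S x"]) measurable
    then show "(\<integral>\<^sup>+ x. indicator {0..1} t * (ennreal ((norm h)\<^sup>2) * (ennreal ((norm (gradient f (x + t *\<^sub>R h)))\<^sup>2) * indicator S (x + t *\<^sub>R h))) \<partial>lborel)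
      = indicator {0..1::real} t * (ennreal ((norm h)\<^sup>2) * (\<integral>\<^sup>+ x\<in>S. ennreal ((norm (gradient f x))\<^sup>2) \<partial>lborel))"
      by (simp add: nn_integral_cmult)
  qed
  also have "\<dots> = ennreal ((norm h)\<^sup>2) * (\<integral>\<^sup>+ x\<in>S. ennreal ((norm (gradient f x))\<^sup>2) \<partial>lborel)"
    by (simp add: nn_integral_multc)
  finally show ?thesis .
qed

lemma emeasure_ball_pos_finite:
  assumes "r > 0"
  shows "emeasure lborel (ball (x::real^'n) r) \<noteq> 0" "emeasure lborel (ball (x::real^'n) r) \<noteq> top"
proof -
  have "unit_ball_vol (real CARD('n)) > 0" by simp
  then have "unit_ball_vol (real CARD('n)) * r ^ CARD('n) > 0" using assms by simp
  then show "emeasure lborel (ball (x::real^'n) r) \<noteq> 0" "emeasure lborel (ball (x::real^'n) r) \<noteq> top"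
    using assms by (simp_all add: emeasure_ball ennreal_eq_0_iff not_le)
qed

lemma AE_avoid_ball:
  assumes "AE y in lborel. y \<notin> ball (x::real^'n) r"
  shows "r \<le> 0"
proof -
  have "emeasure lborel (ball x r) = 0"
    using assms by (subst (asm) AE_iff_measurable[OF _ refl]) (auto simp: ball_def)
  then show ?thesis using emeasure_ball_pos_finite(1)[of r x] by linarith
qed

text \<open>
  If the ball of radius \<open>\<delta>\<close> has at least twice the measure of \<open>A\<close>, then for every \<open>x\<close> at least half of
  the translations \<open>h\<close> in that ball move \<open>x\<close> out of \<open>A\<close>, where \<open>f\<close> vanishes. So the mean over \<open>h\<close> of
  \<open>(f (x + h) - f x)\<^sup>2\<close> is at least half of \<open>(f x)\<^sup>2\<close>, and \<open>translation_increment_le\<close> bounds the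
  integral of that mean.
\<close>

lemma faber_krahn:
  fixes f :: "real^'n \<Rightarrow> real"
  assumes f: "C1 f" and [measurable]: "A \<in> sets borel" and off: "\<And>x. x \<notin> A \<Longrightarrow> f x = 0"
    and \<delta>: "\<delta> > 0" and small: "2 * emeasure lborel A \<le> emeasure lborel (ball (0::real^'n) \<delta>)"
  shows "(\<integral>\<^sup>+ x. ennreal ((f x)\<^sup>2) \<partial>lborel) \<le> ennreal (2 * \<delta>\<^sup>2) * (\<integral>\<^sup>+ x. ennreal ((norm (gradient f x))\<^sup>2) \<partial>lborel)"
proof -
  have [measurable]: "f \<in> borel_measurable borel" using C1_borel[OF f] by simp
  let ?B = "ball (0::real^'n) \<delta>"
  let ?b = "emeasure lborel ?B"
  let ?D = "\<integral>\<^sup>+ x. ennreal ((norm (gradient f x))\<^sup>2) \<partial>lborel"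
  have T: "(\<integral>\<^sup>+ x. ennreal ((f (x + h) - f x)\<^sup>2) \<partial>lborel) \<le> ennreal ((norm h)\<^sup>2) * ?D" for h
    using translation_increment_le[OF f convex_UNIV, of h] by simp
  have half: "?b \<le> 2 * (\<integral>\<^sup>+ h. indicator ?B h * indicator (- A) (x + h) \<partial>lborel)" for x
  proof -
    have "?b = (\<integral>\<^sup>+ h. indicator ?B h \<partial>lborel)" by simp
    also have "\<dots> \<le> (\<integral>\<^sup>+ h. indicator ?B h * indicator (- A) (x + h) + indicator A (h + x) \<partial>lborel)"
      by (intro nn_integral_mono) (auto simp: indicator_def add.commute)
    also have "\<dots> = (\<integral>\<^sup>+ h. indicator ?B h * indicator (- A) (x + h) \<partial>lborel) + (\<integral>\<^sup>+ h. indicator A (h + x) \<partial>lborel)"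
      by (rule nn_integral_add) measurable
    also have "(\<integral>\<^sup>+ h. indicator A (h + x) \<partial>lborel) = (\<integral>\<^sup>+ h. indicator A h \<partial>lborel)"
      by (rule nn_integral_translate) measurable
    finally have "?b \<le> (\<integral>\<^sup>+ h. indicator ?B h * indicator (- A) (x + h) \<partial>lborel) + emeasure lborel A" by simp
    then have "2 * ?b \<le> 2 * ((\<integral>\<^sup>+ h. indicator ?B h * indicator (- A) (x + h) \<partial>lborel) + emeasure lborel A)"
      by (rule mult_left_mono) simp
    also have "\<dots> \<le> 2 * (\<integral>\<^sup>+ h. indicator ?B h * indicator (- A) (x + h) \<partial>lborel) + ?b"
      using small by (simp add: distrib_left add_left_mono)
    finally have "?b + ?b \<le> ?b + 2 * (\<integral>\<^sup>+ h. indicator ?B h * indicator (- A) (x + h) \<partial>lborel)"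
      by (simp add: mult_2 add.commute)
    then show ?thesis
      using emeasure_ball_pos_finite[OF \<delta>, of "0::real^'n"] by (simp only: ennreal_add_left_cancel_le) auto
  qed
  have "?b * (\<integral>\<^sup>+ x. ennreal ((f x)\<^sup>2) \<partial>lborel) = (\<integral>\<^sup>+ x. ennreal ((f x)\<^sup>2) * ?b \<partial>lborel)"
    by (subst nn_integral_multc) (auto simp: mult.commute)
  also have "\<dots> \<le> (\<integral>\<^sup>+ x. ennreal ((f x)\<^sup>2) * (2 * (\<integral>\<^sup>+ h. indicator ?B h * indicator (- A) (x + h) \<partial>lborel)) \<partial>lborel)"
    by (intro nn_integral_mono mult_left_mono half) simp
  also have "\<dots> = (\<integral>\<^sup>+ x. (\<integral>\<^sup>+ h. 2 * (ennreal ((f x)\<^sup>2) * (indicator ?B h * indicator (- A) (x + h))) \<partial>lborel) \<partial>lborel)"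
    by (intro nn_integral_cong) (subst nn_integral_cmult, simp, subst nn_integral_cmult, simp, simp only: mult_ac)
  also have "\<dots> \<le> (\<integral>\<^sup>+ x. (\<integral>\<^sup>+ h. 2 * (indicator ?B h * ennreal ((f (x + h) - f x)\<^sup>2)) \<partial>lborel) \<partial>lborel)"
    by (intro nn_integral_mono mult_left_mono) (auto simp: indicator_def off)
  also have "\<dots> = (\<integral>\<^sup>+ h. (\<integral>\<^sup>+ x. 2 * (indicator ?B h * ennreal ((f (x + h) - f x)\<^sup>2)) \<partial>lborel) \<partial>lborel)"
    by (rule lborel_pair.Fubini'[symmetric]) measurable
  also have "\<dots> = (\<integral>\<^sup>+ h. 2 * (indicator ?B h * (\<integral>\<^sup>+ x. ennreal ((f (x + h) - f x)\<^sup>2) \<partial>lborel)) \<partial>lborel)"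
    by (intro nn_integral_cong) (simp add: nn_integral_cmult)
  also have "\<dots> \<le> (\<integral>\<^sup>+ h. (2 * (ennreal (\<delta>\<^sup>2) * ?D)) * indicator ?B h \<partial>lborel)"
  proof (intro nn_integral_mono)
    fix h :: "real^'n"
    show "2 * (indicator ?B h * (\<integral>\<^sup>+ x. ennreal ((f (x + h) - f x)\<^sup>2) \<partial>lborel)) \<le> (2 * (ennreal (\<delta>\<^sup>2) * ?D)) * indicator ?B h"
    proof (cases "h \<in> ?B")
      case True
      have "(\<integral>\<^sup>+ x. ennreal ((f (x + h) - f x)\<^sup>2) \<partial>lborel) \<le> ennreal ((norm h)\<^sup>2) * ?D" by (rule T)
      also have "\<dots> \<le> ennreal (\<delta>\<^sup>2) * ?D"
        using True by (intro mult_right_mono ennreal_leI power_mono) auto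
      finally show ?thesis using True by (simp add: mult_left_mono)
    qed simp
  qed
  also have "\<dots> = ?b * (ennreal (2 * \<delta>\<^sup>2) * ?D)"
    by (subst nn_integral_cmult_indicator) (auto simp: ennreal_mult' mult_ac)
  finally show ?thesis
    by (simp only: ennreal_mult_le_mult_iff[OF emeasure_ball_pos_finite[OF \<delta>, of "0::real^'n"]])
qed

text \<open>
  The inequality of \<open>translation_increment_le\<close> is integrated over all differences \<open>h\<close> of points of
  the ball, which lie in a ball of twice the radius. A value \<open>f y\<close> at a well chosen point takes the
  place of the mean value: some point is at least as good as the average over all \<open>y\<close>.
\<close>

lemma poincare_ball:
  fixes f :: "real^'n \<Rightarrow> real"
  assumes f: "C1 f" and s: "s > 0"
  obtains y where "y \<in> ball Q s"
    "(\<integral>\<^sup>+ x\<in>ball Q s. ennreal ((f x - f y)\<^sup>2) \<partial>lborel)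
       \<le> ennreal (2 ^ (CARD('n) + 2) * s\<^sup>2) * (\<integral>\<^sup>+ x\<in>ball Q s. ennreal ((norm (gradient f x))\<^sup>2) \<partial>lborel)"
proof -
  have [measurable]: "f \<in> borel_measurable borel" using C1_borel[OF f] by simp
  let ?B = "ball Q s"
  let ?D = "\<integral>\<^sup>+ x\<in>?B. ennreal ((norm (gradient f x))\<^sup>2) \<partial>lborel"
  define I where "I = (\<lambda>y. \<integral>\<^sup>+ x\<in>?B. ennreal ((f x - f y)\<^sup>2) \<partial>lborel)"
  have [measurable]: "I \<in> borel_measurable borel" unfolding I_def by measurable
  let ?c = "ennreal (2 ^ (CARD('n) + 2) * s\<^sup>2) * ?D"
  have le: "(\<integral>\<^sup>+ y. I y * indicator ?B y \<partial>lborel) \<le> ?c * emeasure lborel ?B"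
  proof -
    have "(\<integral>\<^sup>+ y. I y * indicator ?B y \<partial>lborel)
      = (\<integral>\<^sup>+ y. (\<integral>\<^sup>+ h. ennreal ((f (h + y) - f y)\<^sup>2) * indicator ?B y * indicator ?B (h + y) \<partial>lborel) \<partial>lborel)"
    proof (intro nn_integral_cong)
      fix y :: "real^'n"
      have "(\<integral>\<^sup>+ h. ennreal ((f (h + y) - f y)\<^sup>2) * indicator ?B y * indicator ?B (h + y) \<partial>lborel)
        = (\<integral>\<^sup>+ h. ennreal ((f h - f y)\<^sup>2) * indicator ?B y * indicator ?B h \<partial>lborel)"
        by (rule nn_integral_translate[of "\<lambda>h. ennreal ((f h - f y)\<^sup>2) * indicator ?B y * indicator ?B h"]) measurable
      also have "\<dots> = I y * indicator ?B y"
        by (auto simp: I_def indicator_def)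
      finally show "I y * indicator ?B y = (\<integral>\<^sup>+ h. ennreal ((f (h + y) - f y)\<^sup>2) * indicator ?B y * indicator ?B (h + y) \<partial>lborel)" by simp
    qed
    also have "\<dots> = (\<integral>\<^sup>+ h. (\<integral>\<^sup>+ y. ennreal ((f (h + y) - f y)\<^sup>2) * indicator ?B y * indicator ?B (h + y) \<partial>lborel) \<partial>lborel)"
      by (rule lborel_pair.Fubini'[symmetric]) measurable
    also have "\<dots> \<le> (\<integral>\<^sup>+ h. (ennreal ((2 * s)\<^sup>2) * ?D) * indicator (ball (0::real^'n) (2 * s)) h \<partial>lborel)"
    proof (intro nn_integral_mono)
      fix h :: "real^'n"
      show "(\<integral>\<^sup>+ y. ennreal ((f (h + y) - f y)\<^sup>2) * indicator ?B y * indicator ?B (h + y) \<partial>lborel)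
         \<le> (ennreal ((2 * s)\<^sup>2) * ?D) * indicator (ball (0::real^'n) (2 * s)) h"
      proof (cases "h \<in> ball 0 (2 * s)")
        case True
        have "(\<integral>\<^sup>+ y. ennreal ((f (h + y) - f y)\<^sup>2) * indicator ?B y * indicator ?B (h + y) \<partial>lborel) \<le> ennreal ((norm h)\<^sup>2) * ?D"
          using translation_increment_le[OF f convex_ball[of Q s], of h] by (simp add: add.commute)
        also have "\<dots> \<le> ennreal ((2 * s)\<^sup>2) * ?D"
          using True by (intro mult_right_mono ennreal_leI power_mono) auto
        finally show ?thesis using True by simp
      next
        case False
        have "\<not> (y \<in> ?B \<and> h + y \<in> ?B)" for y
        proof
          assume "y \<in> ?B \<and> h + y \<in> ?B"
          then have "dist (h + y) y < 2 * s" using dist_triangle[of "h + y" y Q] by (auto simp: dist_commute)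
          with False show False by (simp add: dist_norm)
        qed
        then have "ennreal ((f (h + y) - f y)\<^sup>2) * indicator ?B y * indicator ?B (h + y) = 0" for y
          by (auto simp: indicator_def)
        then show ?thesis by (simp only: nn_integral_const) simp
      qed
    qed
    also have "\<dots> = (ennreal ((2 * s)\<^sup>2) * ?D) * emeasure lborel (ball (0::real^'n) (2 * s))"
      by (rule nn_integral_cmult_indicator) measurable
    also have "emeasure lborel (ball (0::real^'n) (2 * s)) = ennreal (2 ^ CARD('n)) * emeasure lborel ?B"
      using s by (simp add: emeasure_ball power_mult_distrib ennreal_mult[symmetric] mult_ac)
    also have "(ennreal ((2 * s)\<^sup>2) * ?D) * (ennreal (2 ^ CARD('n)) * emeasure lborel ?B)
      = (ennreal ((2 * s)\<^sup>2) * ennreal (2 ^ CARD('n))) * ?D * emeasure lborel ?B"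
      by (simp only: mult_ac)
    also have "ennreal ((2 * s)\<^sup>2) * ennreal (2 ^ CARD('n)) = ennreal (2 ^ (CARD('n) + 2) * s\<^sup>2)"
      by (subst ennreal_mult[symmetric]) (auto simp: power_add power_mult_distrib mult_ac)
    finally show ?thesis .
  qed
  have sb: "?B \<in> sets lborel" by simp
  have "\<exists>y\<in>?B. I y \<le> ?c"
  proof (rule ccontr)
    assume neg: "\<not> ?thesis"
    then have gt: "I y > ?c" if "y \<in> ?B" for y using that by (auto simp: not_le)
    have fin': "c * b \<noteq> \<infinity>" if "c < top" "b \<noteq> top" for c b :: ennreal
      using that by (auto simp: ennreal_mult_eq_top_iff)
    have "?c < top" using gt[of Q] s less_le_trans[OF _ top_greatest] by simp
    then have fin: "(\<integral>\<^sup>+ y. ?c * indicator ?B y \<partial>lborel) \<noteq> \<infinity>"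
      using fin' emeasure_ball_pos_finite(2)[OF s, of Q]
      by (simp only: nn_integral_cmult_indicator sb)
    have "(\<integral>\<^sup>+ y. ?c * indicator ?B y \<partial>lborel) < (\<integral>\<^sup>+ y. I y * indicator ?B y \<partial>lborel)"
    proof (rule nn_integral_less[OF _ _ fin])
      show "AE y in lborel. ?c * indicator ?B y \<le> I y * indicator ?B y"
        using gt by (intro AE_I2) (auto simp: indicator_def less_imp_le)
      show "\<not> (AE y in lborel. I y * indicator ?B y \<le> ?c * indicator ?B y)"
      proof
        assume "AE y in lborel. I y * indicator ?B y \<le> ?c * indicator ?B y"
        then have "AE y in lborel. y \<notin> ?B"
        proof eventually_elim
          case (elim y)
          show ?case
          proof
            assume y: "y \<in> ?B"
            then have "I y \<le> ?c" using elim by (simp only: indicator_simps mult_1_right)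
            with gt[OF y] show False by (simp only: leD)
          qed
        qed
        from AE_avoid_ball[OF this] s show False by simp
      qed
    qed measurable
    also note le
    finally show False by (simp only: nn_integral_cmult_indicator sb)
  qed
  then show thesis using that by (auto simp: I_def)
qed

section \<open>Polynomial cutoff functions\<close>

lemma pospart_power_DERIV:
  "((\<lambda>t. (max 0 t) ^ Suc (Suc m)) has_real_derivative real (Suc (Suc m)) * (max 0 t) ^ Suc m) (at t)"
proof -
  consider "t > 0" | "t < 0" | "t = 0" by linarith
  then show ?thesis
  proof cases
    case 1
    have "eventually (\<lambda>s. s ^ Suc (Suc m) = (max 0 s) ^ Suc (Suc m)) (nhds t)"
      using eventually_nhds_in_open[of "{0<..}" t] 1 by (auto elim!: eventually_mono simp: max_def)
    moreover have "((\<lambda>s. s ^ Suc (Suc m)) has_real_derivative real (Suc (Suc m)) * t ^ Suc m) (at t)"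
      using DERIV_pow[of "Suc (Suc m)" t] by simp
    ultimately have "((\<lambda>s. (max 0 s) ^ Suc (Suc m)) has_real_derivative real (Suc (Suc m)) * t ^ Suc m) (at t)"
      using DERIV_cong_ev[of t t "\<lambda>s. s ^ Suc (Suc m)" "\<lambda>s. (max 0 s) ^ Suc (Suc m)"] by blast
    then show ?thesis using 1 by (simp add: max_def)
  next
    case 2
    have "eventually (\<lambda>s. 0 = (max 0 s) ^ Suc (Suc m)) (nhds t)"
      using eventually_nhds_in_open[of "{..<0}" t] 2 by (auto elim!: eventually_mono simp: max_def)
    then have "((\<lambda>s. (max 0 s) ^ Suc (Suc m)) has_real_derivative 0) (at t)"
      using DERIV_cong_ev[of t t "\<lambda>_. 0" "\<lambda>s. (max 0 s) ^ Suc (Suc m)" 0 0] by simp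
    then show ?thesis using 2 by (simp add: max_def)
  next
    case 3
    have "((\<lambda>h. (max 0 h) ^ Suc (Suc m) / h) \<longlongrightarrow> 0) (at (0::real))"
    proof (rule Lim_null_comparison)
      show "eventually (\<lambda>h. norm ((max 0 h) ^ Suc (Suc m) / h) \<le> \<bar>h\<bar> ^ Suc m) (at (0::real))"
      proof (intro always_eventually allI)
        show "norm ((max 0 h) ^ Suc (Suc m) / h) \<le> \<bar>h\<bar> ^ Suc m" for h :: real
          by (cases "h > 0") (auto simp: max_def mult_nonpos_nonneg)
      qed
      have "((\<lambda>h. \<bar>h\<bar> ^ Suc m) \<longlongrightarrow> \<bar>0::real\<bar> ^ Suc m) (at 0)" by (intro tendsto_intros)
      then show "((\<lambda>h. \<bar>h\<bar> ^ Suc m) \<longlongrightarrow> (0::real)) (at 0)" by simp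
    qed
    then have "((\<lambda>t. (max 0 t) ^ Suc (Suc m)) has_real_derivative 0) (at 0)"
      by (simp add: DERIV_def)
    then show ?thesis using 3 by simp
  qed
qed

lemma pospart_power_DERIV_shift:
  "((\<lambda>t. (max 0 (t - c)) ^ Suc (Suc m)) has_real_derivative real (Suc (Suc m)) * (max 0 (t - c)) ^ Suc m) (at t)"
proof -
  have "((\<lambda>t. t - c) has_real_derivative 1) (at t)" by (auto intro!: derivative_eq_intros)
  from DERIV_chain'[OF this pospart_power_DERIV[of m "t - c"]] show ?thesis by (simp only: mult_1_right)
qed

text \<open>
  A cutoff without plateau: it is bounded below by \<open>(b\<^sup>2 - a\<^sup>2)\<^sup>2\<close> on the ball of radius \<open>a < b\<close>. In the
  De Giorgi iteration this bound decreases geometrically along the sequence of balls, which the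
  iteration absorbs.
\<close>

definition cutoff :: "real^'n \<Rightarrow> real \<Rightarrow> real^'n \<Rightarrow> real" where
  "cutoff Q b x = (max 0 (b\<^sup>2 - (norm (x - Q))\<^sup>2))\<^sup>2"

lemma cutoff_C1: "C1 (cutoff Q b)"
  and cutoff_gradient: "gradient (cutoff Q b) x = (- 4 * max 0 (b\<^sup>2 - (norm (x - Q))\<^sup>2)) *\<^sub>R (x - Q)"
proof -
  have 1: "GDERIV (\<lambda>x. b\<^sup>2 - (norm (x - Q))\<^sup>2) x :> (-2) *\<^sub>R (x - Q)" for x
    unfolding gderiv_def power2_norm_eq_inner
    by (auto intro!: derivative_eq_intros simp: inner_commute)
  have 2: "GDERIV (cutoff Q b) x :> (2 * max 0 (b\<^sup>2 - (norm (x - Q))\<^sup>2)) *\<^sub>R ((-2) *\<^sub>R (x - Q))" for x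
    unfolding cutoff_def using GDERIV_DERIV_compose[OF 1 pospart_power_DERIV[of 0]] by (simp add: numeral_2_eq_2)
  have 3: "continuous_on UNIV (\<lambda>x. (2 * max 0 (b\<^sup>2 - (norm (x - Q))\<^sup>2)) *\<^sub>R ((-2) *\<^sub>R (x - Q)))"
    by (intro continuous_intros)
  show "C1 (cutoff Q b)" by (rule C1I(1)[OF 2 3])
  show "gradient (cutoff Q b) x = (- 4 * max 0 (b\<^sup>2 - (norm (x - Q))\<^sup>2)) *\<^sub>R (x - Q)"
    using C1I(2)[OF 2 3] by simp
qed

lemma cutoff_nonneg: "cutoff Q b x \<ge> 0" by (simp add: cutoff_def)

lemma cutoff_off_ball:
  assumes "x \<notin> ball Q b" "b > 0"
  shows "cutoff Q b x = 0" "gradient (cutoff Q b) x = 0"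
proof -
  have "b\<^sup>2 \<le> (norm (x - Q))\<^sup>2" using assms by (intro power_mono) (auto simp: dist_norm norm_minus_commute)
  then show "cutoff Q b x = 0" "gradient (cutoff Q b) x = 0"
    by (simp_all add: cutoff_gradient cutoff_def)
qed

lemma cutoff_bounds:
  assumes "b > 0"
  shows "cutoff Q b x \<le> b ^ 4" "norm (gradient (cutoff Q b) x) \<le> 4 * b ^ 3"
proof -
  have 1: "max 0 (b\<^sup>2 - (norm (x - Q))\<^sup>2) \<le> b\<^sup>2" by simp
  have "cutoff Q b x \<le> (b\<^sup>2)\<^sup>2" unfolding cutoff_def by (rule power_mono[OF 1]) simp
  then show "cutoff Q b x \<le> b ^ 4" by (simp flip: power_mult)
  show "norm (gradient (cutoff Q b) x) \<le> 4 * b ^ 3"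
  proof (cases "x \<in> ball Q b")
    case True
    then have "norm (x - Q) \<le> b" by (simp add: dist_norm norm_minus_commute)
    then have "4 * max 0 (b\<^sup>2 - (norm (x - Q))\<^sup>2) * norm (x - Q) \<le> 4 * b\<^sup>2 * b"
      using 1 assms by (intro mult_mono) auto
    then show ?thesis by (simp add: cutoff_gradient power2_eq_square power3_eq_cube abs_mult)
  qed (use assms in \<open>simp add: cutoff_off_ball\<close>)
qed

lemma cutoff_lower:
  assumes "norm (x - Q) \<le> a" "a \<le> b"
  shows "(b\<^sup>2 - a\<^sup>2)\<^sup>2 \<le> cutoff Q b x"
proof -
  have "(norm (x - Q))\<^sup>2 \<le> a\<^sup>2" "a\<^sup>2 \<le> b\<^sup>2" using assms order_trans[OF norm_ge_zero assms(1)] by (auto intro!: power_mono)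
  then show ?thesis unfolding cutoff_def by (intro power_mono) auto
qed

lemma cutoff_bounded_support: "b > 0 \<Longrightarrow> bounded {x. cutoff Q b x \<noteq> 0}"
  by (rule bounded_subset[of "ball Q b"]) (auto simp: cutoff_off_ball intro: ccontr)

lemma integrable_continuous_off_ball:
  fixes h :: "real^'n \<Rightarrow> real"
  assumes "continuous_on UNIV h" "\<And>x. x \<notin> ball Q b \<Longrightarrow> h x = 0"
  shows "integrable lborel h"
  by (rule integrable_compact_support[OF assms(1)], rule bounded_subset[OF bounded_ball[of Q b]])
    (use assms(2) in blast)

lemma norm_add_square_le: "(norm (a + b))\<^sup>2 \<le> 2 * (norm a)\<^sup>2 + 2 * (norm (b::'a::real_normed_vector))\<^sup>2"
proof -
  have "(norm (a + b))\<^sup>2 \<le> (norm a + norm b)\<^sup>2" by (intro power_mono norm_triangle_ineq) simp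
  also have "\<dots> \<le> 2 * (norm a)\<^sup>2 + 2 * (norm b)\<^sup>2"
    using sum_squares_ge_zero[of "norm a - norm b" 0] by (simp add: power2_eq_square algebra_simps)
  finally show ?thesis .
qed

section \<open>A Poincare inequality from capacity\<close>

lemma ennreal_linear2:
  "0 \<le> a \<Longrightarrow> 0 \<le> x \<Longrightarrow> 0 \<le> b \<Longrightarrow> 0 \<le> y \<Longrightarrow>
    ennreal (a * x + b * y) = ennreal a * ennreal x + ennreal b * ennreal y"
  by (simp add: ennreal_plus ennreal_mult)

text \<open>
  The constant collects \<open>2 ^ (n + 4)\<close> from \<open>poincare_ball\<close> on a ball of radius \<open>2 * s\<close>, and the energy
  of the truncation in \<open>cap2_le_truncation\<close> divided by the lower capacity bound.
\<close>

definition cap_poincare_const :: "nat \<Rightarrow> real \<Rightarrow> real" where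
  "cap_poincare_const n C0 = 2 * 2 ^ (n + 4) + 2 * unit_ball_vol n * 2 ^ n * ((512 + 2048 * 2 ^ (n + 4)) / C0)"

text \<open>
  The competitor is \<open>1 - w / c\<close> times a cutoff divided by \<open>s ^ 4\<close>. Near \<open>K\<close> the first factor is 1 and
  the second at least 1. The term with the gradient of the cutoff contains \<open>w - c\<close>, which the
  hypothesis \<open>poin\<close> controls.
\<close>

lemma cap2_le_truncation:
  fixes w :: "real^'n \<Rightarrow> real"
  assumes w: "C1 w" and s: "s > 0" and \<delta>: "\<delta> > 0" and K: "K \<subseteq> ball Q s"
    and zero: "\<And>x y. y \<in> K \<Longrightarrow> dist x y < \<delta> \<Longrightarrow> w x = 0" and c: "c \<noteq> 0"
    and poin: "(\<integral>\<^sup>+ x\<in>ball Q (2 * s). ennreal ((w x - c)\<^sup>2) \<partial>lborel) \<le> ennreal (p * s\<^sup>2) * G"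
    and p: "p \<ge> 0" and G: "G = (\<integral>\<^sup>+ x\<in>ball Q (2 * s). ennreal ((norm (gradient w x))\<^sup>2) \<partial>lborel)"
  shows "cap2 K \<le> ennreal ((512 + 2048 * p) / c\<^sup>2) * G"
proof -
  have [measurable]: "w \<in> borel_measurable borel" "gradient w \<in> borel_measurable borel"
    using C1_borel[OF w] by simp_all
  let ?B = "ball Q (2 * s)"
  let ?\<psi> = "cutoff Q (2 * s)"
  have a: "C1 (\<lambda>x. 1 - w x / c)" "gradient (\<lambda>x. 1 - w x / c) = (\<lambda>x. (- 1 / c) *\<^sub>R gradient w x)"
    by (rule C1_compose[OF w, where T=UNIV and H="\<lambda>t. 1 - t / c" and H'="\<lambda>_. - 1 / c"]; use c in \<open>auto intro!: derivative_eq_intros\<close>)+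
  have b: "C1 (\<lambda>x. ?\<psi> x / s ^ 4)" "gradient (\<lambda>x. ?\<psi> x / s ^ 4) = (\<lambda>x. (1 / s ^ 4) *\<^sub>R gradient ?\<psi> x)"
    by (rule C1_compose[OF cutoff_C1, where T=UNIV and H="\<lambda>t. t / s ^ 4" and H'="\<lambda>_. 1 / s ^ 4"]; auto intro!: DERIV_cdivide[OF DERIV_ident])+
  define \<phi> where "\<phi> = (\<lambda>x. (1 - w x / c) * (?\<psi> x / s ^ 4))"
  have \<phi>1: "C1 \<phi>" unfolding \<phi>_def by (rule C1_mult(1)[OF a(1) b(1)])
  have \<phi>2: "gradient \<phi> x = (1 - w x / c) *\<^sub>R ((1 / s ^ 4) *\<^sub>R gradient ?\<psi> x) + (?\<psi> x / s ^ 4) *\<^sub>R ((- 1 / c) *\<^sub>R gradient w x)" for x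
    unfolding \<phi>_def by (subst C1_mult(2)[OF a(1) b(1)]) (simp only: a(2) b(2))
  have "cap2 K \<le> (\<integral>\<^sup>+ x. ennreal ((norm (gradient \<phi> x))\<^sup>2) \<partial>lborel)"
  proof (rule cap2_le_C1[OF \<phi>1])
    show "bounded {x. \<phi> x \<noteq> 0}"
      by (rule bounded_subset[OF cutoff_bounded_support[of "2 * s" Q]]) (use s in \<open>auto simp: \<phi>_def\<close>)
    show "min \<delta> (s / 2) > 0" using \<delta> s by simp
    fix x y assume y: "y \<in> K" and d: "dist x y < min \<delta> (s / 2)"
    then have "w x = 0" by (intro zero) auto
    have "dist y Q < s" using K y by (auto simp: dist_commute)
    then have "norm (x - Q) \<le> 3 / 2 * s" using d dist_triangle[of x Q y] by (simp add: dist_norm)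
    from cutoff_lower[OF this, of "2 * s"] have "((2 * s)\<^sup>2 - (3 / 2 * s)\<^sup>2)\<^sup>2 \<le> ?\<psi> x" using s by simp
    moreover have "((2 * s)\<^sup>2 - (3 / 2 * s)\<^sup>2)\<^sup>2 = 49 / 16 * s ^ 4" by (simp add: power2_eq_square field_simps power4_eq_xxxx)
    moreover have "s ^ 4 > 0" using s by simp
    ultimately have "s ^ 4 \<le> ?\<psi> x" by linarith
    then show "1 \<le> \<phi> x" using \<open>w x = 0\<close> s by (simp add: \<phi>_def)
  qed
  also have "\<dots> \<le> (\<integral>\<^sup>+ x. ennreal (2048 / (c\<^sup>2 * s\<^sup>2)) * (ennreal ((w x - c)\<^sup>2) * indicator ?B x)
      + ennreal (512 / c\<^sup>2) * (ennreal ((norm (gradient w x))\<^sup>2) * indicator ?B x) \<partial>lborel)"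
  proof (intro nn_integral_mono)
    fix x
    show "ennreal ((norm (gradient \<phi> x))\<^sup>2) \<le> ennreal (2048 / (c\<^sup>2 * s\<^sup>2)) * (ennreal ((w x - c)\<^sup>2) * indicator ?B x)
      + ennreal (512 / c\<^sup>2) * (ennreal ((norm (gradient w x))\<^sup>2) * indicator ?B x)"
    proof (cases "x \<in> ?B")
      case False
      then show ?thesis using s cutoff_off_ball[of x Q "2 * s"] by (simp add: \<phi>2)
    next
      case True
      have ps: "?\<psi> x \<le> 16 * s ^ 4" "norm (gradient ?\<psi> x) \<le> 32 * s ^ 3"
        using cutoff_bounds[of "2 * s" Q x] s by (auto simp: power_mult_distrib)
      have "(norm (gradient \<phi> x))\<^sup>2 \<le> 2 * (norm ((1 - w x / c) *\<^sub>R ((1 / s ^ 4) *\<^sub>R gradient ?\<psi> x)))\<^sup>2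
         + 2 * (norm ((?\<psi> x / s ^ 4) *\<^sub>R ((- 1 / c) *\<^sub>R gradient w x)))\<^sup>2"
        unfolding \<phi>2 by (rule norm_add_square_le)
      also have "norm ((1 - w x / c) *\<^sub>R ((1 / s ^ 4) *\<^sub>R gradient ?\<psi> x)) = \<bar>1 - w x / c\<bar> * (norm (gradient ?\<psi> x) / s ^ 4)"
        using s by simp
      also have "norm ((?\<psi> x / s ^ 4) *\<^sub>R ((- 1 / c) *\<^sub>R gradient w x)) = (?\<psi> x / s ^ 4) * (norm (gradient w x) / \<bar>c\<bar>)"
        using s cutoff_nonneg[of Q "2 * s" x] by (simp add: abs_mult)
      also have "2 * (\<bar>1 - w x / c\<bar> * (norm (gradient ?\<psi> x) / s ^ 4))\<^sup>2 + 2 * ((?\<psi> x / s ^ 4) * (norm (gradient w x) / \<bar>c\<bar>))\<^sup>2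
        \<le> 2 * (\<bar>1 - w x / c\<bar> * (32 * s ^ 3 / s ^ 4))\<^sup>2 + 2 * ((16 * s ^ 4 / s ^ 4) * (norm (gradient w x) / \<bar>c\<bar>))\<^sup>2"
        using s ps cutoff_nonneg[of Q "2 * s" x]
        by (intro add_mono mult_left_mono power_mono mult_mono divide_right_mono mult_nonneg_nonneg) auto
      also have "\<dots> = 2048 / (c\<^sup>2 * s\<^sup>2) * (w x - c)\<^sup>2 + 512 / c\<^sup>2 * (norm (gradient w x))\<^sup>2"
      proof -
        have "\<bar>1 - w x / c\<bar>\<^sup>2 = (w x - c)\<^sup>2 / c\<^sup>2"
          using c by (simp add: power2_eq_square field_simps)
        moreover have "32 * s ^ 3 / s ^ 4 = 32 / s" "16 * s ^ 4 / s ^ 4 = 16"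
          using s by (simp_all add: power3_eq_cube power4_eq_xxxx)
        ultimately show ?thesis by (simp add: power_mult_distrib power_divide)
      qed
      finally have "ennreal ((norm (gradient \<phi> x))\<^sup>2) \<le> ennreal (2048 / (c\<^sup>2 * s\<^sup>2) * (w x - c)\<^sup>2 + 512 / c\<^sup>2 * (norm (gradient w x))\<^sup>2)"
        by (rule ennreal_leI)
      then show ?thesis using True by (subst (asm) ennreal_linear2) simp_all
    qed
  qed
  also have "\<dots> = ennreal (2048 / (c\<^sup>2 * s\<^sup>2)) * (\<integral>\<^sup>+ x\<in>?B. ennreal ((w x - c)\<^sup>2) \<partial>lborel) + ennreal (512 / c\<^sup>2) * G"
    unfolding G by (subst nn_integral_add) (auto simp: nn_integral_cmult)
  also have "\<dots> \<le> ennreal (2048 / (c\<^sup>2 * s\<^sup>2)) * (ennreal (p * s\<^sup>2) * G) + ennreal (512 / c\<^sup>2) * G"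
    by (intro add_right_mono mult_left_mono poin) simp
  also have "\<dots> = (ennreal (2048 / (c\<^sup>2 * s\<^sup>2) * (p * s\<^sup>2)) + ennreal (512 / c\<^sup>2)) * G"
    using p by (subst ennreal_mult) (auto simp: distrib_right mult.assoc)
  also have "2048 / (c\<^sup>2 * s\<^sup>2) * (p * s\<^sup>2) = 2048 * p / c\<^sup>2" using s by simp
  also have "ennreal (2048 * p / c\<^sup>2) + ennreal (512 / c\<^sup>2) = ennreal ((512 + 2048 * p) / c\<^sup>2)"
    using p by (subst ennreal_plus[symmetric]) (auto simp: add_divide_distrib)
  finally show ?thesis .
qed

text \<open>
  By \<open>cap2_le_truncation\<close> the typical value \<open>c\<close> from the Poincare inequality satisfies
  \<open>c\<^sup>2 * cap2 K \<le> const * energy\<close>. The lower bound on the capacity turns this into a bound on \<open>c\<close>, and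
  the mean square of \<open>w\<close> is controlled by those of \<open>w - c\<close> and \<open>c\<close>.
\<close>

lemma capacity_poincare:
  fixes w :: "real^'n \<Rightarrow> real"
  assumes w: "C1 w" and s: "s > 0" and \<delta>: "\<delta> > 0" and K: "K \<subseteq> ball Q s"
    and zero: "\<And>x y. y \<in> K \<Longrightarrow> dist x y < \<delta> \<Longrightarrow> w x = 0"
    and C0: "C0 > 0" and cap: "ennreal (C0 * s ^ (CARD('n) - 2)) \<le> cap2 K" and n: "CARD('n) \<ge> 2"
  shows "(\<integral>\<^sup>+ x\<in>ball Q (2 * s). ennreal ((w x)\<^sup>2) \<partial>lborel)
    \<le> ennreal (cap_poincare_const CARD('n) C0 * s\<^sup>2) * (\<integral>\<^sup>+ x\<in>ball Q (2 * s). ennreal ((norm (gradient w x))\<^sup>2) \<partial>lborel)"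
proof -
  have [measurable]: "w \<in> borel_measurable borel" using C1_borel[OF w] by simp
  let ?B = "ball Q (2 * s)"
  define G where "G = (\<integral>\<^sup>+ x\<in>?B. ennreal ((norm (gradient w x))\<^sup>2) \<partial>lborel)"
  define p :: real where "p = 2 ^ (CARD('n) + 4)"
  have p: "p > 0" by (simp add: p_def)
  define \<omega> where "\<omega> = unit_ball_vol (real CARD('n))"
  have \<omega>: "\<omega> > 0" by (simp add: \<omega>_def)
  define C where "C = 2 * p + 2 * \<omega> * 2 ^ CARD('n) * ((512 + 2048 * p) / C0)"
  have C: "C > 0" unfolding C_def using p \<omega> C0 by (intro add_pos_nonneg) auto
  have C': "cap_poincare_const CARD('n) C0 = C" by (simp add: C_def cap_poincare_const_def p_def \<omega>_def)
  obtain y where y: "(\<integral>\<^sup>+ x\<in>?B. ennreal ((w x - w y)\<^sup>2) \<partial>lborel) \<le> ennreal (2 ^ (CARD('n) + 2) * (2 * s)\<^sup>2) * G"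
    using poincare_ball[OF w, of "2 * s" Q] s unfolding G_def by (metis mult_pos_pos zero_less_numeral)
  define c where "c = w y"
  have poin: "(\<integral>\<^sup>+ x\<in>?B. ennreal ((w x - c)\<^sup>2) \<partial>lborel) \<le> ennreal (p * s\<^sup>2) * G"
    using y by (simp add: c_def p_def power_add power_mult_distrib mult_ac)
  show ?thesis
  proof (cases "G = top")
    case True
    then show ?thesis unfolding G_def[symmetric] C' using C s by (simp add: ennreal_mult_top)
  next
    case False
    then obtain \<gamma> where \<gamma>: "G = ennreal \<gamma>" "\<gamma> \<ge> 0" by (cases G) auto
    have c2: "c\<^sup>2 * (C0 * s ^ (CARD('n) - 2)) \<le> (512 + 2048 * p) * \<gamma>"
    proof (cases "c = 0")
      case True
      then show ?thesis using \<gamma> p by simp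
    next
      case c: False
      have "ennreal (C0 * s ^ (CARD('n) - 2)) \<le> ennreal ((512 + 2048 * p) / c\<^sup>2) * G"
        using cap2_le_truncation[OF w s \<delta> K zero c poin _ G_def] p cap by (meson order_trans less_imp_le)
      also have "\<dots> = ennreal ((512 + 2048 * p) / c\<^sup>2 * \<gamma>)" using p \<gamma> by (simp only: \<gamma>(1)) (rule ennreal_mult[symmetric], auto)
      finally have "C0 * s ^ (CARD('n) - 2) \<le> (512 + 2048 * p) / c\<^sup>2 * \<gamma>"
        using p \<gamma> by (simp add: ennreal_le_iff)
      then show ?thesis using c by (simp add: field_simps)
    qed
    have sn: "s ^ CARD('n) = s ^ (CARD('n) - 2) * s\<^sup>2"
      by (subst (1) le_add_diff_inverse2[OF n, symmetric]) (simp only: power_add)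
    have "C0 * (c\<^sup>2 * s ^ CARD('n)) = c\<^sup>2 * (C0 * s ^ (CARD('n) - 2)) * s\<^sup>2" by (simp add: sn)
    also have "\<dots> \<le> (512 + 2048 * p) * \<gamma> * s\<^sup>2" by (intro mult_right_mono c2) simp
    finally have c3: "c\<^sup>2 * s ^ CARD('n) \<le> (512 + 2048 * p) / C0 * (s\<^sup>2 * \<gamma>)"
      using C0 by (simp add: field_simps)
    have "(\<integral>\<^sup>+ x\<in>?B. ennreal ((w x)\<^sup>2) \<partial>lborel)
       \<le> (\<integral>\<^sup>+ x. 2 * (ennreal ((w x - c)\<^sup>2) * indicator ?B x) + ennreal (2 * c\<^sup>2) * indicator ?B x \<partial>lborel)"
    proof (intro nn_integral_mono)
      fix x
      have "(w x)\<^sup>2 \<le> 2 * (w x - c)\<^sup>2 + 2 * c\<^sup>2"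
        using norm_add_square_le[of "w x - c" c] by simp
      then have "ennreal ((w x)\<^sup>2) \<le> ennreal (2 * (w x - c)\<^sup>2 + 2 * c\<^sup>2)" by (rule ennreal_leI)
      also have "\<dots> = 2 * ennreal ((w x - c)\<^sup>2) + ennreal (2 * c\<^sup>2)" by (simp add: ennreal_plus ennreal_mult')
      finally show "ennreal ((w x)\<^sup>2) * indicator ?B x \<le> 2 * (ennreal ((w x - c)\<^sup>2) * indicator ?B x) + ennreal (2 * c\<^sup>2) * indicator ?B x"
        by (simp add: indicator_def)
    qed
    also have "\<dots> = 2 * (\<integral>\<^sup>+ x\<in>?B. ennreal ((w x - c)\<^sup>2) \<partial>lborel) + ennreal (2 * c\<^sup>2) * emeasure lborel ?B"
      by (subst nn_integral_add) (auto simp: nn_integral_cmult nn_integral_cmult_indicator)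
    also have "\<dots> \<le> 2 * (ennreal (p * s\<^sup>2) * G) + ennreal (2 * c\<^sup>2) * emeasure lborel ?B"
      by (intro add_right_mono mult_left_mono poin) simp
    also have "\<dots> = ennreal (2 * (p * s\<^sup>2 * \<gamma>) + 2 * c\<^sup>2 * (\<omega> * (2 * s) ^ CARD('n)))"
      using s p \<gamma> \<omega> by (simp add: emeasure_ball \<omega>_def[symmetric] ennreal_plus ennreal_mult)
    also have "\<dots> \<le> ennreal (C * s\<^sup>2 * \<gamma>)"
    proof (rule ennreal_leI)
      have "2 * c\<^sup>2 * (\<omega> * (2 * s) ^ CARD('n)) = (2 * \<omega> * 2 ^ CARD('n)) * (c\<^sup>2 * s ^ CARD('n))"
        by (simp add: power_mult_distrib)
      also have "\<dots> \<le> (2 * \<omega> * 2 ^ CARD('n)) * ((512 + 2048 * p) / C0 * (s\<^sup>2 * \<gamma>))"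
        using \<omega> by (intro mult_left_mono c3) simp
      finally show "2 * (p * s\<^sup>2 * \<gamma>) + 2 * c\<^sup>2 * (\<omega> * (2 * s) ^ CARD('n)) \<le> C * s\<^sup>2 * \<gamma>"
        unfolding C_def distrib_right by (simp only: mult.assoc)
    qed
    also have "\<dots> = ennreal (C * s\<^sup>2) * G" using C \<gamma> by (simp add: ennreal_mult)
    finally show ?thesis by (simp only: G_def C')
  qed
qed

section \<open>Approximate solutions and the energy inequality\<close>

lemma integral_linear_combination:
  fixes A S E N :: "'a \<Rightarrow> real"
  assumes "integrable M A" "integrable M S" "integrable M E" "integrable M N"
  shows "(\<integral> x. a * A x - c * S x - L * (d * E x + t * N x) \<partial>M)
    = a * (\<integral> x. A x \<partial>M) - c * (\<integral> x. S x \<partial>M) - L * (d * (\<integral> x. E x \<partial>M) + t * (\<integral> x. N x \<partial>M))"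
  using assms by simp

text \<open>
  The integrand of the tested equation, where \<open>G\<close> is the gradient of the approximation, \<open>g\<close> the weak
  gradient, \<open>F\<close> the flux, and \<open>y\<close>, \<open>W\<close> the cutoff and its gradient. Young's inequality absorbs the mixed
  term into half of the coercive one; what is left over is \<open>G - g\<close>, which is small in mean square,
  times \<open>norm g + 1\<close>. The parameter \<open>\<theta>\<close> splits that product so that the second factor may be
  large.
\<close>

lemma energy_pointwise:
  fixes F G W g :: "'a::real_inner" and lam \<theta> y L :: real
  assumes lam: "lam > 0" and \<theta>: "\<theta> > 0" and y: "y \<ge> 0"
    and E1: "(norm G)\<^sup>2 / lam - lam * norm (G - g) * norm G \<le> F \<bullet> G"
    and E2: "\<bar>F \<bullet> W\<bar> \<le> lam * (norm G + norm (G - g)) * norm W"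
    and P: "0 \<le> P" "P\<^sup>2 \<le> \<Phi>'" and S: "\<bar>\<Phi>\<bar> \<le> P * S"
    and L: "y\<^sup>2 * \<Phi>' * lam \<le> L" "2 * lam * y * \<bar>\<Phi>\<bar> * norm W \<le> L"
  shows "1 / (2 * lam) * (P\<^sup>2 * y\<^sup>2 * (norm G)\<^sup>2) - 2 * lam ^ 3 * (S\<^sup>2 * (norm W)\<^sup>2)
      - L * ((1 + 1 / (4 * \<theta>)) * (norm (G - g))\<^sup>2 + 2 * \<theta> * ((norm g)\<^sup>2 + 1))
    \<le> F \<bullet> (\<Phi> *\<^sub>R ((2 * y) *\<^sub>R W) + (y * y) *\<^sub>R (\<Phi>' *\<^sub>R G))"
proof -
  define p q d h where "p = norm G" and "q = norm (G - g)" and "d = norm W" and "h = norm g"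
  have nn: "p \<ge> 0" "q \<ge> 0" "d \<ge> 0" "h \<ge> 0" by (auto simp: p_def q_def d_def h_def)
  note E = E1[folded p_def q_def] E2[folded p_def q_def d_def]
  note L' = L[folded d_def]
  have \<Phi>': "0 \<le> \<Phi>'" using P(2) by (meson order_trans zero_le_power2)
  have L0: "L \<ge> 0" using L'(1) \<Phi>' lam by (meson mult_nonneg_nonneg order_trans zero_le_power2 less_imp_le)
  have a1: "y\<^sup>2 * \<Phi>' * (p\<^sup>2 / lam - lam * q * p) \<le> y\<^sup>2 * \<Phi>' * (F \<bullet> G)"
    using E(1) \<Phi>' by (intro mult_left_mono) auto
  have a2: "2 * y * \<Phi> * (F \<bullet> W) \<ge> - (2 * y * \<bar>\<Phi>\<bar> * (lam * (p + q) * d))"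
  proof -
    have "\<bar>2 * y * \<Phi> * (F \<bullet> W)\<bar> = 2 * y * \<bar>\<Phi>\<bar> * \<bar>F \<bullet> W\<bar>" using y by (simp add: abs_mult)
    also have "\<dots> \<le> 2 * y * \<bar>\<Phi>\<bar> * (lam * (p + q) * d)" using y E(2) by (intro mult_left_mono) auto
    finally show ?thesis by linarith
  qed
  have Fe: "F \<bullet> (\<Phi> *\<^sub>R ((2 * y) *\<^sub>R W) + (y * y) *\<^sub>R (\<Phi>' *\<^sub>R G)) = y\<^sup>2 * \<Phi>' * (F \<bullet> G) + 2 * y * \<Phi> * (F \<bullet> W)"
    by (simp add: inner_add_right power2_eq_square mult_ac)
  have a3: "P\<^sup>2 * y\<^sup>2 * p\<^sup>2 / lam \<le> y\<^sup>2 * \<Phi>' * (p\<^sup>2 / lam)"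
  proof -
    have "P\<^sup>2 * (y\<^sup>2 * (p\<^sup>2 / lam)) \<le> \<Phi>' * (y\<^sup>2 * (p\<^sup>2 / lam))" using P lam by (intro mult_right_mono) auto
    then show ?thesis by (simp add: mult_ac)
  qed
  have a4: "2 * y * \<bar>\<Phi>\<bar> * (lam * p * d) \<le> 1 / (2 * lam) * (P\<^sup>2 * y\<^sup>2 * p\<^sup>2) + 2 * lam ^ 3 * (S\<^sup>2 * d\<^sup>2)"
  proof -
    have "2 * y * \<bar>\<Phi>\<bar> * (lam * p * d) \<le> 2 * y * (P * S) * (lam * p * d)"
      using S nn y lam by (intro mult_right_mono mult_left_mono) auto
    also have "\<dots> \<le> 1 / (2 * lam) * (P\<^sup>2 * y\<^sup>2 * p\<^sup>2) + 2 * lam ^ 3 * (S\<^sup>2 * d\<^sup>2)"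
    proof -
      have "0 \<le> (1 / (2 * lam)) * (P * y * p - 2 * lam\<^sup>2 * (S * d))\<^sup>2" using lam by simp
      also have "\<dots> = 1 / (2 * lam) * (P\<^sup>2 * y\<^sup>2 * p\<^sup>2) + 2 * lam ^ 3 * (S\<^sup>2 * d\<^sup>2) - 2 * y * (P * S) * (lam * p * d)"
        using lam by (simp add: power2_eq_square power3_eq_cube field_simps)
      finally show ?thesis by simp
    qed
    finally show ?thesis .
  qed
  have a5: "y\<^sup>2 * \<Phi>' * (lam * q * p) + 2 * y * \<bar>\<Phi>\<bar> * (lam * q * d) \<le> L * (q * (p + 1))"
  proof -
    have "y\<^sup>2 * \<Phi>' * (lam * q * p) + 2 * y * \<bar>\<Phi>\<bar> * (lam * q * d)
      = (y\<^sup>2 * \<Phi>' * lam) * (q * p) + (2 * lam * y * \<bar>\<Phi>\<bar> * d) * q" by (simp add: mult_ac)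
    also have "\<dots> \<le> L * (q * p) + L * q" using L' nn by (intro add_mono mult_right_mono) auto
    also have "\<dots> = L * (q * (p + 1))" by (simp add: algebra_simps)
    finally show ?thesis .
  qed
  have a6: "q * (p + 1) \<le> (1 + 1 / (4 * \<theta>)) * q\<^sup>2 + 2 * \<theta> * (h\<^sup>2 + 1)"
  proof -
    have "p \<le> h + q" using norm_triangle_ineq[of "G - g" g] by (simp add: p_def q_def h_def)
    then have "q * (p + 1) \<le> q * (h + q + 1)" using nn by (intro mult_left_mono) auto
    also have "\<dots> = q\<^sup>2 + q * (h + 1)" by (simp add: power2_eq_square algebra_simps)
    also have "q * (h + 1) \<le> 1 / (4 * \<theta>) * q\<^sup>2 + \<theta> * (h + 1)\<^sup>2"
    proof -
      have "0 \<le> \<theta> * (q / (2 * \<theta>) - (h + 1))\<^sup>2" using \<theta> by simp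
      also have "\<dots> = 1 / (4 * \<theta>) * q\<^sup>2 + \<theta> * (h + 1)\<^sup>2 - q * (h + 1)"
        using \<theta> by (simp add: power2_diff power_divide) (simp add: power2_eq_square field_simps)
      finally show ?thesis by simp
    qed
    also have "\<theta> * (h + 1)\<^sup>2 \<le> \<theta> * (2 * (h\<^sup>2 + 1))"
    proof (intro mult_left_mono)
      have "0 \<le> (h - 1)\<^sup>2" by simp
      then show "(h + 1)\<^sup>2 \<le> 2 * (h\<^sup>2 + 1)" by (simp add: power2_eq_square algebra_simps)
    qed (use \<theta> in simp)
    finally show ?thesis by (simp add: algebra_simps)
  qed
  have a7: "L * (q * (p + 1)) \<le> L * ((1 + 1 / (4 * \<theta>)) * q\<^sup>2 + 2 * \<theta> * (h\<^sup>2 + 1))"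
    by (intro mult_left_mono a6 L0)
  have a8: "F \<bullet> (\<Phi> *\<^sub>R ((2 * y) *\<^sub>R W) + (y * y) *\<^sub>R (\<Phi>' *\<^sub>R G))
    \<ge> y\<^sup>2 * \<Phi>' * (p\<^sup>2 / lam) - y\<^sup>2 * \<Phi>' * (lam * q * p) - 2 * y * \<bar>\<Phi>\<bar> * (lam * p * d) - 2 * y * \<bar>\<Phi>\<bar> * (lam * q * d)"
    unfolding Fe using a1 a2 by (simp add: algebra_simps)
  have a9: "P\<^sup>2 * y\<^sup>2 * p\<^sup>2 / lam - 1 / (2 * lam) * (P\<^sup>2 * y\<^sup>2 * p\<^sup>2) = 1 / (2 * lam) * (P\<^sup>2 * y\<^sup>2 * p\<^sup>2)"
    using lam by (simp add: field_simps)
  show ?thesis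
    unfolding p_def[symmetric] q_def[symmetric] d_def[symmetric] h_def[symmetric]
    using a3 a4 a5 a7 a8 a9 by linarith
qed

text \<open>
  A weak solution in \<open>ball Q r \<inter> \<Omega>\<close> with zero boundary values, bounded by 1 and extended by 0. The
  weak gradient \<open>g\<close> and the flux \<open>F\<close> are represented by Borel functions on the whole space, so that
  all integrals are over \<open>lborel\<close>. The coefficient matrix enters only through the two inequalities
  of the last assumption: they compare \<open>F\<close> with what the matrix would do to an arbitrary vector \<open>p\<close>,
  which is later the gradient of an approximation of \<open>u\<close>.
\<close>

locale dirichlet_solution =
  fixes Q :: "real^'n" and r lam :: real and \<Omega> :: "(real^'n) set"
    and u :: "real^'n \<Rightarrow> real" and g F :: "real^'n \<Rightarrow> real^'n"
  assumes r: "r > 0" and lam: "lam > 0" and \<Omega>: "open \<Omega>"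
    and u_borel [measurable]: "u \<in> borel_measurable borel"
    and u_cont: "continuous_on (ball Q r) u"
    and u_zero: "\<And>x. x \<notin> ball Q r \<inter> \<Omega> \<Longrightarrow> u x = 0"
    and u_le: "\<And>x. \<bar>u x\<bar> \<le> 1"
    and g_borel [measurable]: "g \<in> borel_measurable borel"
    and g_zero: "\<And>x. x \<notin> ball Q r \<inter> \<Omega> \<Longrightarrow> g x = 0"
    and g_fin: "(\<integral>\<^sup>+ x. ennreal ((norm (g x))\<^sup>2) \<partial>lborel) < \<infinity>"
    and F_int: "integrable lborel F"
    and weak_grad: "\<And>\<phi> i. \<phi> \<in> test_functions (ball Q r \<inter> \<Omega>) \<Longrightarrow>
        (\<integral> x. u x * gradient \<phi> x $ i \<partial>lborel) = - (\<integral> x. g x $ i * \<phi> x \<partial>lborel)"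
    and weak_eq: "\<And>\<phi>. \<phi> \<in> test_functions (ball Q r \<inter> \<Omega>) \<Longrightarrow> (\<integral> x. F x \<bullet> gradient \<phi> x \<partial>lborel) = 0"
    and elliptic: "AE x in lborel. x \<in> ball Q r \<inter> \<Omega> \<longrightarrow> (\<forall>p \<xi>.
        (norm p)\<^sup>2 / lam - lam * norm (p - g x) * norm p \<le> F x \<bullet> p \<and>
        \<bar>F x \<bullet> \<xi>\<bar> \<le> lam * (norm p + norm (p - g x)) * norm \<xi>)"
begin

lemma g_component_borel [measurable]: "(\<lambda>y. g y $ i) \<in> borel_measurable borel"
  by (rule measurable_compose[OF g_borel]) (intro borel_measurable_continuous_onI continuous_intros)

lemma g_component_fin: "(\<integral>\<^sup>+ x. ennreal ((g x $ i)\<^sup>2) \<partial>lborel) < \<infinity>"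
proof -
  have "(g x $ i)\<^sup>2 \<le> (norm (g x))\<^sup>2" for x
    using component_le_norm_cart[of "g x" i] by (simp add: abs_le_square_iff[symmetric])
  then have "(\<integral>\<^sup>+ x. ennreal ((g x $ i)\<^sup>2) \<partial>lborel) \<le> (\<integral>\<^sup>+ x. ennreal ((norm (g x))\<^sup>2) \<partial>lborel)"
    by (intro nn_integral_mono ennreal_leI)
  then show ?thesis using g_fin by (rule order.strict_trans1)
qed

definition superlevel :: "real \<Rightarrow> real \<Rightarrow> (real^'n) set" where
  "superlevel b k = {x \<in> cball Q b. k \<le> u x}"

text \<open>
  Here the boundary condition is used: \<open>u\<close> is continuous on the ball including the points outside
  \<open>\<Omega>\<close>, where it is 0, so a positive superlevel set cannot approach the complement of \<open>\<Omega>\<close>.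
\<close>

lemma superlevel_compact:
  assumes "b < r" "k > 0"
  shows "compact (superlevel b k)" "superlevel b k \<subseteq> ball Q r \<inter> \<Omega>" "superlevel b k \<in> sets borel"
proof -
  have "continuous_on (cball Q b) u"
    by (rule continuous_on_subset[OF u_cont]) (use assms in auto)
  then have "closed (cball Q b \<inter> u -` {k..})"
    by (intro continuous_closed_preimage) auto
  moreover have "superlevel b k = cball Q b \<inter> u -` {k..}" by (auto simp: superlevel_def)
  ultimately have "closed (superlevel b k)" by simp
  moreover have "bounded (superlevel b k)" by (rule bounded_subset[OF bounded_cball[of Q b]]) (auto simp: superlevel_def)
  ultimately show c: "compact (superlevel b k)" by (simp add: compact_eq_bounded_closed)
  show "superlevel b k \<in> sets borel" using c by (simp add: borel_compact)
  show "superlevel b k \<subseteq> ball Q r \<inter> \<Omega>" using u_zero assms(2) by (fastforce simp: superlevel_def)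
qed

text \<open>
  Closeness of the gradients is required on a superlevel set only. Elsewhere mollification would
  look across the boundary of \<open>\<Omega>\<close>, where nothing is known about a weak gradient.
\<close>

definition approximates :: "real \<Rightarrow> real \<Rightarrow> real \<Rightarrow> (real^'n \<Rightarrow> real) \<Rightarrow> bool" where
  "approximates b k e f \<longleftrightarrow> C1 f \<and> (\<forall>x. f x \<le> 1) \<and> (\<forall>x\<in>cball Q b. \<bar>f x - u x\<bar> \<le> e) \<and>
     (\<integral>\<^sup>+ x\<in>superlevel b k. ennreal ((norm (gradient f x - g x))\<^sup>2) \<partial>lborel) \<le> ennreal e"

lemma u_integrable: "integrable lborel u"
proof (rule Bochner_Integration.integrable_bound)
  show "integrable lborel (indicator (ball Q r) :: real^'n \<Rightarrow> real)"
    using emeasure_bounded_finite[of "ball Q r"] by (simp add: integrable_indicator_iff)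
  show "AE x in lborel. norm (u x) \<le> norm (indicat_real (ball Q r) x)"
    using u_le u_zero by (intro AE_I2) (auto simp: indicator_def)
qed simp

text \<open>
  The approximation is a mollification of \<open>u\<close> at a scale smaller than the distance of the
  superlevel set from the complement of \<open>ball Q r \<inter> \<Omega>\<close>. Then the reflected kernel is an admissible
  test function, and the weak gradient identifies the gradient of the mollification of \<open>u\<close> with the
  mollification of \<open>g\<close>.
\<close>

lemma approximation_exists:
  assumes b: "b < r" and k: "k > 0" and e: "e > 0"
  obtains f where "approximates b k e f"
proof -
  let ?K = "superlevel b k" and ?U = "ball Q r \<inter> \<Omega>"
  define b' where "b' = (b + r) / 2"
  have b': "b < b'" "b' < r" using b by (auto simp: b'_def)
  have "uniformly_continuous_on (cball Q b') u"
    by (intro compact_uniformly_continuous continuous_on_subset[OF u_cont]) (use b' in auto)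
  then obtain d1 where d1: "d1 > 0" "\<And>x y. x \<in> cball Q b' \<Longrightarrow> y \<in> cball Q b' \<Longrightarrow> dist x y < d1 \<Longrightarrow> \<bar>u y - u x\<bar> < e"
    using e unfolding uniformly_continuous_on_def by (metis dist_commute dist_real_def)
  have opU: "open ?U" using \<Omega> by auto
  note K = superlevel_compact[OF b k]
  obtain d2 where d2: "d2 > 0" "\<And>x y. x \<in> ?K \<Longrightarrow> dist x y < d2 \<Longrightarrow> y \<in> ?U"
    using compact_in_open_margin[OF K(1) opU K(2)] by metis
  obtain R where R: "\<And>x. x \<in> ball Q r \<Longrightarrow> x \<in> cball 0 R"
    using bounded_ball[of Q r] unfolding bounded_iff mem_cball_0 by blast
  have gz: "g x $ i = 0" if "x \<notin> cball 0 R" for x i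
  proof -
    have "x \<notin> ball Q r \<inter> \<Omega>" using R that by blast
    then show ?thesis by (simp add: g_zero)
  qed
  let ?n = "real CARD('n)"
  have n: "?n > 0" by simp
  have "\<forall>i. \<exists>d>0. \<forall>\<epsilon> \<rho>. \<epsilon> \<le> d \<longrightarrow> mollifier \<epsilon> \<rho> \<longrightarrow>
    (\<integral>\<^sup>+ x\<in>cball 0 R. ennreal ((conv (\<lambda>y. g y $ i) \<rho> x - g x $ i)\<^sup>2) \<partial>lborel) \<le> ennreal (e / ?n)"
  proof
    fix i
    have "e / ?n > 0" using e n by simp
    from conv_mean_square_limit[OF g_component_borel g_component_fin gz this]
    show "\<exists>d>0. \<forall>\<epsilon> \<rho>. \<epsilon> \<le> d \<longrightarrow> mollifier \<epsilon> \<rho> \<longrightarrow>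
      (\<integral>\<^sup>+ x\<in>cball 0 R. ennreal ((conv (\<lambda>y. g y $ i) \<rho> x - g x $ i)\<^sup>2) \<partial>lborel) \<le> ennreal (e / ?n)"
      by blast
  qed
  from choice[OF this] obtain d3 where d3': "\<forall>i. d3 i > 0 \<and> (\<forall>\<epsilon> \<rho>. \<epsilon> \<le> d3 i \<longrightarrow> mollifier \<epsilon> \<rho> \<longrightarrow>
    (\<integral>\<^sup>+ x\<in>cball 0 R. ennreal ((conv (\<lambda>y. g y $ i) \<rho> x - g x $ i)\<^sup>2) \<partial>lborel) \<le> ennreal (e / ?n))" ..
  have d3: "\<And>i. d3 i > 0" "\<And>i \<epsilon> \<rho>. \<epsilon> \<le> d3 i \<Longrightarrow> mollifier \<epsilon> \<rho> \<Longrightarrow>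
    (\<integral>\<^sup>+ x\<in>cball 0 R. ennreal ((conv (\<lambda>y. g y $ i) \<rho> x - g x $ i)\<^sup>2) \<partial>lborel) \<le> ennreal (e / ?n)"
    using d3' by blast+
  define \<epsilon> where "\<epsilon> = Min ({d1, d2 / 2, b' - b} \<union> range d3)"
  have \<epsilon>: "\<epsilon> > 0" "\<epsilon> \<le> d1" "\<epsilon> \<le> d2 / 2" "\<epsilon> \<le> b' - b" "\<And>i. \<epsilon> \<le> d3 i"
  proof -
    let ?M = "{d1, d2 / 2, b' - b} \<union> range d3"
    have le: "\<epsilon> \<le> m" if "m \<in> ?M" for m unfolding \<epsilon>_def by (rule Min_le[OF _ that]) simp
    show "\<epsilon> > 0" unfolding \<epsilon>_def using d1(1) d2(1) d3(1) b' by (subst Min_gr_iff) auto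
    show "\<epsilon> \<le> d1" "\<epsilon> \<le> d2 / 2" "\<epsilon> \<le> b' - b" "\<And>i. \<epsilon> \<le> d3 i" by (intro le; simp)+
  qed
  obtain \<rho> :: "real^'n \<Rightarrow> real" where m: "mollifier \<epsilon> \<rho>" using exists_mollifier[OF \<epsilon>(1)] by blast
  define f where "f = conv u \<rho>"
  have "Ck (Suc 0) f" unfolding f_def
    by (rule Ck_conv[OF u_integrable _ mollifier_bounded_support[OF m]]) (use m in \<open>simp only: mollifier_def\<close>)
  then have C: "C1 f" by (simp only: C1_iff_Ck)
  have grad: "gradient f x $ i = conv (\<lambda>y. g y $ i) \<rho> x" if x: "x \<in> ?K" for x i
  proof -
    let ?p = "\<lambda>y. \<rho> (x - y)"
    have dif: "\<rho> differentiable (at z)" for z using mollifier_C1[OF m] by (simp add: C1_def)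
    have "{y. ?p y \<noteq> 0} \<subseteq> cball x \<epsilon>"
    proof
      fix y assume "y \<in> {y. ?p y \<noteq> 0}"
      then have "\<not> \<epsilon> \<le> norm (x - y)" using m by (auto simp: mollifier_def)
      then show "y \<in> cball x \<epsilon>" by (simp add: dist_norm)
    qed
    then have cl: "closure {y. ?p y \<noteq> 0} \<subseteq> cball x \<epsilon>" by (intro closure_minimal) auto
    have "cball x \<epsilon> \<subseteq> ?U"
    proof
      fix y assume "y \<in> cball x \<epsilon>"
      then have "dist x y < d2" using \<epsilon>(3) d2(1) by simp
      then show "y \<in> ?U" by (rule d2(2)[OF x])
    qed
    moreover have "compact (closure {y. ?p y \<noteq> 0})"
      unfolding compact_closure by (rule bounded_subset[OF bounded_cball subset_trans[OF closure_subset cl]])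
    moreover have "Ck k ?p" for k by (rule Ck_reflect) (use m in \<open>simp add: mollifier_def\<close>)
    ultimately have T: "?p \<in> test_functions ?U" using cl by (auto simp: test_functions_def)
    have "gradient f x $ i = conv u (\<lambda>z. gradient \<rho> z $ i) x"
      unfolding f_def by (rule conv_gradient[OF u_integrable mollifier_C1[OF m] mollifier_bounded_support[OF m]])
    also have "\<dots> = - (\<integral> y. u y * gradient ?p y $ i \<partial>lborel)"
      by (simp add: conv_def gradient_reflect[OF dif])
    also have "\<dots> = conv (\<lambda>y. g y $ i) \<rho> x" by (simp add: weak_grad[OF T] conv_def)
    finally show ?thesis .
  qed
  have "approximates b k e f"
    unfolding approximates_def
  proof (intro conjI allI ballI C)
    show "f x \<le> 1" for x unfolding f_def
      by (rule conv_mollifier_le[OF u_integrable m]) (use u_le in \<open>auto simp: abs_le_iff\<close>)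
    show "\<bar>f x - u x\<bar> \<le> e" if "x \<in> cball Q b" for x unfolding f_def
    proof (rule conv_mollifier_near[OF u_integrable m])
      fix y assume y: "dist x y < \<epsilon>"
      have "dist Q y \<le> dist Q x + dist x y" by (rule dist_triangle)
      then have "x \<in> cball Q b'" "y \<in> cball Q b'" using that y \<epsilon> b' by auto
      then show "\<bar>u y - u x\<bar> \<le> e" using d1(2)[of x y] y \<epsilon> by auto
    qed
    have [measurable]: "conv (\<lambda>y. g y $ i) \<rho> \<in> borel_measurable borel" for i
    proof -
      have "integrable lborel (\<lambda>y. g y $ i)"
      proof (rule integrable_of_square_integrable(1)[of _ R])
        show "(\<integral>\<^sup>+ x. ennreal ((g x $ i)\<^sup>2) \<partial>lborel) < \<infinity>" by (rule g_component_fin)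
        show "x \<notin> cball 0 R \<Longrightarrow> g x $ i = 0" for x by (rule gz)
      qed measurable
      then show ?thesis
        by (intro borel_measurable_continuous_onI conv_continuous C1_continuous[OF mollifier_C1[OF m]] mollifier_bounded_support[OF m])
    qed
    have "(\<integral>\<^sup>+ x\<in>?K. ennreal ((norm (gradient f x - g x))\<^sup>2) \<partial>lborel)
      \<le> (\<integral>\<^sup>+ x. (\<Sum>i\<in>UNIV. ennreal ((conv (\<lambda>y. g y $ i) \<rho> x - g x $ i)\<^sup>2) * indicator (cball 0 R) x) \<partial>lborel)"
    proof (intro nn_integral_mono)
      fix x
      show "ennreal ((norm (gradient f x - g x))\<^sup>2) * indicator ?K x
        \<le> (\<Sum>i\<in>UNIV. ennreal ((conv (\<lambda>y. g y $ i) \<rho> x - g x $ i)\<^sup>2) * indicator (cball 0 R) x)"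
      proof (cases "x \<in> ?K")
        case True
        then have xR: "x \<in> cball 0 R" using K(2) R by auto
        have "(norm (gradient f x - g x))\<^sup>2 = (\<Sum>i\<in>UNIV. (conv (\<lambda>y. g y $ i) \<rho> x - g x $ i)\<^sup>2)"
          unfolding power2_norm_eq_inner inner_vec_def using grad[OF True] by (simp add: power2_eq_square)
        then have "ennreal ((norm (gradient f x - g x))\<^sup>2) = (\<Sum>i\<in>UNIV. ennreal ((conv (\<lambda>y. g y $ i) \<rho> x - g x $ i)\<^sup>2))"
          by (simp add: sum_ennreal)
        then show ?thesis using True xR by simp
      qed simp
    qed
    also have "\<dots> = (\<Sum>i\<in>UNIV. \<integral>\<^sup>+ x\<in>cball 0 R. ennreal ((conv (\<lambda>y. g y $ i) \<rho> x - g x $ i)\<^sup>2) \<partial>lborel)"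
      by (rule nn_integral_sum) measurable
    also have "\<dots> \<le> (\<Sum>i\<in>(UNIV::'n set). ennreal (e / ?n))"
      by (intro sum_mono d3(2)[OF \<epsilon>(5) m])
    also have "\<dots> = ennreal (\<Sum>i\<in>(UNIV::'n set). e / ?n)" using e n by (subst sum_ennreal) auto
    also have "\<dots> = ennreal e" by simp
    finally show "(\<integral>\<^sup>+ x\<in>?K. ennreal ((norm (gradient f x - g x))\<^sup>2) \<partial>lborel) \<le> ennreal e" .
  qed
  then show thesis by (rule that)
qed

lemma g_square_integrable: "integrable lborel (\<lambda>x. (norm (g x))\<^sup>2)"
  by (rule integrableI_bounded) (use g_fin in auto)

text \<open>
  The test function is \<open>\<Phi> (f x) * (cutoff Q b x)\<^sup>2\<close>, which vanishes where \<open>f \<le> \<kappa>\<close> and therefore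
  has compact support in \<open>ball Q r \<inter> \<Omega>\<close>. Coercivity gives a term with \<open>\<Phi>' \<ge> P\<^sup>2\<close>, and the mixed term
  contains \<open>\<Phi>\<close>, which \<open>P * S\<close> bounds. The lemma is used with \<open>S = 1\<close> for the logarithm of the solution
  and with \<open>S\<close> the square of a truncation, and \<open>P\<close> the derivative of that square, for the De Giorgi
  step.
\<close>

lemma energy_inequality:
  fixes \<Phi> \<Phi>' P S :: "real \<Rightarrow> real"
  assumes b: "0 < b" "b < r" and \<kappa>: "\<kappa> > 0" and \<eta>: "\<eta> > 0"
    and D: "\<And>t. t \<le> 1 \<Longrightarrow> (\<Phi> has_real_derivative \<Phi>' t) (at t)" and c\<Phi>': "continuous_on {..1} \<Phi>'"
    and \<Phi>0: "\<And>t. t \<le> \<kappa> \<Longrightarrow> \<Phi> t = 0" "\<And>t. t \<le> \<kappa> \<Longrightarrow> \<Phi>' t = 0"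
    and P: "continuous_on {..1} P" "\<And>t. t \<le> 1 \<Longrightarrow> 0 \<le> P t" "\<And>t. t \<le> 1 \<Longrightarrow> (P t)\<^sup>2 \<le> \<Phi>' t"
    and S: "continuous_on {..1} S" "\<And>t. t \<le> 1 \<Longrightarrow> 0 \<le> S t" "\<And>t. t \<le> 1 \<Longrightarrow> \<bar>\<Phi> t\<bar> \<le> P t * S t"
  obtains e0 where "e0 > 0" "\<And>e f. e \<le> e0 \<Longrightarrow> approximates b (\<kappa> / 2) e f \<Longrightarrow>
    (\<integral> x. (P (f x))\<^sup>2 * (cutoff Q b x)\<^sup>2 * (norm (gradient f x))\<^sup>2 \<partial>lborel)
      \<le> 4 * lam ^ 4 * (\<integral> x. (S (f x))\<^sup>2 * (norm (gradient (cutoff Q b) x))\<^sup>2 \<partial>lborel) + \<eta>"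
proof -
  let ?K = "superlevel b (\<kappa> / 2)" and ?\<psi> = "cutoff Q b"
  have \<kappa>2: "\<kappa> / 2 > 0" using \<kappa> by simp
  note K = superlevel_compact[OF b(2) \<kappa>2]
  note [measurable] = K(3)
  have c\<Phi>: "continuous_on {..1} \<Phi>"
    using D by (intro continuous_at_imp_continuous_on) (auto intro: DERIV_isCont)
  have "bounded (\<Phi>' ` {\<kappa>..1})"
    by (intro compact_imp_bounded compact_continuous_image continuous_on_subset[OF c\<Phi>']) auto
  then obtain M1 where M1: "\<And>t. t \<in> {\<kappa>..1} \<Longrightarrow> \<bar>\<Phi>' t\<bar> \<le> M1"
    unfolding bounded_iff real_norm_def by blast
  have "bounded (\<Phi> ` {\<kappa>..1})"
    by (intro compact_imp_bounded compact_continuous_image continuous_on_subset[OF c\<Phi>]) auto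
  then obtain M2 where M2: "\<And>t. t \<in> {\<kappa>..1} \<Longrightarrow> \<bar>\<Phi> t\<bar> \<le> M2"
    unfolding bounded_iff real_norm_def by blast
  \<comment> \<open>\<open>L\<close> bounds the coefficients of the error terms in \<open>energy_pointwise\<close>; the summand 1 makes it positive.\<close>
  define L where "L = lam * \<bar>M1\<bar> * (b ^ 4)\<^sup>2 + 2 * lam * b ^ 4 * \<bar>M2\<bar> * (4 * b ^ 3) + 1"
  have L: "L > 0" unfolding L_def using lam b by (intro add_nonneg_pos add_nonneg_nonneg mult_nonneg_nonneg) auto
  define N where "N = (\<integral> x. (norm (g x))\<^sup>2 + indicat_real ?K x \<partial>lborel)"
  have N: "N \<ge> 0" unfolding N_def by simp
  have iK: "integrable lborel (indicat_real ?K)"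
    using emeasure_bounded_finite[OF compact_imp_bounded[OF K(1)]] K(3) by (simp add: integrable_indicator_iff)
  \<comment> \<open>\<open>\<theta>\<close> makes the error term with \<open>g\<close> small, and \<open>e1\<close>, chosen afterwards, the one with \<open>1 / \<theta>\<close>.\<close>
  define \<theta> where "\<theta> = \<eta> / (2 * lam) / (4 * L * (N + 1))"
  have \<theta>: "\<theta> > 0" unfolding \<theta>_def using \<eta> L N lam by (intro divide_pos_pos mult_pos_pos) auto
  define e1 where "e1 = \<eta> / (2 * lam) / (2 * L * (1 + 1 / (4 * \<theta>)))"
  have e1: "e1 > 0" unfolding e1_def using \<eta> L \<theta> lam by (intro divide_pos_pos mult_pos_pos add_pos_pos) auto
  show thesis
  proof (rule that[of "min e1 (\<kappa> / 4)"])
    show "0 < min e1 (\<kappa> / 4)" using e1 \<kappa> by simp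
    fix e f assume e: "e \<le> min e1 (\<kappa> / 4)" and f: "approximates b (\<kappa> / 2) e f"
    have C: "C1 f" and f1: "\<And>x. f x \<le> 1" and near: "\<And>x. x \<in> cball Q b \<Longrightarrow> \<bar>f x - u x\<bar> \<le> e"
      and gr: "(\<integral>\<^sup>+ x\<in>?K. ennreal ((norm (gradient f x - g x))\<^sup>2) \<partial>lborel) \<le> ennreal e"
      using f by (auto simp: approximates_def)
    have [measurable]: "f \<in> borel_measurable borel" "gradient f \<in> borel_measurable borel" using C1_borel[OF C] by simp_all
    have inK: "x \<in> ?K" if "x \<in> cball Q b" "\<kappa> < f x" for x
      using near[OF that(1)] that e \<kappa> by (auto simp: superlevel_def)
    have fC: "C1 (\<lambda>x. \<Phi> (f x))" "gradient (\<lambda>x. \<Phi> (f x)) = (\<lambda>x. \<Phi>' (f x) *\<^sub>R gradient f x)"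
      by (rule C1_compose[OF C, where T="{..1}" and H=\<Phi> and H'=\<Phi>']; use D f1 c\<Phi>' in auto)+
    have pC: "C1 (\<lambda>x. ?\<psi> x * ?\<psi> x)" "gradient (\<lambda>x. ?\<psi> x * ?\<psi> x) = (\<lambda>x. (2 * ?\<psi> x) *\<^sub>R gradient ?\<psi> x)"
      using C1_mult[OF cutoff_C1 cutoff_C1, of Q b Q b] by (simp_all flip: scaleR_add_left)
    define \<phi> where "\<phi> = (\<lambda>x. \<Phi> (f x) * (?\<psi> x * ?\<psi> x))"
    have \<phi>C: "C1 \<phi>" unfolding \<phi>_def by (rule C1_mult(1)[OF fC(1) pC(1)])
    have \<phi>g: "gradient \<phi> x = \<Phi> (f x) *\<^sub>R ((2 * ?\<psi> x) *\<^sub>R gradient ?\<psi> x) + (?\<psi> x * ?\<psi> x) *\<^sub>R (\<Phi>' (f x) *\<^sub>R gradient f x)" for x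
      unfolding \<phi>_def by (subst C1_mult(2)[OF fC(1) pC(1)]) (simp only: fC(2) pC(2))
    have \<phi>K: "\<phi> x = 0" if "x \<notin> ?K" for x
    proof (cases "x \<in> cball Q b")
      case True
      then have "f x \<le> \<kappa>" using inK[of x] that by force
      then show ?thesis by (simp add: \<phi>_def \<Phi>0)
    next
      case False
      then show ?thesis using b by (simp add: \<phi>_def cutoff_off_ball)
    qed
    have eq0: "(\<integral> x. F x \<bullet> gradient \<phi> x \<partial>lborel) = 0"
      by (rule weak_equation_C1_test[OF F_int _ weak_eq \<phi>C K(1,2) \<phi>K]) (use \<Omega> in auto)
    have \<phi>supp: "bounded {x. \<phi> x \<noteq> 0}" by (rule bounded_subset[OF compact_imp_bounded[OF K(1)]]) (use \<phi>K in auto)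
    have iF: "integrable lborel (\<lambda>x. F x \<bullet> gradient \<phi> x)"
      by (rule integrable_inner_gradient[OF F_int \<phi>C \<phi>supp])
    let ?A = "\<lambda>x. (P (f x))\<^sup>2 * (?\<psi> x)\<^sup>2 * (norm (gradient f x))\<^sup>2"
    let ?S = "\<lambda>x. (S (f x))\<^sup>2 * (norm (gradient ?\<psi> x))\<^sup>2"
    let ?E = "\<lambda>x. (norm (gradient f x - g x))\<^sup>2 * indicat_real ?K x"
    let ?N = "\<lambda>x. (norm (g x))\<^sup>2 + indicat_real ?K x"
    have cf: "continuous_on UNIV (\<lambda>x. G (f x))" if "continuous_on {..1} G" for G :: "real \<Rightarrow> real"
      by (rule continuous_on_compose2[OF that C1_continuous[OF C]]) (use f1 in auto)
    have iA: "integrable lborel ?A"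
    proof (rule integrable_continuous_off_ball[where Q=Q and b=b])
      show "continuous_on UNIV ?A"
        by (intro continuous_intros cf P C1_continuous[OF cutoff_C1] C1_continuous_gradient[OF C])
    qed (use b(1) in \<open>simp add: cutoff_off_ball\<close>)
    have iS: "integrable lborel ?S"
    proof (rule integrable_continuous_off_ball[where Q=Q and b=b])
      show "continuous_on UNIV ?S"
        by (intro continuous_intros cf S C1_continuous_gradient[OF cutoff_C1])
    qed (use b(1) in \<open>simp add: cutoff_off_ball\<close>)
    have nE: "(\<integral>\<^sup>+ x. ennreal (?E x) \<partial>lborel) \<le> ennreal e"
    proof -
      have "(\<integral>\<^sup>+ x. ennreal (?E x) \<partial>lborel) = (\<integral>\<^sup>+ x\<in>?K. ennreal ((norm (gradient f x - g x))\<^sup>2) \<partial>lborel)"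
        by (intro nn_integral_cong) (auto simp: indicator_def)
      with gr show ?thesis by simp
    qed
    have iE: "integrable lborel ?E"
    proof (rule integrableI_bounded)
      have "(\<integral>\<^sup>+ x. ennreal (norm (?E x)) \<partial>lborel) = (\<integral>\<^sup>+ x. ennreal (?E x) \<partial>lborel)" by simp
      also have "\<dots> < \<infinity>" using nE by (simp add: order.strict_trans1)
      finally show "(\<integral>\<^sup>+ x. ennreal (norm (?E x)) \<partial>lborel) < \<infinity>" .
    qed measurable
    have IE: "(\<integral> x. ?E x \<partial>lborel) \<le> e1"
    proof -
      have "ennreal (\<integral> x. ?E x \<partial>lborel) \<le> ennreal e"
        using nE by (subst nn_integral_eq_integral[OF iE, symmetric]) auto
      also have "\<dots> \<le> ennreal e1" using e by (intro ennreal_leI) simp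
      finally show ?thesis using e1 by (simp add: ennreal_le_iff)
    qed
    have iN: "integrable lborel ?N" using g_square_integrable iK by simp
    have "0 \<ge> (\<integral> x. 1 / (2 * lam) * ?A x - 2 * lam ^ 3 * ?S x - L * ((1 + 1 / (4 * \<theta>)) * ?E x + 2 * \<theta> * ?N x) \<partial>lborel)"
      unfolding eq0[symmetric]
    proof (rule integral_mono_AE)
      show "AE x in lborel. 1 / (2 * lam) * ?A x - 2 * lam ^ 3 * ?S x - L * ((1 + 1 / (4 * \<theta>)) * ?E x + 2 * \<theta> * ?N x)
          \<le> F x \<bullet> gradient \<phi> x"
        using elliptic
      proof eventually_elim
        case (elim x)
        show ?case
        proof (cases "x \<in> cball Q b \<and> \<kappa> < f x")
          case False
          then have z: "?\<psi> x = 0 \<or> \<Phi> (f x) = 0 \<and> \<Phi>' (f x) = 0 \<and> P (f x) = 0"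
          proof (cases "x \<in> cball Q b")
            case True
            then have le: "f x \<le> \<kappa>" using False by auto
            have "(P (f x))\<^sup>2 \<le> 0" using P(3)[OF f1] \<Phi>0(2)[OF le] by metis
            then show ?thesis using \<Phi>0[OF le] by simp
          next
            case False
            then show ?thesis using b by (simp add: cutoff_off_ball)
          qed
          then have "F x \<bullet> gradient \<phi> x = 0" "1 / (2 * lam) * ?A x = 0" by (auto simp: \<phi>g)
          moreover have "0 \<le> 2 * lam ^ 3 * ?S x" using lam by simp
          moreover have "0 \<le> L * ((1 + 1 / (4 * \<theta>)) * ?E x + 2 * \<theta> * ?N x)"
            using L \<theta> by (intro mult_nonneg_nonneg add_nonneg_nonneg) auto
          ultimately show ?thesis by linarith
        next
          case True
          then have xK: "x \<in> ?K" using inK by blast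
          have k1: "f x \<in> {\<kappa>..1}" using True f1 by auto
          have \<Phi>'x: "0 \<le> \<Phi>' (f x)" "\<Phi>' (f x) \<le> \<bar>M1\<bar>" "\<bar>\<Phi> (f x)\<bar> \<le> \<bar>M2\<bar>"
            using P(3)[OF f1, of x] M1[OF k1] M2[OF k1] by (auto intro: order_trans[OF zero_le_power2])
          have xU: "x \<in> ball Q r \<inter> \<Omega>" using xK K(2) by auto
          have "(?\<psi> x)\<^sup>2 * \<Phi>' (f x) * lam \<le> (b ^ 4)\<^sup>2 * \<bar>M1\<bar> * lam"
            using \<Phi>'x cutoff_bounds(1)[OF b(1), of Q x] cutoff_nonneg[of Q b x] lam
            by (intro mult_right_mono mult_mono power_mono) auto
          moreover have "0 \<le> 2 * lam * b ^ 4 * \<bar>M2\<bar> * (4 * b ^ 3)" using lam b by simp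
          moreover have "lam * \<bar>M1\<bar> * (b ^ 4)\<^sup>2 = (b ^ 4)\<^sup>2 * \<bar>M1\<bar> * lam" by (simp only: mult_ac)
          ultimately have l1: "(?\<psi> x)\<^sup>2 * \<Phi>' (f x) * lam \<le> L" unfolding L_def by linarith
          have "2 * lam * ?\<psi> x * \<bar>\<Phi> (f x)\<bar> * norm (gradient ?\<psi> x) \<le> 2 * lam * b ^ 4 * \<bar>M2\<bar> * (4 * b ^ 3)"
            using \<Phi>'x cutoff_bounds[OF b(1), of Q x] cutoff_nonneg[of Q b x] lam b by (intro mult_mono mult_nonneg_nonneg) auto
          moreover have "0 \<le> lam * \<bar>M1\<bar> * (b ^ 4)\<^sup>2" using lam by simp
          ultimately have l2: "2 * lam * ?\<psi> x * \<bar>\<Phi> (f x)\<bar> * norm (gradient ?\<psi> x) \<le> L"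
            unfolding L_def by linarith
          have "1 / (2 * lam) * ?A x - 2 * lam ^ 3 * ?S x
              - L * ((1 + 1 / (4 * \<theta>)) * (norm (gradient f x - g x))\<^sup>2 + 2 * \<theta> * ((norm (g x))\<^sup>2 + 1))
            \<le> F x \<bullet> gradient \<phi> x"
            unfolding \<phi>g
            by (rule energy_pointwise[OF lam \<theta> cutoff_nonneg _ _ P(2)[OF f1] P(3)[OF f1] S(3)[OF f1] l1 l2])
              (use elim xU in blast)+
          then show ?thesis using xK by simp
        qed
      qed
      show "integrable lborel (\<lambda>x. 1 / (2 * lam) * ?A x - 2 * lam ^ 3 * ?S x - L * ((1 + 1 / (4 * \<theta>)) * ?E x + 2 * \<theta> * ?N x))"
        by (intro Bochner_Integration.integrable_diff Bochner_Integration.integrable_add integrable_mult_right iA iS iE iN)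
    qed (rule iF)
    also have "(\<integral> x. 1 / (2 * lam) * ?A x - 2 * lam ^ 3 * ?S x - L * ((1 + 1 / (4 * \<theta>)) * ?E x + 2 * \<theta> * ?N x) \<partial>lborel)
      = 1 / (2 * lam) * (\<integral> x. ?A x \<partial>lborel) - 2 * lam ^ 3 * (\<integral> x. ?S x \<partial>lborel)
        - L * ((1 + 1 / (4 * \<theta>)) * (\<integral> x. ?E x \<partial>lborel) + 2 * \<theta> * N)"
      unfolding N_def by (rule integral_linear_combination[OF iA iS iE iN])
    finally have main: "1 / (2 * lam) * (\<integral> x. ?A x \<partial>lborel) \<le> 2 * lam ^ 3 * (\<integral> x. ?S x \<partial>lborel)
        + L * ((1 + 1 / (4 * \<theta>)) * (\<integral> x. ?E x \<partial>lborel) + 2 * \<theta> * N)" by linarith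
    have "L * ((1 + 1 / (4 * \<theta>)) * (\<integral> x. ?E x \<partial>lborel) + 2 * \<theta> * N) \<le> \<eta> / (2 * lam)"
    proof -
      have c1: "L * (c * (y / (2 * L * c))) = y / 2" if "c > 0" for c y
        using L that by (simp add: field_simps)
      have c2: "L * (2 * (y / (4 * L * c)) * c) = y / 2" if "c > 0" for c y
        using L that by (simp add: field_simps)
      have t0: "1 + 1 / (4 * \<theta>) > 0" using \<theta> by (intro add_pos_pos) auto
      have "L * ((1 + 1 / (4 * \<theta>)) * (\<integral> x. ?E x \<partial>lborel)) \<le> L * ((1 + 1 / (4 * \<theta>)) * e1)"
        using IE L t0 by (intro mult_left_mono) auto
      also have "\<dots> = \<eta> / (2 * lam) / 2" unfolding e1_def by (rule c1[OF t0])
      finally have 1: "L * ((1 + 1 / (4 * \<theta>)) * (\<integral> x. ?E x \<partial>lborel)) \<le> \<eta> / (2 * lam) / 2" .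
      have "L * (2 * \<theta> * N) \<le> L * (2 * \<theta> * (N + 1))" using L \<theta> by (intro mult_left_mono) auto
      also have "\<dots> = \<eta> / (2 * lam) / 2"
        unfolding \<theta>_def by (rule c2) (use N in linarith)
      finally have 2: "L * (2 * \<theta> * N) \<le> \<eta> / (2 * lam) / 2" .
      from 1 2 show ?thesis by (simp add: distrib_left)
    qed
    note le = this
    define X Y where "X = (\<integral> x. ?A x \<partial>lborel)" and "Y = (\<integral> x. ?S x \<partial>lborel)"
    have "1 / (2 * lam) * X \<le> 2 * lam ^ 3 * Y + \<eta> / (2 * lam)"
      unfolding X_def Y_def by (rule order.trans[OF main add_left_mono[OF le]])
    then have "(2 * lam) * (1 / (2 * lam) * X) \<le> (2 * lam) * (2 * lam ^ 3 * Y + \<eta> / (2 * lam))"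
      using lam by (intro mult_left_mono) auto
    also have "(2 * lam) * (1 / (2 * lam) * X) = X" using lam by simp
    also have "(2 * lam) * (2 * lam ^ 3 * Y + \<eta> / (2 * lam)) = (2 * lam) * (2 * lam ^ 3 * Y) + (2 * lam) * (\<eta> / (2 * lam))"
      by (rule distrib_left)
    also have "(2 * lam) * (\<eta> / (2 * lam)) = \<eta>" using lam by simp
    also have "(2 * lam) * (2 * lam ^ 3 * Y) = 4 * (lam * lam ^ 3) * Y" by simp
    also have "lam * lam ^ 3 = lam ^ 4" by (simp add: power3_eq_cube power4_eq_xxxx)
    finally show "(\<integral> x. ?A x \<partial>lborel) \<le> 4 * lam ^ 4 * (\<integral> x. ?S x \<partial>lborel) + \<eta>"
      by (simp only: X_def Y_def)
  qed
qed

end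

section \<open>De Giorgi iteration\<close>

context dirichlet_solution
begin

text \<open>
  The fourth power arises because the energy inequality is applied to the square of the truncation
  \<open>(u - l)\<^sub>+\<close>. The truncation itself is not of class C1; its square is, and so is the product
  \<open>2 * (t - l)\<^sub>+ ^ 3\<close> of that square with its derivative, which enters the test function.
\<close>

definition excess :: "real \<Rightarrow> real \<Rightarrow> real" where
  "excess l b = (\<integral> x. (max 0 (u x - l)) ^ 4 * indicat_real (ball Q b) x \<partial>lborel)"

lemma bounded_ball_integrable:
  fixes h :: "real^'n \<Rightarrow> real"
  assumes [measurable]: "h \<in> borel_measurable borel" and B: "\<And>x. x \<in> ball Q b \<Longrightarrow> \<bar>h x\<bar> \<le> B"
  shows "integrable lborel (\<lambda>x. h x * indicat_real (ball Q b) x)"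
proof (rule Bochner_Integration.integrable_bound)
  show "integrable lborel (\<lambda>x. B * indicat_real (ball Q b) x)"
    using emeasure_bounded_finite[of "ball Q b"] by (simp add: integrable_indicator_iff)
  show "(\<lambda>x. h x * indicat_real (ball Q b) x) \<in> borel_measurable lborel" by measurable
  show "AE x in lborel. norm (h x * indicat_real (ball Q b) x) \<le> norm (B * indicat_real (ball Q b) x)"
    using B by (intro AE_I2) (force simp: indicator_def)
qed

lemma excess_integrable:
  assumes "l \<ge> 0"
  shows "integrable lborel (\<lambda>x. (max 0 (u x - l)) ^ 4 * indicat_real (ball Q b) x)"
proof (rule bounded_ball_integrable)
  show "\<bar>(max 0 (u x - l)) ^ 4\<bar> \<le> 1" for x
    using u_le[of x] assms by (auto simp: abs_le_iff intro!: power_le_one)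
qed measurable

lemma excess_nonneg: "excess l b \<ge> 0"
  unfolding excess_def by (intro Bochner_Integration.integral_nonneg) simp

text \<open>
  The square of the truncation at the intermediate level \<open>m\<close>, times a cutoff, is supported where the
  approximation exceeds \<open>m\<close>; by Chebyshev's inequality this set has measure at most a multiple of
  \<open>excess l b\<close>. The hypothesis \<open>small\<close> therefore allows \<open>faber_krahn\<close> with radius \<open>\<delta>\<close>, and the
  energy inequality bounds the gradient. The gaps between \<open>l\<close>, \<open>m\<close> and \<open>l'\<close> leave room for the
  difference of \<open>u\<close> and its approximation.
\<close>

lemma de_giorgi_step:
  assumes ab: "0 < a" "a < b" "b < r" and l: "0 \<le> l" "l < l'" and \<delta>: "\<delta> > 0"
    and small: "2 * excess l b \<le> ((l' - l) / 4) ^ 4 * (unit_ball_vol CARD('n) * \<delta> ^ CARD('n))"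
  shows "(b\<^sup>2 - a\<^sup>2) ^ 4 * excess l' a \<le> 32 * (8 * lam ^ 4 + 2) * (\<delta>\<^sup>2 * b ^ 6 * excess l b)"
proof -
  have b0: "0 < b" using ab by simp
  define m where "m = (l + l') / 2"
  have m: "l < m" "m < l'" "m > 0" using l by (auto simp: m_def)
  let ?\<psi> = "cutoff Q b"
  have step: "(b\<^sup>2 - a\<^sup>2) ^ 4 * excess l' a \<le> 32 * (8 * lam ^ 4 + 2) * (\<delta>\<^sup>2 * b ^ 6 * excess l b) + 4 * \<delta>\<^sup>2 * \<eta>"
    if \<eta>: "\<eta> > 0" for \<eta>
  proof -
    define pp where "pp = (\<lambda>t. max 0 (t - m))"
    have ppc: "continuous_on S pp" for S unfolding pp_def by (intro continuous_intros)
    have pp0: "pp t \<ge> 0" for t by (simp add: pp_def)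
    have D: "((\<lambda>t. pp t ^ Suc (Suc k)) has_real_derivative real (Suc (Suc k)) * pp t ^ Suc k) (at t)" for k t
      unfolding pp_def by (rule pospart_power_DERIV_shift)
    obtain e0 where e0: "e0 > 0" "\<And>e f. e \<le> e0 \<Longrightarrow> approximates b (m / 2) e f \<Longrightarrow>
      (\<integral> x. (2 * pp (f x))\<^sup>2 * (?\<psi> x)\<^sup>2 * (norm (gradient f x))\<^sup>2 \<partial>lborel)
      \<le> 4 * lam ^ 4 * (\<integral> x. ((pp (f x))\<^sup>2)\<^sup>2 * (norm (gradient ?\<psi> x))\<^sup>2 \<partial>lborel) + \<eta>"
    proof (rule energy_inequality[of b m \<eta> "\<lambda>t. 2 * pp t ^ 3" "\<lambda>t. 6 * pp t ^ 2" "\<lambda>t. 2 * pp t" "\<lambda>t. (pp t)\<^sup>2"])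
      show "((\<lambda>t. 2 * pp t ^ 3) has_real_derivative 6 * (pp t)\<^sup>2) (at t)" for t
        using DERIV_cmult[OF D[where k=1], of 2] by (simp add: numeral_3_eq_3 numeral_2_eq_2)
      show "(2 * pp t)\<^sup>2 \<le> 6 * (pp t)\<^sup>2" for t by (simp add: power_mult_distrib)
      show "\<bar>2 * pp t ^ 3\<bar> \<le> 2 * pp t * (pp t)\<^sup>2" for t
        using pp0[of t] by (simp add: power3_eq_cube power2_eq_square abs_mult)
    qed (use b0 ab m \<eta> in \<open>auto intro!: continuous_intros ppc simp: pp_def\<close>)
    \<comment> \<open>A quarter of the gap separates \<open>m\<close> from \<open>l\<close> and \<open>l'\<close> by more than the error of the approximation.\<close>
    define e where "e = min e0 ((l' - l) / 4)"
    have e: "e > 0" "e \<le> e0" "e \<le> (l' - l) / 4" using e0(1) l by (simp_all add: e_def del: le_divide_eq_numeral1)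
    obtain f where f: "approximates b (m / 2) e f"
      using approximation_exists[of b "m / 2" e] ab m e by auto
    have C: "C1 f" and f1: "\<And>x. f x \<le> 1" and near: "\<And>x. x \<in> cball Q b \<Longrightarrow> \<bar>f x - u x\<bar> \<le> e"
      using f by (auto simp: approximates_def)
    have [measurable]: "f \<in> borel_measurable borel" "gradient f \<in> borel_measurable borel" using C1_borel[OF C] by simp_all
    have [measurable]: "gradient ?\<psi> \<in> borel_measurable borel" "?\<psi> \<in> borel_measurable borel" using C1_borel[OF cutoff_C1[of Q b]] by simp_all
    have [measurable]: "pp \<in> borel_measurable borel" by (rule borel_measurable_continuous_onI[OF ppc])
    have ZC: "C1 (\<lambda>x. (pp (f x))\<^sup>2)" "gradient (\<lambda>x. (pp (f x))\<^sup>2) = (\<lambda>x. (2 * pp (f x)) *\<^sub>R gradient f x)"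
      by (rule C1_compose[OF C, where T=UNIV and H="\<lambda>t. (pp t)\<^sup>2" and H'="\<lambda>t. 2 * pp t"];
          use D[where k=0] in \<open>auto intro!: continuous_intros ppc simp: numeral_2_eq_2\<close>)+
    define G where "G = (\<lambda>x. ?\<psi> x * (pp (f x))\<^sup>2)"
    have GC: "C1 G" unfolding G_def by (rule C1_mult(1)[OF cutoff_C1 ZC(1)])
    have Gg: "gradient G x = ?\<psi> x *\<^sub>R ((2 * pp (f x)) *\<^sub>R gradient f x) + (pp (f x))\<^sup>2 *\<^sub>R gradient ?\<psi> x" for x
      unfolding G_def by (subst C1_mult(2)[OF cutoff_C1 ZC(1)]) (simp only: ZC(2))
    have [measurable]: "G \<in> borel_measurable borel" "gradient G \<in> borel_measurable borel" using C1_borel[OF GC] by simp_all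
    have supp: "bounded {x. G x \<noteq> 0}" by (rule bounded_subset[OF cutoff_bounded_support[OF b0, of Q]]) (auto simp: G_def)
    let ?A = "\<lambda>x. (2 * pp (f x))\<^sup>2 * (?\<psi> x)\<^sup>2 * (norm (gradient f x))\<^sup>2"
    let ?S = "\<lambda>x. ((pp (f x))\<^sup>2)\<^sup>2 * (norm (gradient ?\<psi> x))\<^sup>2"
    let ?Y = "\<lambda>l x. (max 0 (u x - l)) ^ 4"
    have cpf: "continuous_on UNIV (\<lambda>x. pp (f x))"
      by (rule continuous_on_compose2[OF ppc[of UNIV] C1_continuous[OF C]]) auto
    have iA: "integrable lborel ?A"
    proof (rule integrable_continuous_off_ball[where Q=Q and b=b])
      show "continuous_on UNIV ?A"
        by (intro continuous_intros cpf C1_continuous[OF cutoff_C1] C1_continuous_gradient[OF C])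
    qed (use b0 in \<open>simp add: cutoff_off_ball\<close>)
    have iS: "integrable lborel ?S"
    proof (rule integrable_continuous_off_ball[where Q=Q and b=b])
      show "continuous_on UNIV ?S"
        by (intro continuous_intros cpf C1_continuous_gradient[OF cutoff_C1])
    qed (use b0 in \<open>simp add: cutoff_off_ball\<close>)
    have iG: "integrable lborel (\<lambda>x. (norm (gradient G x))\<^sup>2)"
    proof (rule integrable_continuous_off_ball[where Q=Q and b=b])
      show "continuous_on UNIV (\<lambda>x. (norm (gradient G x))\<^sup>2)"
        by (intro continuous_intros C1_continuous_gradient[OF GC])
    qed (use b0 in \<open>simp add: Gg cutoff_off_ball\<close>)
    have iG2: "integrable lborel (\<lambda>x. (G x)\<^sup>2)"
    proof (rule integrable_continuous_off_ball[where Q=Q and b=b])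
      show "continuous_on UNIV (\<lambda>x. (G x)\<^sup>2)"
        by (intro continuous_intros C1_continuous[OF GC])
    qed (use b0 in \<open>simp add: G_def cutoff_off_ball\<close>)
    have en: "(\<integral> x. ?A x \<partial>lborel) \<le> 4 * lam ^ 4 * (\<integral> x. ?S x \<partial>lborel) + \<eta>" by (rule e0(2)[OF e(2) f])
    have IS: "(\<integral> x. ?S x \<partial>lborel) \<le> 16 * b ^ 6 * excess l b"
    proof -
      have "(\<integral> x. ?S x \<partial>lborel) \<le> (\<integral> x. 16 * b ^ 6 * (?Y l x * indicat_real (ball Q b) x) \<partial>lborel)"
      proof (rule integral_mono)
        show "integrable lborel (\<lambda>x. 16 * b ^ 6 * (?Y l x * indicat_real (ball Q b) x))"
          using excess_integrable[OF l(1), of b] by (intro integrable_mult_right)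
        fix x
        show "?S x \<le> 16 * b ^ 6 * (?Y l x * indicat_real (ball Q b) x)"
        proof (cases "x \<in> ball Q b")
          case True
          have "f x - u x \<le> e" using near[of x] True by auto
          then have "f x - m \<le> u x - l" using e(3) l(2) unfolding m_def by argo
          then have "pp (f x) \<le> max 0 (u x - l)" by (auto simp: pp_def)
          then have "(pp (f x)) ^ 4 \<le> ?Y l x" using pp0 by (intro power_mono) auto
          moreover have "(norm (gradient ?\<psi> x))\<^sup>2 \<le> (4 * b ^ 3)\<^sup>2"
            using cutoff_bounds(2)[OF b0, of Q x] by (intro power_mono) auto
          ultimately have "(pp (f x)) ^ 4 * (norm (gradient ?\<psi> x))\<^sup>2 \<le> ?Y l x * (4 * b ^ 3)\<^sup>2"
            by (intro mult_mono) auto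
          then show ?thesis using True by (simp add: power_mult_distrib mult_ac flip: power_mult)
        next
          case False
          then show ?thesis using b0 by (simp add: cutoff_off_ball)
        qed
      qed (rule iS)
      then show ?thesis by (simp add: excess_def)
    qed
    have grad: "(\<integral> x. (norm (gradient G x))\<^sup>2 \<partial>lborel) \<le> (8 * lam ^ 4 + 2) * (16 * b ^ 6 * excess l b) + 2 * \<eta>"
    proof -
      have "(\<integral> x. (norm (gradient G x))\<^sup>2 \<partial>lborel) \<le> (\<integral> x. 2 * ?A x + 2 * ?S x \<partial>lborel)"
      proof (rule integral_mono)
        fix x
        have "(norm (gradient G x))\<^sup>2 \<le> 2 * (norm (?\<psi> x *\<^sub>R ((2 * pp (f x)) *\<^sub>R gradient f x)))\<^sup>2 + 2 * (norm ((pp (f x))\<^sup>2 *\<^sub>R gradient ?\<psi> x))\<^sup>2"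
          unfolding Gg by (rule norm_add_square_le)
        then show "(norm (gradient G x))\<^sup>2 \<le> 2 * ?A x + 2 * ?S x" by (simp add: power_mult_distrib mult_ac)
        show "integrable lborel (\<lambda>x. 2 * ?A x + 2 * ?S x)"
          by (intro Bochner_Integration.integrable_add integrable_mult_right iA iS)
      qed (rule iG)
      also have "\<dots> = 2 * (\<integral> x. ?A x \<partial>lborel) + 2 * (\<integral> x. ?S x \<partial>lborel)"
        using Bochner_Integration.integral_add[OF integrable_mult_right[of 2, OF iA] integrable_mult_right[of 2, OF iS]]
        by (simp only: integral_mult_right_zero)
      also have "\<dots> \<le> (8 * lam ^ 4 + 2) * (\<integral> x. ?S x \<partial>lborel) + 2 * \<eta>" using en by (simp add: algebra_simps)
      also have "\<dots> \<le> (8 * lam ^ 4 + 2) * (16 * b ^ 6 * excess l b) + 2 * \<eta>" using IS by (intro add_right_mono mult_left_mono) auto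
      finally show ?thesis .
    qed
    define A where "A = {x \<in> ball Q b. m < f x}"
    have A[measurable]: "A \<in> sets borel"
    proof -
      have "A = ball Q b \<inter> f -` {m<..} \<inter> space borel" by (auto simp: A_def)
      then show ?thesis by simp
    qed
    have Asub: "A \<subseteq> ball Q b" by (auto simp: A_def)
    have emA: "emeasure lborel A = ennreal (measure lborel A)"
      using emeasure_mono[OF Asub, of lborel] emeasure_bounded_finite[of "ball Q b"]
      by (intro emeasure_eq_ennreal_measure) (auto simp: top_unique)
    have iAi: "integrable lborel (indicat_real A)"
      using emA by (simp add: integrable_indicator_iff)
    have mA: "((l' - l) / 4) ^ 4 * measure lborel A \<le> excess l b"
    proof -
      have "((l' - l) / 4) ^ 4 * measure lborel A = (\<integral> x. ((l' - l) / 4) ^ 4 * indicat_real A x \<partial>lborel)"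
        using iAi by simp
      also have "\<dots> \<le> excess l b" unfolding excess_def
      proof (rule integral_mono)
        fix x
        show "((l' - l) / 4) ^ 4 * indicat_real A x \<le> ?Y l x * indicat_real (ball Q b) x"
        proof (cases "x \<in> A")
          case True
          then have "m < f x" "f x - u x \<le> e" using near[of x] by (auto simp: A_def)
          then have "(l' - l) / 4 \<le> u x - l" using e(3) unfolding m_def by argo
          then have "(l' - l) / 4 \<le> max 0 (u x - l)" by (rule max.coboundedI2)
          from power_mono[OF this] l(2) have "((l' - l) / 4) ^ 4 \<le> ?Y l x" by simp
          then show ?thesis using True Asub by (auto simp: indicator_def)
        qed simp
      qed (use iAi excess_integrable[OF l(1), of b] in auto)
      finally show ?thesis .
    qed
    have fk: "(\<integral>\<^sup>+ x. ennreal ((G x)\<^sup>2) \<partial>lborel) \<le> ennreal (2 * \<delta>\<^sup>2) * (\<integral>\<^sup>+ x. ennreal ((norm (gradient G x))\<^sup>2) \<partial>lborel)"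
    proof (rule faber_krahn[OF GC A _ \<delta>])
      show "G x = 0" if "x \<notin> A" for x
        using that b0 by (cases "x \<in> ball Q b") (auto simp: A_def G_def pp_def cutoff_off_ball)
      have "((l' - l) / 4) ^ 4 * (2 * measure lborel A) \<le> ((l' - l) / 4) ^ 4 * (unit_ball_vol CARD('n) * \<delta> ^ CARD('n))"
        using mA small by linarith
      then have "2 * measure lborel A \<le> unit_ball_vol CARD('n) * \<delta> ^ CARD('n)"
        using l by (subst (asm) mult_le_cancel_left_pos) auto
      then have "ennreal (2 * measure lborel A) \<le> ennreal (unit_ball_vol CARD('n) * \<delta> ^ CARD('n))" by (rule ennreal_leI)
      then show "2 * emeasure lborel A \<le> emeasure lborel (ball (0::real^'n) \<delta>)"
        using \<delta> by (simp add: emeasure_ball emA ennreal_mult')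
    qed
    have fk': "(\<integral> x. (G x)\<^sup>2 \<partial>lborel) \<le> 2 * \<delta>\<^sup>2 * (\<integral> x. (norm (gradient G x))\<^sup>2 \<partial>lborel)"
    proof -
      have "ennreal (\<integral> x. (G x)\<^sup>2 \<partial>lborel) \<le> ennreal (2 * \<delta>\<^sup>2) * ennreal (\<integral> x. (norm (gradient G x))\<^sup>2 \<partial>lborel)"
        using fk by (simp only: nn_integral_eq_integral[OF iG2] nn_integral_eq_integral[OF iG] AE_I2 zero_le_power2)
      also have "\<dots> = ennreal (2 * \<delta>\<^sup>2 * (\<integral> x. (norm (gradient G x))\<^sup>2 \<partial>lborel))"
        by (rule ennreal_mult[symmetric]) auto
      finally show ?thesis by (subst (asm) ennreal_le_iff) auto
    qed
    have "(b\<^sup>2 - a\<^sup>2) ^ 4 * excess l' a \<le> (\<integral> x. (G x)\<^sup>2 \<partial>lborel)"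
    proof -
      have "(b\<^sup>2 - a\<^sup>2) ^ 4 * excess l' a = (\<integral> x. (b\<^sup>2 - a\<^sup>2) ^ 4 * (?Y l' x * indicat_real (ball Q a) x) \<partial>lborel)"
        by (simp add: excess_def)
      also have "\<dots> \<le> (\<integral> x. (G x)\<^sup>2 \<partial>lborel)"
      proof (rule integral_mono)
        fix x
        show "(b\<^sup>2 - a\<^sup>2) ^ 4 * (?Y l' x * indicat_real (ball Q a) x) \<le> (G x)\<^sup>2"
        proof (cases "x \<in> ball Q a")
          case True
          then have "x \<in> cball Q b" using ab by auto
          then have "u x - f x \<le> e" using near[of x] by auto
          then have "u x - l' \<le> f x - m" using e(3) l(2) unfolding m_def by argo
          then have "max 0 (u x - l') \<le> pp (f x)" by (auto simp: pp_def)
          then have 1: "?Y l' x \<le> pp (f x) ^ 4" by (intro power_mono) auto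
          have "(b\<^sup>2 - a\<^sup>2)\<^sup>2 \<le> ?\<psi> x"
            by (rule cutoff_lower) (use True ab in \<open>auto simp: dist_norm norm_minus_commute\<close>)
          then have "((b\<^sup>2 - a\<^sup>2)\<^sup>2)\<^sup>2 \<le> (?\<psi> x)\<^sup>2" by (intro power_mono) auto
          then have "(b\<^sup>2 - a\<^sup>2) ^ 4 * ?Y l' x \<le> (?\<psi> x)\<^sup>2 * pp (f x) ^ 4"
            using 1 by (intro mult_mono) (auto simp flip: power_mult)
          then show ?thesis using True by (simp add: G_def power_mult_distrib flip: power_mult)
        qed simp
      qed (use excess_integrable[of l' a] l iG2 in auto)
      finally show ?thesis .
    qed
    also have "\<dots> \<le> 2 * \<delta>\<^sup>2 * (\<integral> x. (norm (gradient G x))\<^sup>2 \<partial>lborel)" by (rule fk')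
    also have "\<dots> \<le> 2 * \<delta>\<^sup>2 * ((8 * lam ^ 4 + 2) * (16 * b ^ 6 * excess l b) + 2 * \<eta>)"
      by (intro mult_left_mono grad) simp
    also have "\<dots> = 32 * (8 * lam ^ 4 + 2) * (\<delta>\<^sup>2 * b ^ 6 * excess l b) + 4 * \<delta>\<^sup>2 * \<eta>"
      by (simp add: algebra_simps)
    finally show ?thesis .
  qed
  show ?thesis
  proof (rule field_le_epsilon)
    fix e :: real assume "e > 0"
    then have "e / (4 * \<delta>\<^sup>2) > 0" using \<delta> by simp
    from step[OF this] show "(b\<^sup>2 - a\<^sup>2) ^ 4 * excess l' a \<le> 32 * (8 * lam ^ 4 + 2) * (\<delta>\<^sup>2 * b ^ 6 * excess l b) + e"
      using \<delta> by simp
  qed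
qed

end

text \<open>
  The constants of the iteration. Along radii \<open>s * (1 + 2 ^ - i)\<close> and levels with gaps of order
  \<open>\<tau> * 2 ^ - i\<close>, the radius in \<open>faber_krahn\<close> is taken as \<open>s * de_giorgi_scale * 8 ^ - i\<close>. The excess then
  decreases by the factor \<open>de_giorgi_ratio\<close> per step, which is chosen to preserve the smallness
  hypothesis of \<open>de_giorgi_step\<close>, provided that it starts below \<open>de_giorgi_threshold\<close>.
\<close>

definition de_giorgi_ratio :: "nat \<Rightarrow> real" where "de_giorgi_ratio n = 1 / (16 * 8 ^ n)"
definition de_giorgi_scale :: "nat \<Rightarrow> real \<Rightarrow> real" where
  "de_giorgi_scale n lam = sqrt (de_giorgi_ratio n / (2048 * (8 * lam ^ 4 + 2)))"
definition de_giorgi_threshold :: "nat \<Rightarrow> real \<Rightarrow> real" where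
  "de_giorgi_threshold n lam = unit_ball_vol n * de_giorgi_scale n lam ^ n / 131072"

lemma de_giorgi_scale_pos: "de_giorgi_scale n lam > 0"
  unfolding de_giorgi_scale_def de_giorgi_ratio_def by (intro real_sqrt_gt_zero divide_pos_pos mult_pos_pos add_nonneg_pos) auto

lemma de_giorgi_threshold_pos: "de_giorgi_threshold n lam > 0"
  unfolding de_giorgi_threshold_def using de_giorgi_scale_pos[of n lam] by simp

context dirichlet_solution
begin

text \<open>
  The excess tends to 0 along the iteration, so \<open>u \<le> 1 - \<tau> / 2\<close> almost everywhere on the smallest ball,
  and by continuity everywhere.
\<close>

lemma de_giorgi_iteration:
  assumes s: "s > 0" "2 * s < r" and \<tau>: "0 < \<tau>" "\<tau> < 1"
    and start: "excess (1 - \<tau>) (2 * s) \<le> de_giorgi_threshold CARD('n) lam * \<tau> ^ 4 * s ^ CARD('n)"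
    and x: "x \<in> ball Q s"
  shows "u x \<le> 1 - \<tau> / 2"
proof -
  let ?n = "CARD('n)"
  define \<omega> where "\<omega> = unit_ball_vol (real ?n)"
  have \<omega>: "\<omega> > 0" by (simp add: \<omega>_def)
  define q where "q = de_giorgi_ratio ?n"
  have q: "q > 0" "q < 1" "q = 1 / (16 * 8 ^ ?n)"
    by (auto simp: q_def de_giorgi_ratio_def divide_less_eq_1) (use one_le_power[of "8::real" ?n] in linarith)
  define \<eta> where "\<eta> = de_giorgi_scale ?n lam"
  have \<eta>: "\<eta> > 0" by (simp add: \<eta>_def de_giorgi_scale_pos)
  define D where "D = 2048 * (8 * lam ^ 4 + 2)"
  have D: "D > 0" unfolding D_def by (intro mult_pos_pos add_nonneg_pos) auto
  have D\<eta>: "D * \<eta>\<^sup>2 = q"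
    unfolding \<eta>_def de_giorgi_scale_def D_def[symmetric] q_def[symmetric] using D q by simp
  define \<nu> where "\<nu> = de_giorgi_threshold ?n lam"
  have \<nu>: "\<nu> > 0" "2 * \<nu> = \<omega> * \<eta> ^ ?n / 65536"
    by (simp_all add: \<nu>_def de_giorgi_threshold_pos) (simp add: de_giorgi_threshold_def \<omega>_def \<eta>_def)
  \<comment> \<open>The radii decrease from \<open>2 * s\<close> to \<open>s\<close> and the levels increase from \<open>1 - \<tau>\<close> to \<open>1 - \<tau> / 2\<close>.\<close>
  define h where "h = (\<lambda>i::nat. (1/2::real) ^ i)"
  have h: "h i > 0" "h i \<le> 1" "h (Suc i) = h i / 2" for i by (auto simp: h_def power_le_one)
  have \<tau>h: "\<tau> * h i \<le> \<tau>" "\<tau> * h i > 0" for i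
    using \<tau> h[of i] by (simp_all add: mult_left_le)
  define b where "b = (\<lambda>i. s * (1 + h i))"
  define l where "l = (\<lambda>i. 1 - \<tau> / 2 - \<tau> / 2 * h i)"
  have Y: "excess (l i) (b i) \<le> \<nu> * \<tau> ^ 4 * s ^ ?n * q ^ i" for i
  proof (induction i)
    case 0
    have "l 0 = 1 - \<tau>" "b 0 = 2 * s" by (simp_all add: l_def b_def h_def)
    then show ?case using start by (simp add: \<nu>_def)
  next
    case (Suc i)
    let ?Y = "excess (l i) (b i)" and ?Y' = "excess (l (Suc i)) (b (Suc i))"
    have bb: "0 < b (Suc i)" "b (Suc i) < b i" "b i \<le> 2 * s" "s \<le> b (Suc i)" "b i < r"
      using h[of i] s by (auto simp: b_def mult_left_le intro: order.strict_trans1[OF _ s(2)])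
    have ll: "0 \<le> l i" "l i < l (Suc i)" "l (Suc i) - l i = \<tau> / 4 * h i"
      using h[of i] \<tau> \<tau>h[of i] by (auto simp: l_def)
    define \<delta> where "\<delta> = s * \<eta> * (1/8) ^ i"
    have \<delta>: "\<delta> > 0" using s \<eta> by (simp add: \<delta>_def)
    have small: "2 * ?Y \<le> ((l (Suc i) - l i) / 4) ^ 4 * (\<omega> * \<delta> ^ ?n)"
    proof -
      have "2 * ?Y \<le> (2 * \<nu>) * \<tau> ^ 4 * s ^ ?n * q ^ i" using Suc by simp
      also have "\<dots> = (\<omega> * \<eta> ^ ?n / 65536) * \<tau> ^ 4 * s ^ ?n * q ^ i" by (simp only: \<nu>(2))
      also have "q ^ i = (h i) ^ 4 * ((1/8) ^ i) ^ ?n"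
      proof -
        have "q = (1/2) ^ 4 * (1/8) ^ ?n" by (simp add: q(3) power_divide power_one_over)
        then show ?thesis by (simp add: h_def power_mult_distrib mult.commute flip: power_mult)
      qed
      also have "(\<omega> * \<eta> ^ ?n / 65536) * \<tau> ^ 4 * s ^ ?n * ((h i) ^ 4 * ((1/8) ^ i) ^ ?n)
          = (\<tau> / 4 * h i / 4) ^ 4 * (\<omega> * \<delta> ^ ?n)"
        by (simp add: \<delta>_def power_mult_distrib power_divide mult_ac)
      finally show ?thesis by (simp only: ll)
    qed
    have step: "((b i)\<^sup>2 - (b (Suc i))\<^sup>2) ^ 4 * ?Y' \<le> 32 * (8 * lam ^ 4 + 2) * (\<delta>\<^sup>2 * b i ^ 6 * ?Y)"
      by (rule de_giorgi_step[OF bb(1,2,5) ll(1,2) \<delta>]) (use small in \<open>simp add: \<omega>_def\<close>)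
    have "(s\<^sup>2 * h i) ^ 4 * ?Y' \<le> ((b i)\<^sup>2 - (b (Suc i))\<^sup>2) ^ 4 * ?Y'"
    proof (intro mult_right_mono power_mono excess_nonneg)
      have "(b i)\<^sup>2 - (b (Suc i))\<^sup>2 = (b i - b (Suc i)) * (b i + b (Suc i))" by (simp add: power2_eq_square algebra_simps)
      also have "b i - b (Suc i) = s * h i / 2" by (simp add: b_def h algebra_simps)
      also have "s * h i / 2 * (b i + b (Suc i)) \<ge> s * h i / 2 * (2 * s)"
        using bb s h[of i] by (intro mult_left_mono) auto
      finally show "s\<^sup>2 * h i \<le> (b i)\<^sup>2 - (b (Suc i))\<^sup>2" by (simp add: power2_eq_square mult_ac)
    qed (use s h[of i] in auto)
    also note step
    also have "32 * (8 * lam ^ 4 + 2) * (\<delta>\<^sup>2 * b i ^ 6 * ?Y) \<le> 32 * (8 * lam ^ 4 + 2) * (\<delta>\<^sup>2 * (2 * s) ^ 6 * ?Y)"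
      using bb by (intro mult_left_mono mult_right_mono power_mono excess_nonneg) auto
    also have "\<dots> = D * (\<delta>\<^sup>2 * s ^ 6 * ?Y)" by (simp add: D_def power_mult_distrib)
    also have "\<delta>\<^sup>2 = s\<^sup>2 * \<eta>\<^sup>2 * ((1/64) ^ i)"
    proof -
      have "((1/8::real) ^ i)\<^sup>2 = (1/64) ^ i" by (simp add: power2_eq_square flip: power_mult_distrib)
      then show ?thesis by (simp add: \<delta>_def power_mult_distrib)
    qed
    also have "D * (s\<^sup>2 * \<eta>\<^sup>2 * ((1/64) ^ i) * s ^ 6 * ?Y) = (D * \<eta>\<^sup>2) * (s\<^sup>2 * s ^ 6) * ((1/64) ^ i) * ?Y"
      by (simp only: mult_ac)
    also have "\<dots> = q * s ^ 8 * ((1/64) ^ i) * ?Y" by (simp only: D\<eta> flip: power_add) simp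
    also have "\<dots> \<le> q * s ^ 8 * ((1/16) ^ i) * ?Y"
      using q s by (intro mult_right_mono mult_left_mono power_mono excess_nonneg) auto
    finally have "s ^ 8 * (1/16) ^ i * ?Y' \<le> s ^ 8 * (1/16) ^ i * (q * ?Y)"
    proof -
      assume *: "(s\<^sup>2 * h i) ^ 4 * ?Y' \<le> q * s ^ 8 * (1/16) ^ i * ?Y"
      have "(h i) ^ 4 = ((1/2) ^ 4) ^ i" unfolding h_def by (simp only: power_mult[symmetric] mult.commute)
      then have "(h i) ^ 4 = (1/16) ^ i" by (simp add: power_divide)
      then have "(s\<^sup>2 * h i) ^ 4 = s ^ 8 * (1/16) ^ i" by (simp add: power_mult_distrib flip: power_mult)
      with * show ?thesis by (simp only: mult_ac)
    qed
    then have "?Y' \<le> q * ?Y" using s by (subst (asm) mult_le_cancel_left_pos) auto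
    also have "\<dots> \<le> q * (\<nu> * \<tau> ^ 4 * s ^ ?n * q ^ i)" using q Suc by (intro mult_left_mono) auto
    finally show ?case by (simp add: mult_ac)
  qed
  define c where "c = 1 - \<tau> / 2"
  have c0: "c \<ge> 0" using \<tau> by (simp add: c_def)
  have le: "excess c s \<le> \<nu> * \<tau> ^ 4 * s ^ ?n * q ^ i" for i
  proof -
    have "excess c s \<le> excess (l i) (b i)" unfolding excess_def
    proof (rule integral_mono)
      have li: "0 \<le> l i" "l i \<le> c" using h[of i] \<tau> \<tau>h[of i] by (auto simp: l_def c_def)
      show "integrable lborel (\<lambda>x. (max 0 (u x - c)) ^ 4 * indicat_real (ball Q s) x)" by (rule excess_integrable[OF c0])
      show "integrable lborel (\<lambda>x. (max 0 (u x - l i)) ^ 4 * indicat_real (ball Q (b i)) x)" by (rule excess_integrable[OF li(1)])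
      fix y
      have "ball Q s \<subseteq> ball Q (b i)" using h[of i] s by (intro subset_ball) (simp add: b_def)
      then have "indicat_real (ball Q s) y \<le> indicat_real (ball Q (b i)) y" by (auto simp: indicator_def)
      moreover have "(max 0 (u y - c)) ^ 4 \<le> (max 0 (u y - l i)) ^ 4" using li by (intro power_mono) auto
      ultimately show "(max 0 (u y - c)) ^ 4 * indicat_real (ball Q s) y \<le> (max 0 (u y - l i)) ^ 4 * indicat_real (ball Q (b i)) y"
        by (intro mult_mono) auto
    qed
    also note Y
    finally show ?thesis .
  qed
  have "(\<lambda>i. \<nu> * \<tau> ^ 4 * s ^ ?n * q ^ i) \<longlonglongrightarrow> \<nu> * \<tau> ^ 4 * s ^ ?n * 0"
    using q by (intro tendsto_intros LIMSEQ_realpow_zero) auto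
  then have "excess c s \<le> 0" using le by (intro LIMSEQ_le_const) auto
  then have z: "excess c s = 0" using excess_nonneg[of c s] by simp
  have ae: "AE y in lborel. (max 0 (u y - c)) ^ 4 * indicat_real (ball Q s) y = 0"
    using z integral_nonneg_eq_0_iff_AE[OF excess_integrable[OF c0, of s]] by (simp add: excess_def)
  show ?thesis
  proof (rule ccontr)
    assume "\<not> ?thesis"
    then have gt: "u x > c" by (simp add: c_def)
    have cu: "continuous_on (ball Q s) u" by (rule continuous_on_subset[OF u_cont]) (use s in auto)
    have "open (ball Q s \<inter> u -` {c<..})" by (rule continuous_open_preimage[OF cu]) auto
    moreover have "x \<in> ball Q s \<inter> u -` {c<..}" using x gt by simp
    ultimately obtain d where d: "d > 0" "ball x d \<subseteq> ball Q s \<inter> u -` {c<..}"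
      by (rule openE)
    have "AE y in lborel. y \<notin> ball x d"
      using ae
    proof eventually_elim
      case (elim y)
      show ?case
      proof
        assume "y \<in> ball x d"
        then have "y \<in> ball Q s" "u y > c" using d(2) by auto
        with elim show False by (simp add: max_def)
      qed
    qed
    from AE_avoid_ball[OF this] d(1) show False by simp
  qed
qed

end

section \<open>Decay at one scale\<close>

text \<open>
  The constant of \<open>capacity_poincare\<close> times the bound of the energy of \<open>H u\<close> that the cutoff of radius
  \<open>3 * s\<close> gives on the ball of radius \<open>2 * s\<close>.
\<close>

definition log_const :: "nat \<Rightarrow> real \<Rightarrow> real \<Rightarrow> real" where
  "log_const n C0 lam = cap_poincare_const n C0 * ((46656 * lam ^ 4 * unit_ball_vol n * 3 ^ n + 1) / 625)"

context dirichlet_solution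
begin

text \<open>
  The cube in \<open>H t = - ln (1 - (t - \<tau>)\<^sub>+ ^ 3)\<close> makes \<open>H\<close> twice continuously differentiable at \<open>\<tau>\<close>, and the
  shift by \<open>\<tau>\<close> makes \<open>H u\<close> vanish near the complement of \<open>\<Omega>\<close> and stay finite where \<open>u = 1\<close>. The
  bound on the mean square of \<open>H u\<close> is independent of \<open>\<tau>\<close>, while \<open>H u\<close> is at least \<open>- ln (9 * \<tau>)\<close> where
  the excess is not 0.
\<close>

lemma log_level_estimate:
  assumes s: "s > 0" "3 * s < r" and \<tau>: "0 < \<tau>" "\<tau> < 1 / 9" and C0: "C0 > 0" and n: "CARD('n) \<ge> 2"
    and cap: "ennreal (C0 * s ^ (CARD('n) - 2)) \<le> cap2 (ball Q s \<inter> - \<Omega>)"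
  shows "(ln (9 * \<tau>))\<^sup>2 * excess (1 - \<tau>) (2 * s) \<le> \<tau> ^ 4 * (log_const CARD('n) C0 lam * s ^ CARD('n))"
proof -
  let ?n = "CARD('n)" and ?\<psi> = "cutoff Q (3 * s)"
  define \<omega> where "\<omega> = unit_ball_vol (real ?n)"
  have \<omega>: "\<omega> > 0" by (simp add: \<omega>_def)
  define pp where "pp = (\<lambda>t. max 0 (t - \<tau>))"
  have ppc [continuous_intros]: "continuous_on S pp" for S unfolding pp_def by (intro continuous_intros)
  have pp0: "pp t \<ge> 0" for t by (simp add: pp_def)
  have D: "((\<lambda>t. pp t ^ Suc (Suc k)) has_real_derivative real (Suc (Suc k)) * pp t ^ Suc k) (at t)" for k t
    unfolding pp_def by (rule pospart_power_DERIV_shift)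
  have D3: "((\<lambda>t. pp t ^ 3) has_real_derivative 3 * (pp t)\<^sup>2) (at t)" for t
    using D[of 1 t] by (simp add: numeral_3_eq_3 numeral_2_eq_2)
  have D2: "((\<lambda>t. (pp t)\<^sup>2) has_real_derivative 2 * pp t) (at t)" for t
    using D[of 0 t] by (simp add: numeral_2_eq_2)
  have pos: "1 - pp t ^ 3 > 0" if "t \<le> 1" for t
  proof -
    have "pp t \<le> 1 - \<tau>" using that \<tau> by (auto simp: pp_def)
    then have "pp t ^ 3 \<le> (1 - \<tau>) ^ 3" using pp0 by (intro power_mono) auto
    also have "(1 - \<tau>) ^ 3 < 1 ^ 3" using \<tau> by (intro power_strict_mono) auto
    finally show ?thesis by simp
  qed
  define H where "H = (\<lambda>t. - ln (1 - pp t ^ 3))"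
  define H' where "H' = (\<lambda>t. 3 * (pp t)\<^sup>2 / (1 - pp t ^ 3))"
  define H'' where "H'' = (\<lambda>t. (6 * pp t * (1 - pp t ^ 3) + 9 * (pp t)\<^sup>2 * (pp t)\<^sup>2) / (1 - pp t ^ 3)\<^sup>2)"
  have D1: "((\<lambda>t. 1 - pp t ^ 3) has_real_derivative 0 - 3 * (pp t)\<^sup>2) (at t)" for t
    by (intro DERIV_diff DERIV_const D3)
  have DH: "(H has_real_derivative H' t) (at t)" if "t \<le> 1" for t
    using DERIV_minus[OF DERIV_chain'[OF D1 DERIV_ln[OF pos[OF that]]]]
    by (simp add: H_def H'_def field_simps)
  have DH': "(H' has_real_derivative H'' t) (at t)" if "t \<le> 1" for t
  proof -
    have "(H' has_real_derivative (3 * (2 * pp t) * (1 - pp t ^ 3) - 3 * (pp t)\<^sup>2 * (0 - 3 * (pp t)\<^sup>2))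
        / ((1 - pp t ^ 3) * (1 - pp t ^ 3))) (at t)"
      unfolding H'_def by (rule DERIV_divide[OF DERIV_cmult[OF D2] D1]) (use pos[OF that] in simp)
    then show ?thesis by (simp add: H''_def power2_eq_square algebra_simps)
  qed
  have cH': "continuous_on {..1} H'" unfolding H'_def
    by (intro continuous_intros) (use pos in force)
  have cH'': "continuous_on {..1} H''" unfolding H''_def
    by (intro continuous_intros) (use pos in force)
  have H'0: "H' t \<ge> 0" if "t \<le> 1" for t using pos[OF that] by (simp add: H'_def)
  have HH: "(H' t)\<^sup>2 \<le> H'' t" if "t \<le> 1" for t
  proof -
    have "(H' t)\<^sup>2 = 9 * (pp t)\<^sup>2 * (pp t)\<^sup>2 / (1 - pp t ^ 3)\<^sup>2"
      by (simp add: H'_def power_divide power_mult_distrib power2_eq_square)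
    also have "\<dots> \<le> H'' t" unfolding H''_def using pos[OF that] pp0[of t] by (intro divide_right_mono) auto
    finally show ?thesis .
  qed
  \<comment> \<open>The admitted error \<open>s ^ (n + 6)\<close> has the order of the main term: the squared gradient of the
    cutoff is of order \<open>s ^ 6\<close>, and the ball has measure of order \<open>s ^ n\<close>.\<close>
  obtain e0 where e0: "e0 > 0" "\<And>e f. e \<le> e0 \<Longrightarrow> approximates (3 * s) (\<tau> / 2) e f \<Longrightarrow>
    (\<integral> x. (H' (f x))\<^sup>2 * (?\<psi> x)\<^sup>2 * (norm (gradient f x))\<^sup>2 \<partial>lborel)
      \<le> 4 * lam ^ 4 * (\<integral> x. 1\<^sup>2 * (norm (gradient ?\<psi> x))\<^sup>2 \<partial>lborel) + s ^ (?n + 6)"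
  proof (rule energy_inequality[of "3 * s" \<tau> "s ^ (?n + 6)" H' H'' H' "\<lambda>_. 1"])
    show "H' t = 0" "H'' t = 0" if "t \<le> \<tau>" for t using that by (auto simp: H'_def H''_def pp_def)
    show "\<bar>H' t\<bar> \<le> H' t * 1" if "t \<le> 1" for t using H'0[OF that] by simp
  qed (use s \<tau> DH' cH' cH'' H'0 HH in auto)
  have "uniformly_continuous_on (cball Q (2 * s)) u"
    by (intro compact_uniformly_continuous continuous_on_subset[OF u_cont]) (use s in auto)
  then obtain d where d: "d > 0" "\<And>x y. x \<in> cball Q (2 * s) \<Longrightarrow> y \<in> cball Q (2 * s) \<Longrightarrow> dist x y < d \<Longrightarrow> \<bar>u y - u x\<bar> < \<tau> / 2"
    using \<tau>(1) unfolding uniformly_continuous_on_def by (metis dist_commute dist_real_def half_gt_zero)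
  define e where "e = min e0 (\<tau> / 2)"
  have e: "e > 0" "e \<le> e0" "e \<le> \<tau> / 2" using e0(1) \<tau> by (simp_all add: e_def del: le_divide_eq_numeral1)
  obtain f where f: "approximates (3 * s) (\<tau> / 2) e f"
    using approximation_exists[of "3 * s" "\<tau> / 2" e] s \<tau> e by auto
  have C: "C1 f" and f1: "\<And>x. f x \<le> 1" and near: "\<And>x. x \<in> cball Q (3 * s) \<Longrightarrow> \<bar>f x - u x\<bar> \<le> e"
    using f by (auto simp: approximates_def)
  have [measurable]: "f \<in> borel_measurable borel" "gradient f \<in> borel_measurable borel" using C1_borel[OF C] by simp_all
  define w where "w = (\<lambda>x. H (f x))"
  have wC: "C1 w" "gradient w = (\<lambda>x. H' (f x) *\<^sub>R gradient f x)" unfolding w_def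
    by (rule C1_compose[OF C, where T="{..1}" and H=H and H'=H']; use f1 DH cH' in auto)+
  have [measurable]: "w \<in> borel_measurable borel" "gradient w \<in> borel_measurable borel" using C1_borel[OF wC(1)] by simp_all
  let ?A = "\<lambda>x. (H' (f x))\<^sup>2 * (?\<psi> x)\<^sup>2 * (norm (gradient f x))\<^sup>2"
  have s3: "3 * s > 0" using s by simp
  have cH'f: "continuous_on UNIV (\<lambda>x. H' (f x))"
    by (rule continuous_on_compose2[OF cH' C1_continuous[OF C]]) (use f1 in auto)
  have iA: "integrable lborel ?A"
  proof (rule integrable_continuous_off_ball[where Q=Q and b="3 * s"])
    show "continuous_on UNIV ?A"
      by (intro continuous_intros cH'f C1_continuous[OF cutoff_C1] C1_continuous_gradient[OF C])
  qed (use s3 in \<open>simp add: cutoff_off_ball\<close>)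
  have iS: "integrable lborel (\<lambda>x. (norm (gradient ?\<psi> x))\<^sup>2)"
  proof (rule integrable_continuous_off_ball[where Q=Q and b="3 * s"])
    show "continuous_on UNIV (\<lambda>x. (norm (gradient ?\<psi> x))\<^sup>2)"
      by (intro continuous_intros C1_continuous_gradient[OF cutoff_C1])
  qed (use s3 in \<open>simp add: cutoff_off_ball\<close>)
  have mb: "measure lborel (ball Q (3 * s)) = \<omega> * 3 ^ ?n * s ^ ?n"
    using s by (simp add: measure_def emeasure_ball \<omega>_def power_mult_distrib)
  have IS: "(\<integral> x. (norm (gradient ?\<psi> x))\<^sup>2 \<partial>lborel) \<le> 11664 * (\<omega> * 3 ^ ?n) * (s ^ 6 * s ^ ?n)"
  proof -
    have ib: "integrable lborel (indicat_real (ball Q (3 * s)))"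
      using emeasure_bounded_finite[of "ball Q (3 * s)"] by (simp add: integrable_indicator_iff)
    have "(\<integral> x. (norm (gradient ?\<psi> x))\<^sup>2 \<partial>lborel) \<le> (\<integral> x. 11664 * s ^ 6 * indicat_real (ball Q (3 * s)) x \<partial>lborel)"
    proof (rule integral_mono)
      fix x
      show "(norm (gradient ?\<psi> x))\<^sup>2 \<le> 11664 * s ^ 6 * indicat_real (ball Q (3 * s)) x"
      proof (cases "x \<in> ball Q (3 * s)")
        case True
        have "(norm (gradient ?\<psi> x))\<^sup>2 \<le> (4 * (3 * s) ^ 3)\<^sup>2"
          using cutoff_bounds(2)[OF s3, of Q x] by (intro power_mono) auto
        also have "\<dots> = 11664 * s ^ 6" by (simp add: power_mult_distrib flip: power_mult)
        finally show ?thesis using True by simp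
      qed (use s3 in \<open>simp add: cutoff_off_ball\<close>)
    qed (use ib iS in auto)
    also have "\<dots> = 11664 * (\<omega> * 3 ^ ?n) * (s ^ 6 * s ^ ?n)"
      using ib by (simp add: mb)
    finally show ?thesis .
  qed
  have iw: "integrable lborel (\<lambda>x. (norm (gradient w x))\<^sup>2 * indicat_real (ball Q (2 * s)) x)"
  proof -
    have "bounded (gradient w ` cball Q (2 * s))"
      by (intro compact_imp_bounded compact_continuous_image C1_continuous_gradient[OF wC(1)] compact_cball)
    then obtain B where B: "\<And>x. x \<in> cball Q (2 * s) \<Longrightarrow> norm (gradient w x) \<le> B"
      unfolding bounded_iff by blast
    show ?thesis
    proof (rule bounded_ball_integrable)
      fix x assume "x \<in> ball Q (2 * s)"
      then have "norm (gradient w x) \<le> B" by (intro B) auto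
      then show "\<bar>(norm (gradient w x))\<^sup>2\<bar> \<le> B\<^sup>2" by (simp add: power_mono)
    qed measurable
  qed
  define W where "W = (\<integral> x. (norm (gradient w x))\<^sup>2 * indicat_real (ball Q (2 * s)) x \<partial>lborel)"
  define M where "M = (46656 * lam ^ 4 * \<omega> * 3 ^ ?n + 1) / 625"
  have M: "M > 0" unfolding M_def using \<omega> by (intro divide_pos_pos add_nonneg_pos) auto
  have W: "s\<^sup>2 * W \<le> M * s ^ ?n" "W \<ge> 0"
  proof -
    show "W \<ge> 0" unfolding W_def by (intro Bochner_Integration.integral_nonneg) simp
    have "(25 * s ^ 4)\<^sup>2 * W = (\<integral> x. (25 * s ^ 4)\<^sup>2 * ((norm (gradient w x))\<^sup>2 * indicat_real (ball Q (2 * s)) x) \<partial>lborel)"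
      by (simp add: W_def)
    also have "\<dots> \<le> (\<integral> x. ?A x \<partial>lborel)"
    proof (rule integral_mono)
      fix x
      show "(25 * s ^ 4)\<^sup>2 * ((norm (gradient w x))\<^sup>2 * indicat_real (ball Q (2 * s)) x) \<le> ?A x"
      proof (cases "x \<in> ball Q (2 * s)")
        case True
        have "((3 * s)\<^sup>2 - (2 * s)\<^sup>2)\<^sup>2 \<le> ?\<psi> x"
          by (rule cutoff_lower) (use True s in \<open>auto simp: dist_norm norm_minus_commute\<close>)
        moreover have "((3 * s)\<^sup>2 - (2 * s)\<^sup>2)\<^sup>2 = 25 * s ^ 4" by (simp add: power_mult_distrib power2_eq_square power4_eq_xxxx)
        ultimately have "25 * s ^ 4 \<le> ?\<psi> x" by simp
        then have "(25 * s ^ 4)\<^sup>2 \<le> (?\<psi> x)\<^sup>2" using s by (intro power_mono) auto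
        then have "(25 * s ^ 4)\<^sup>2 * (norm (gradient w x))\<^sup>2 \<le> (?\<psi> x)\<^sup>2 * (norm (gradient w x))\<^sup>2" by (intro mult_right_mono) auto
        then show ?thesis using True by (simp add: wC(2) power_mult_distrib mult_ac)
      qed simp
    qed (use iw iA in \<open>auto intro: integrable_mult_right\<close>)
    also have "\<dots> \<le> 4 * lam ^ 4 * (\<integral> x. (norm (gradient ?\<psi> x))\<^sup>2 \<partial>lborel) + s ^ (?n + 6)"
      using e0(2)[OF e(2) f] by simp
    also have "\<dots> \<le> 4 * lam ^ 4 * (11664 * (\<omega> * 3 ^ ?n) * (s ^ 6 * s ^ ?n)) + s ^ (?n + 6)"
      by (intro add_right_mono mult_left_mono IS) simp
    also have "\<dots> = (625 * M) * s ^ ?n * s ^ 6" by (simp add: M_def power_add algebra_simps)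
    finally have "625 * s ^ 6 * (s\<^sup>2 * W) \<le> 625 * s ^ 6 * (M * s ^ ?n)"
      by (simp add: power_mult_distrib mult_ac flip: power_mult power_add)
    then show "s\<^sup>2 * W \<le> M * s ^ ?n" using s by (subst (asm) mult_le_cancel_left_pos) auto
  qed
  define Cp where "Cp = cap_poincare_const ?n C0"
  have Cp: "Cp > 0" unfolding Cp_def cap_poincare_const_def using C0 by (intro add_pos_nonneg) auto
  have iw2: "integrable lborel (\<lambda>x. (w x)\<^sup>2 * indicat_real (ball Q (2 * s)) x)"
  proof -
    have "bounded (w ` cball Q (2 * s))"
      by (intro compact_imp_bounded compact_continuous_image C1_continuous[OF wC(1)] compact_cball)
    then obtain B where B: "\<And>x. x \<in> cball Q (2 * s) \<Longrightarrow> norm (w x) \<le> B"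
      unfolding bounded_iff by blast
    show ?thesis
    proof (rule bounded_ball_integrable)
      fix x assume "x \<in> ball Q (2 * s)"
      then have "\<bar>w x\<bar> \<le> B" using B[of x] by auto
      then have "\<bar>w x\<bar>\<^sup>2 \<le> B\<^sup>2" by (intro power_mono) auto
      then show "\<bar>(w x)\<^sup>2\<bar> \<le> B\<^sup>2" by simp
    qed measurable
  qed
  have cp: "(\<integral> x. (w x)\<^sup>2 * indicat_real (ball Q (2 * s)) x \<partial>lborel) \<le> Cp * s\<^sup>2 * W"
  proof -
    have "(\<integral>\<^sup>+ x\<in>ball Q (2 * s). ennreal ((w x)\<^sup>2) \<partial>lborel)
      \<le> ennreal (cap_poincare_const ?n C0 * s\<^sup>2) * (\<integral>\<^sup>+ x\<in>ball Q (2 * s). ennreal ((norm (gradient w x))\<^sup>2) \<partial>lborel)"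
    proof (rule capacity_poincare[OF wC(1) s(1) _ _ _ C0 cap n])
      show "0 < min d s" using d s by simp
      show "ball Q s \<inter> - \<Omega> \<subseteq> ball Q s" by blast
      fix x y assume y: "y \<in> ball Q s \<inter> - \<Omega>" and xy: "dist x y < min d s"
      have "u y = 0" using y by (intro u_zero) auto
      have yb: "y \<in> cball Q (2 * s)" using y s by auto
      have xb: "x \<in> cball Q (2 * s)" using y xy dist_triangle[of Q x y] by (auto simp: dist_commute)
      then have "x \<in> cball Q (3 * s)" using s by auto
      from near[OF this] d(2)[OF yb xb] xy \<open>u y = 0\<close> e(3) have "f x \<le> \<tau>" by (auto simp: dist_commute)
      then show "w x = 0" by (simp add: w_def H_def pp_def)
    qed
    moreover have "(\<integral>\<^sup>+ x\<in>ball Q (2 * s). ennreal ((w x)\<^sup>2) \<partial>lborel) = ennreal (\<integral> x. (w x)\<^sup>2 * indicat_real (ball Q (2 * s)) x \<partial>lborel)"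
      by (subst nn_integral_eq_integral[OF iw2, symmetric]) (auto intro!: nn_integral_cong simp: indicator_def)
    moreover have "(\<integral>\<^sup>+ x\<in>ball Q (2 * s). ennreal ((norm (gradient w x))\<^sup>2) \<partial>lborel) = ennreal W"
      unfolding W_def by (subst nn_integral_eq_integral[OF iw, symmetric]) (auto intro!: nn_integral_cong simp: indicator_def)
    ultimately have "ennreal (\<integral> x. (w x)\<^sup>2 * indicat_real (ball Q (2 * s)) x \<partial>lborel) \<le> ennreal (Cp * s\<^sup>2) * ennreal W"
      by (simp only: Cp_def)
    also have "\<dots> = ennreal (Cp * s\<^sup>2 * W)" using Cp W(2) by (intro ennreal_mult[symmetric]) auto
    finally show ?thesis using Cp W(2) by (subst (asm) ennreal_le_iff) auto
  qed
  have low: "(ln (9 * \<tau>))\<^sup>2 \<le> (w x)\<^sup>2" if x: "x \<in> ball Q (2 * s)" "u x > 1 - \<tau>" for x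
  proof -
    have "x \<in> cball Q (3 * s)" using x s by auto
    from near[OF this] x(2) e(3) have "f x > 1 - 2 * \<tau>" by auto
    then have "1 - 3 * \<tau> \<le> pp (f x)" by (auto simp: pp_def)
    then have "(1 - 3 * \<tau>) ^ 3 \<le> pp (f x) ^ 3" using \<tau> by (intro power_mono) auto
    moreover have "1 - 9 * \<tau> \<le> (1 - 3 * \<tau>) ^ 3"
      using Bernoulli_inequality[of "- (3 * \<tau>)" 3] \<tau> by simp
    \<comment> \<open>The factor 9 is 3 from Bernoulli's inequality times 3: the level \<open>1 - \<tau>\<close> of \<open>u\<close>, the
      approximation error and the shift in \<open>pp\<close> cost at most \<open>\<tau>\<close> each.\<close>
    ultimately have "1 - pp (f x) ^ 3 \<le> 9 * \<tau>" by linarith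
    then have "ln (1 - pp (f x) ^ 3) \<le> ln (9 * \<tau>)" using pos[OF f1, of x] \<tau> by (subst ln_le_cancel_iff) auto
    moreover have "ln (9 * \<tau>) < 0" using \<tau> by (subst ln_less_zero_iff) auto
    ultimately have "- ln (9 * \<tau>) \<le> w x" "0 \<le> - ln (9 * \<tau>)" by (auto simp: w_def H_def)
    then have "(- ln (9 * \<tau>))\<^sup>2 \<le> (w x)\<^sup>2" by (intro power_mono) auto
    then show ?thesis by simp
  qed
  have "(ln (9 * \<tau>))\<^sup>2 * excess (1 - \<tau>) (2 * s)
     = (\<integral> x. (ln (9 * \<tau>))\<^sup>2 * ((max 0 (u x - (1 - \<tau>))) ^ 4 * indicat_real (ball Q (2 * s)) x) \<partial>lborel)"
    by (simp add: excess_def)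
  also have "\<dots> \<le> (\<integral> x. \<tau> ^ 4 * ((w x)\<^sup>2 * indicat_real (ball Q (2 * s)) x) \<partial>lborel)"
  proof (rule integral_mono)
    fix x
    show "(ln (9 * \<tau>))\<^sup>2 * ((max 0 (u x - (1 - \<tau>))) ^ 4 * indicat_real (ball Q (2 * s)) x)
      \<le> \<tau> ^ 4 * ((w x)\<^sup>2 * indicat_real (ball Q (2 * s)) x)"
    proof (cases "x \<in> ball Q (2 * s) \<and> u x > 1 - \<tau>")
      case True
      have "max 0 (u x - (1 - \<tau>)) \<le> \<tau>" using u_le[of x] \<tau> by (auto simp: abs_le_iff)
      then have "(max 0 (u x - (1 - \<tau>))) ^ 4 \<le> \<tau> ^ 4" by (intro power_mono) auto
      then have "(ln (9 * \<tau>))\<^sup>2 * (max 0 (u x - (1 - \<tau>))) ^ 4 \<le> (w x)\<^sup>2 * \<tau> ^ 4"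
        using low[of x] True by (intro mult_mono) auto
      then show ?thesis using True by (simp add: mult.commute)
    next
      case False
      then show ?thesis by (auto simp: indicator_def max_def)
    qed
  qed (use iw2 excess_integrable[of "1 - \<tau>" "2 * s"] \<tau> in \<open>auto intro!: integrable_mult_right\<close>)
  also have "\<dots> = \<tau> ^ 4 * (\<integral> x. (w x)\<^sup>2 * indicat_real (ball Q (2 * s)) x \<partial>lborel)" by simp
  also have "\<dots> \<le> \<tau> ^ 4 * (Cp * (s\<^sup>2 * W))" using cp by (intro mult_left_mono) (auto simp: mult_ac)
  also have "\<dots> \<le> \<tau> ^ 4 * (Cp * (M * s ^ ?n))" using W(1) Cp by (intro mult_left_mono) auto
  also have "\<dots> = \<tau> ^ 4 * (log_const ?n C0 lam * s ^ ?n)"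
    by (simp add: log_const_def Cp_def M_def \<omega>_def)
  finally show ?thesis .
qed

end

text \<open>
  A value of \<open>\<tau>\<close> for which \<open>log_level_estimate\<close> provides the smallness that \<open>de_giorgi_iteration\<close> needs.
\<close>

definition decay_gap :: "nat \<Rightarrow> real \<Rightarrow> real \<Rightarrow> real" where
  "decay_gap n C0 lam = exp (- (sqrt (log_const n C0 lam / de_giorgi_threshold n lam) + 1)) / 9"

lemma log_const_pos: "C0 > 0 \<Longrightarrow> log_const n C0 lam > 0"
  unfolding log_const_def cap_poincare_const_def
  by (intro mult_pos_pos add_pos_nonneg divide_pos_pos add_nonneg_pos) auto

lemma decay_gap_bounds: "decay_gap n C0 lam > 0" "C0 > 0 \<Longrightarrow> decay_gap n C0 lam < 1 / 9"
proof -
  show "decay_gap n C0 lam > 0" by (simp add: decay_gap_def)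
  assume "C0 > 0"
  then have "log_const n C0 lam / de_giorgi_threshold n lam \<ge> 0"
    using log_const_pos[of C0 n lam] de_giorgi_threshold_pos[of n lam] by (intro divide_nonneg_nonneg) auto
  then have "- (sqrt (log_const n C0 lam / de_giorgi_threshold n lam) + 1) < 0"
    using real_sqrt_ge_zero by (smt (verit))
  then show "decay_gap n C0 lam < 1 / 9" by (simp add: decay_gap_def)
qed

context dirichlet_solution
begin

theorem oscillation_decay:
  assumes s: "s > 0" "3 * s < r" and C0: "C0 > 0" and n: "CARD('n) \<ge> 2"
    and cap: "ennreal (C0 * s ^ (CARD('n) - 2)) \<le> cap2 (ball Q s \<inter> - \<Omega>)" and x: "x \<in> ball Q s"
  shows "u x \<le> 1 - decay_gap CARD('n) C0 lam / 2"
proof -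
  let ?n = "CARD('n)"
  define \<tau> where "\<tau> = decay_gap ?n C0 lam"
  have \<tau>: "0 < \<tau>" "\<tau> < 1 / 9" using decay_gap_bounds C0 by (auto simp: \<tau>_def)
  define X where "X = log_const ?n C0 lam"
  define \<nu> where "\<nu> = de_giorgi_threshold ?n lam"
  have X: "X > 0" and \<nu>: "\<nu> > 0" by (simp_all add: X_def \<nu>_def log_const_pos[OF C0] de_giorgi_threshold_pos)
  have "ln (9 * \<tau>) = - (sqrt (X / \<nu>) + 1)" by (simp add: \<tau>_def decay_gap_def X_def \<nu>_def)
  then have "(ln (9 * \<tau>))\<^sup>2 = (sqrt (X / \<nu>) + 1)\<^sup>2" by (simp only: power2_minus)
  moreover have "(sqrt (X / \<nu>) + 1)\<^sup>2 \<ge> (sqrt (X / \<nu>))\<^sup>2" using X \<nu> by (intro power_mono) auto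
  ultimately have ln2: "X / \<nu> \<le> (ln (9 * \<tau>))\<^sup>2" using X \<nu> by simp
  have "X / \<nu> * excess (1 - \<tau>) (2 * s) \<le> (ln (9 * \<tau>))\<^sup>2 * excess (1 - \<tau>) (2 * s)"
    by (intro mult_right_mono ln2 excess_nonneg)
  also have "\<dots> \<le> \<tau> ^ 4 * (X * s ^ ?n)" unfolding X_def
    by (rule log_level_estimate[OF s \<tau> C0 n cap])
  finally have "X * excess (1 - \<tau>) (2 * s) \<le> X * (\<nu> * \<tau> ^ 4 * s ^ ?n)"
    using \<nu> by (simp add: field_simps)
  then have "excess (1 - \<tau>) (2 * s) \<le> \<nu> * \<tau> ^ 4 * s ^ ?n" using X by (subst (asm) mult_le_cancel_left_pos) auto
  then show ?thesis
    unfolding \<tau>_def[symmetric] by (intro de_giorgi_iteration[of s]) (use s \<tau> x in \<open>auto simp: \<nu>_def\<close>)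
qed

end

section \<open>From weak solutions to Borel data\<close>

lemma borel_measurable_vecI:
  fixes f :: "'a \<Rightarrow> real^'n"
  assumes "\<And>i. (\<lambda>x. f x $ i) \<in> borel_measurable M"
  shows "f \<in> borel_measurable M"
proof (subst borel_measurable_euclidean_space, intro ballI)
  fix b :: "real^'n" assume "b \<in> Basis"
  then obtain i where "b = axis i 1" by (auto simp: Basis_vec_def)
  then show "(\<lambda>x. f x \<bullet> b) \<in> borel_measurable M" using assms[of i] by (simp add: inner_axis)
qed

lemma borel_representative:
  fixes g :: "real^'n \<Rightarrow> real^'n"
  assumes "g \<in> borel_measurable lebesgue"
  obtains g' where "g' \<in> borel_measurable borel" "AE x in lborel. g x = g' x"
proof -
  have "\<exists>k. k \<in> borel_measurable lborel \<and> (AE x in lborel. g x $ i = k x)" for i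
  proof -
    have "(\<lambda>x. g x $ i) \<in> borel_measurable lebesgue"
      by (rule measurable_compose[OF assms]) (intro borel_measurable_continuous_onI continuous_intros)
    from completion_ex_borel_measurable_real[OF this] show ?thesis by blast
  qed
  then have "\<forall>i. \<exists>k. k \<in> borel_measurable lborel \<and> (AE x in lborel. g x $ i = k x)" by blast
  from choice[OF this] obtain k where k: "\<forall>i. k i \<in> borel_measurable lborel \<and> (AE x in lborel. g x $ i = k i x)" ..
  show thesis
  proof (rule that[of "\<lambda>x. \<chi> i. k i x"])
    show "(\<lambda>x. \<chi> i. k i x) \<in> borel_measurable borel"
      by (rule borel_measurable_vecI) (use k in auto)
    have "AE x in lborel. \<forall>i\<in>UNIV. g x $ i = k i x"
      by (rule AE_finite_allI) (use k in auto)
    then show "AE x in lborel. g x = (\<chi> i. k i x)"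
      by eventually_elim (simp add: vec_eq_iff)
  qed
qed

lemma lebesgue_on_transfer:
  fixes h k :: "real^'n \<Rightarrow> real"
  assumes U: "U \<in> sets lebesgue" and k: "k \<in> borel_measurable borel"
    and ae: "AE x in lborel. k x = (if x \<in> U then h x else 0)"
  shows "integral\<^sup>L (lebesgue_on U) h = integral\<^sup>L lborel k"
    "integrable (lebesgue_on U) h \<longleftrightarrow> integrable lborel k"
proof -
  have kl: "k \<in> borel_measurable lebesgue" using k by (auto intro: measurable_completion)
  have ae': "AE x in lebesgue. k x = indicator U x *\<^sub>R h x"
  proof (rule AE_completion)
    show "AE x in lborel. k x = indicator U x *\<^sub>R h x"
      using ae by eventually_elim (simp add: indicator_def)
  qed
  have hl: "(\<lambda>x. indicator U x *\<^sub>R h x) \<in> borel_measurable lebesgue"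
    by (rule borel_measurable_AE[OF kl ae'])
  have Us: "U \<inter> space lebesgue \<in> sets lebesgue" using U by simp
  show "integral\<^sup>L (lebesgue_on U) h = integral\<^sup>L lborel k"
    using integral_restrict_space[OF Us, of h] integral_cong_AE[OF kl hl ae'] integral_completion[of k lborel] k by simp
  show "integrable (lebesgue_on U) h \<longleftrightarrow> integrable lborel k"
    using integrable_restrict_space[OF Us, of h] integrable_cong_AE[OF kl hl ae'] integrable_completion[of k lborel] k by simp
qed

text \<open>
  The data of a weak solution are Lebesgue measurable functions on \<open>U\<close>. Extending them by 0 and
  changing them on a null set gives Borel functions on the whole space with the same integrals,
  as Fubini's theorem for \<open>lborel\<close> requires. The last property restates ellipticity and the bound on
  the matrix in the form used by \<open>dirichlet_solution\<close>; it follows from \<open>F = A *v p - A *v (p - g)\<close>.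
\<close>

lemma weak_solution_borel:
  fixes \<Omega> U :: "(real^'n) set"
  assumes U: "open U" "bounded U" "U \<subseteq> \<Omega>" and A: "elliptic_matrix ell \<Omega> A" and sol: "weak_solution A U u"
    and u': "u' \<in> borel_measurable borel" "\<And>x. u' x = (if x \<in> U then u x else 0)"
  obtains g F :: "real^'n \<Rightarrow> real^'n" where "g \<in> borel_measurable borel"
    "(\<integral>\<^sup>+ x. ennreal ((norm (g x))\<^sup>2) \<partial>lborel) < \<infinity>" "integrable lborel F"
    "\<And>\<phi> i. \<phi> \<in> test_functions U \<Longrightarrow> (\<integral> x. u' x * gradient \<phi> x $ i \<partial>lborel) = - (\<integral> x. g x $ i * \<phi> x \<partial>lborel)"
    "\<And>\<phi>. \<phi> \<in> test_functions U \<Longrightarrow> (\<integral> x. F x \<bullet> gradient \<phi> x \<partial>lborel) = 0"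
    "AE x in lborel. x \<in> U \<longrightarrow> (\<forall>p \<xi>. (norm p)\<^sup>2 / ell - ell * norm (p - g x) * norm p \<le> F x \<bullet> p \<and>
        \<bar>F x \<bullet> \<xi>\<bar> \<le> ell * (norm p + norm (p - g x)) * norm \<xi>)"
proof -
  have Ul: "U \<in> sets lebesgue" using U(1) by (simp add: borel_open)
  have Ub: "U \<in> sets borel" using U(1) by simp
  have ell: "ell > 0" using A by (simp add: elliptic_matrix_def)
  obtain G where G: "weak_gradient U u G"
    and eq: "\<And>\<phi>. \<phi> \<in> test_functions U \<Longrightarrow> integral\<^sup>L (lebesgue_on U) (\<lambda>x. (A x *v G x) \<bullet> gradient \<phi> x) = 0"
    using sol unfolding weak_solution_def by blast
  have Gm: "G \<in> borel_measurable (lebesgue_on U)" and G2: "integrable (lebesgue_on U) (\<lambda>x. (norm (G x))\<^sup>2)"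
    using G by (auto simp: weak_gradient_def L2_on_def)
  have Am: "A \<in> borel_measurable (lebesgue_on U)"
    using A U(3) unfolding elliptic_matrix_def by (auto intro: measurable_restrict_mono)
  have AGm: "(\<lambda>x. A x *v G x) \<in> borel_measurable (lebesgue_on U)"
  proof (rule borel_measurable_continuous_Pair[OF Am Gm])
    show "continuous_on UNIV (\<lambda>x. fst x *v (snd x :: real^'n) :: real^'n)"
      unfolding matrix_vector_mult_def by (intro continuous_on_vec_lambda continuous_intros)
  qed
  have "(\<lambda>x. if x \<in> U then G x else 0) \<in> borel_measurable lebesgue"
    using Gm by (simp add: borel_measurable_if[OF Ul])
  then obtain g where g: "g \<in> borel_measurable borel" and gae: "AE x in lborel. (if x \<in> U then G x else 0) = g x"
    by (rule borel_representative)
  have "(\<lambda>x. if x \<in> U then A x *v G x else 0) \<in> borel_measurable lebesgue"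
    using AGm by (simp add: borel_measurable_if[OF Ul])
  then obtain F where F: "F \<in> borel_measurable borel" and Fae: "AE x in lborel. (if x \<in> U then A x *v G x else 0) = F x"
    by (rule borel_representative)
  note [measurable] = g F u'(1)
  have gi: "(\<lambda>x. g x $ i) \<in> borel_measurable borel" for i
    by (rule measurable_compose[OF g]) (intro borel_measurable_continuous_onI continuous_intros)
  have tC: "C1 \<phi>" if "\<phi> \<in> test_functions U" for \<phi>
    using that unfolding test_functions_def C1_iff_Ck by blast
  have tm: "\<phi> \<in> borel_measurable borel" "gradient \<phi> \<in> borel_measurable borel" "(\<lambda>x. gradient \<phi> x $ i) \<in> borel_measurable borel"
    if "\<phi> \<in> test_functions U" for \<phi> i
  proof -
    show "\<phi> \<in> borel_measurable borel" "gradient \<phi> \<in> borel_measurable borel" using C1_borel[OF tC[OF that]] by auto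
    show "(\<lambda>x. gradient \<phi> x $ i) \<in> borel_measurable borel"
      by (rule measurable_compose[OF C1_borel(2)[OF tC[OF that]]]) (intro borel_measurable_continuous_onI continuous_intros)
  qed
  have g2: "integrable lborel (\<lambda>x. (norm (g x))\<^sup>2)"
  proof (subst lebesgue_on_transfer(2)[OF Ul, symmetric])
    show "AE x in lborel. (norm (g x))\<^sup>2 = (if x \<in> U then (norm (G x))\<^sup>2 else 0)"
      using gae by eventually_elim (auto split: if_splits simp: eq_commute)
  qed (use G2 in auto)
  show thesis
  proof (rule that)
    show "g \<in> borel_measurable borel" by (rule g)
    show "(\<integral>\<^sup>+ x. ennreal ((norm (g x))\<^sup>2) \<partial>lborel) < \<infinity>"
      using g2 by (simp add: integrable_iff_bounded)
    show "integrable lborel F"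
    proof (rule Bochner_Integration.integrable_bound)
      have "integrable lborel (indicat_real U)"
        using emeasure_bounded_finite[OF U(2)] Ub by (simp add: integrable_indicator_iff)
      then show "integrable lborel (\<lambda>x. ell * ((norm (g x))\<^sup>2 + indicat_real U x))" using g2 by simp
      show "AE x in lborel. norm (F x) \<le> norm (ell * ((norm (g x))\<^sup>2 + indicat_real U x))"
        using gae Fae
      proof eventually_elim
        case (elim x)
        show ?case
        proof (cases "x \<in> U")
          case True
          have "norm (A x *v G x) \<le> ell * norm (G x)"
            using A True U(3) unfolding elliptic_matrix_def by blast
          then have "norm (F x) \<le> ell * norm (g x)"
            using elim True by simp
          also have "\<dots> \<le> ell * ((norm (g x))\<^sup>2 + 1)"
          proof (rule mult_left_mono)
            have "0 \<le> (norm (g x) - 1)\<^sup>2 + norm (g x)" by simp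
            then show "norm (g x) \<le> (norm (g x))\<^sup>2 + 1" by (simp add: power2_eq_square algebra_simps)
          qed (use ell in simp)
          finally show ?thesis using True ell by simp
        next
          case False
          then have "F x = 0" using elim by simp
          then show ?thesis by simp
        qed
      qed
    qed (use F in simp)
  next
    fix \<phi> i assume \<phi>: "\<phi> \<in> test_functions U"
    note [measurable] = tm[OF \<phi>] gi
    have "(\<integral> x. u' x * gradient \<phi> x $ i \<partial>lborel) = integral\<^sup>L (lebesgue_on U) (\<lambda>x. u x * gradient \<phi> x $ i)"
    proof (rule lebesgue_on_transfer(1)[OF Ul, symmetric])
      show "AE x in lborel. u' x * gradient \<phi> x $ i = (if x \<in> U then u x * gradient \<phi> x $ i else 0)"
        by (intro AE_I2) (simp add: u'(2))
    qed measurable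
    also have "\<dots> = - integral\<^sup>L (lebesgue_on U) (\<lambda>x. G x $ i * \<phi> x)"
      using G \<phi> unfolding weak_gradient_def by blast
    also have "integral\<^sup>L (lebesgue_on U) (\<lambda>x. G x $ i * \<phi> x) = (\<integral> x. g x $ i * \<phi> x \<partial>lborel)"
    proof (rule lebesgue_on_transfer(1)[OF Ul])
      show "AE x in lborel. g x $ i * \<phi> x = (if x \<in> U then G x $ i * \<phi> x else 0)"
        using gae by eventually_elim (auto split: if_splits simp: eq_commute)
    qed measurable
    finally show "(\<integral> x. u' x * gradient \<phi> x $ i \<partial>lborel) = - (\<integral> x. g x $ i * \<phi> x \<partial>lborel)" .
  next
    fix \<phi> assume \<phi>: "\<phi> \<in> test_functions U"
    note [measurable] = tm[OF \<phi>]
    have "integral\<^sup>L (lebesgue_on U) (\<lambda>x. (A x *v G x) \<bullet> gradient \<phi> x) = (\<integral> x. F x \<bullet> gradient \<phi> x \<partial>lborel)"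
    proof (rule lebesgue_on_transfer(1)[OF Ul])
      show "AE x in lborel. F x \<bullet> gradient \<phi> x = (if x \<in> U then (A x *v G x) \<bullet> gradient \<phi> x else 0)"
        using Fae by eventually_elim (auto split: if_splits simp: eq_commute)
    qed measurable
    with eq[OF \<phi>] show "(\<integral> x. F x \<bullet> gradient \<phi> x \<partial>lborel) = 0" by simp
  next
    show "AE x in lborel. x \<in> U \<longrightarrow> (\<forall>p \<xi>. (norm p)\<^sup>2 / ell - ell * norm (p - g x) * norm p \<le> F x \<bullet> p \<and>
        \<bar>F x \<bullet> \<xi>\<bar> \<le> ell * (norm p + norm (p - g x)) * norm \<xi>)"
      using gae Fae
    proof eventually_elim
      case (elim x)
      show ?case
      proof (intro impI allI conjI)
        fix p \<xi> :: "real^'n" assume x: "x \<in> U"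
        have Fx: "F x = A x *v g x" using elim x by auto
        have x\<Omega>: "x \<in> \<Omega>" using x U(3) by blast
        have E1: "inverse ell * (norm p)\<^sup>2 \<le> (A x *v p) \<bullet> p" and E2: "\<And>v. norm (A x *v v) \<le> ell * norm v"
          using A x\<Omega> unfolding elliptic_matrix_def by blast+
        have "F x \<bullet> p = (A x *v p) \<bullet> p - (A x *v (p - g x)) \<bullet> p"
          by (simp add: Fx matrix_vector_mult_diff_distrib inner_diff_left)
        moreover have "(A x *v (p - g x)) \<bullet> p \<le> ell * norm (p - g x) * norm p"
        proof -
          have "(A x *v (p - g x)) \<bullet> p \<le> norm (A x *v (p - g x)) * norm p" by (rule norm_cauchy_schwarz)
          also have "\<dots> \<le> (ell * norm (p - g x)) * norm p" by (intro mult_right_mono E2) simp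
          finally show ?thesis .
        qed
        ultimately show "(norm p)\<^sup>2 / ell - ell * norm (p - g x) * norm p \<le> F x \<bullet> p"
          using E1 by (simp add: divide_inverse mult.commute)
        have "\<bar>F x \<bullet> \<xi>\<bar> \<le> norm (F x) * norm \<xi>" by (rule Cauchy_Schwarz_ineq2)
        also have "\<dots> \<le> (ell * norm (g x)) * norm \<xi>" unfolding Fx by (intro mult_right_mono E2) simp
        also have "\<dots> \<le> ell * (norm p + norm (p - g x)) * norm \<xi>"
        proof (intro mult_right_mono mult_left_mono)
          show "norm (g x) \<le> norm p + norm (p - g x)"
            using norm_triangle_ineq4[of p "p - g x"] by simp
        qed (use ell in auto)
        finally show "\<bar>F x \<bullet> \<xi>\<bar> \<le> ell * (norm p + norm (p - g x)) * norm \<xi>" .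
      qed
    qed
  qed
qed

lemma zero_extension_continuous:
  fixes \<Omega> :: "(real^'n) set" and u :: "real^'n \<Rightarrow> real"
  assumes \<Omega>: "open \<Omega>" and c: "continuous_on (closure (ball Q r \<inter> \<Omega>)) u"
    and z: "\<And>x. x \<in> ball Q r \<inter> frontier \<Omega> \<Longrightarrow> u x = 0"
  shows "continuous_on (ball Q r) (\<lambda>x. if x \<in> \<Omega> then u x else 0)"
proof -
  let ?S = "ball Q r \<inter> closure \<Omega>" and ?T = "ball Q r \<inter> - \<Omega>"
  have un: "?S \<union> ?T = ball Q r" using closure_subset[of \<Omega>] by blast
  have "continuous_on (?S \<union> ?T) (\<lambda>x. if x \<in> \<Omega> then u x else 0)"
  proof (rule continuous_on_cases_local)
    show "closedin (top_of_set (?S \<union> ?T)) ?S"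
      unfolding un by (intro closedin_closed_Int closed_closure)
    show "closedin (top_of_set (?S \<union> ?T)) ?T"
      unfolding un by (intro closedin_closed_Int) (use \<Omega> in \<open>simp add: closed_def\<close>)
    show "continuous_on ?S u"
      by (rule continuous_on_subset[OF c]) (rule open_Int_closure_subset[OF open_ball])
    fix x assume x: "x \<in> ?S \<and> x \<notin> \<Omega> \<or> x \<in> ?T \<and> x \<in> \<Omega>"
    then have "x \<in> ball Q r \<inter> frontier \<Omega>" using \<Omega> by (auto simp: frontier_def interior_open)
    then show "u x = 0" by (rule z)
  qed auto
  then show ?thesis by (simp only: un)
qed

section \<open>Decay at the boundary over all scales\<close>

text \<open>
  In the step, both \<open>u / N\<close> and \<open>- u / N\<close> satisfy the assumptions of \<open>dirichlet_solution\<close> on the ball of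
  radius \<open>\<rho> / 4 ^ k\<close>, where \<open>N\<close> is the bound from the induction hypothesis.
\<close>

theorem boundary_decay:
  fixes \<Omega> :: "(real^'n) set" and C0 ell :: real
  assumes n: "CARD('n) \<ge> 2" and C0: "C0 > 0" and \<Omega>: "open \<Omega>" and A: "elliptic_matrix ell \<Omega> A"
    and cdc: "capacity_density \<Omega> C0 R" and Q: "Q \<in> frontier \<Omega>" and \<rho>: "0 < \<rho>" "\<rho> \<le> 3 * R / 4"
    and c: "continuous_on (closure (ball Q (3 * \<rho>) \<inter> \<Omega>)) u" and sol: "weak_solution A (ball Q (3 * \<rho>) \<inter> \<Omega>) u"
    and z: "\<And>x. x \<in> ball Q (3 * \<rho>) \<inter> frontier \<Omega> \<Longrightarrow> u x = 0"
    and M: "\<And>x. x \<in> ball Q (3 * \<rho>) \<inter> \<Omega> \<Longrightarrow> \<bar>u x\<bar> \<le> M"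
  shows "x \<in> ball Q (\<rho> / 4 ^ k) \<inter> \<Omega> \<Longrightarrow> \<bar>u x\<bar> \<le> (1 - decay_gap CARD('n) C0 ell / 2) ^ k * M"
proof (induction k arbitrary: x)
  case 0
  then show ?case using M[of x] \<rho> by auto
next
  case (Suc k)
  define t where "t = \<rho> / 4 ^ k"
  have "(1::real) \<le> 4 ^ k" by simp
  then have t: "t > 0" "t \<le> \<rho>" using \<rho> by (auto simp: t_def divide_le_eq mult_le_cancel_left1)
  define \<theta> where "\<theta> = 1 - decay_gap CARD('n) C0 ell / 2"
  have \<theta>: "\<theta> > 0" using decay_gap_bounds(2)[OF C0, of "CARD('n)" ell] by (simp add: \<theta>_def)
  define N where "N = \<theta> ^ k * M"
  have IH: "\<bar>u y\<bar> \<le> N" if "y \<in> ball Q t \<inter> \<Omega>" for y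
    using Suc.IH[of y] that by (simp add: t_def \<theta>_def N_def)
  let ?U = "ball Q (3 * \<rho>) \<inter> \<Omega>" and ?V = "ball Q t \<inter> \<Omega>"
  have VU: "?V \<subseteq> ?U" using t \<rho> by auto
  have xt: "x \<in> ball Q (t / 4) \<inter> \<Omega>" using Suc.prems by (simp add: t_def mult.commute)
  have xV: "x \<in> ?V" using xt t by auto
  have bound: "\<sigma> * u x / N \<le> \<theta>" if N: "N > 0" and \<sigma>: "\<sigma> = 1 \<or> \<sigma> = -1" for \<sigma>
  proof -
    define u' where "u' = (\<lambda>y. if y \<in> ?U then u y else 0)"
    have cont: "continuous_on (ball Q (3 * \<rho>)) (\<lambda>y. if y \<in> \<Omega> then u y else 0)"
      by (rule zero_extension_continuous[OF \<Omega> c z])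
    have u'if: "u' = (\<lambda>y. if y \<in> ball Q (3 * \<rho>) then (if y \<in> \<Omega> then u y else 0) else 0)" by (auto simp: u'_def)
    have u'm: "u' \<in> borel_measurable borel" unfolding u'if
      by (rule borel_measurable_continuous_on_if[OF _ cont]) auto
    have opU: "open ?U" "bounded ?U" "?U \<subseteq> \<Omega>" using \<Omega> by (auto intro: bounded_subset[OF bounded_ball])
    obtain g F where g: "g \<in> borel_measurable borel" and g2: "(\<integral>\<^sup>+ x. ennreal ((norm (g x))\<^sup>2) \<partial>lborel) < \<infinity>"
      and F: "integrable lborel F"
      and wg: "\<And>\<phi> i. \<phi> \<in> test_functions ?U \<Longrightarrow> (\<integral> x. u' x * gradient \<phi> x $ i \<partial>lborel) = - (\<integral> x. g x $ i * \<phi> x \<partial>lborel)"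
      and we: "\<And>\<phi>. \<phi> \<in> test_functions ?U \<Longrightarrow> (\<integral> x. F x \<bullet> gradient \<phi> x \<partial>lborel) = 0"
      and el: "AE x in lborel. x \<in> ?U \<longrightarrow> (\<forall>p \<xi>. (norm p)\<^sup>2 / ell - ell * norm (p - g x) * norm p \<le> F x \<bullet> p \<and>
        \<bar>F x \<bullet> \<xi>\<bar> \<le> ell * (norm p + norm (p - g x)) * norm \<xi>)"
      by (rule weak_solution_borel[OF opU A sol u'm]) (auto simp: u'_def)
    note [measurable] = g u'm
    have [measurable]: "?V \<in> sets borel" using \<Omega> by auto
    \<comment> \<open>The coefficient of \<open>u\<close>: both signs are needed to bound the absolute value.\<close>
    define a where "a = \<sigma> / N"
    have a: "\<bar>a\<bar> = 1 / N" "a \<noteq> 0" using N \<sigma> by (auto simp: a_def)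
    define v where "v = (\<lambda>y. if y \<in> ?V then a * u' y else 0)"
    define gv where "gv = (\<lambda>y. if y \<in> ?V then a *\<^sub>R g y else 0)"
    define Fv where "Fv = (\<lambda>y. a *\<^sub>R F y)"
    have tVU: "\<phi> \<in> test_functions ?U" if "\<phi> \<in> test_functions ?V" for \<phi>
      using that VU unfolding test_functions_def by auto
    have off: "\<phi> y = 0" "gradient \<phi> y = 0" if "\<phi> \<in> test_functions ?V" "y \<notin> ?V" for \<phi> y
    proof -
      have "y \<notin> closure {x. \<phi> x \<noteq> 0}" using that unfolding test_functions_def by auto
      then show "\<phi> y = 0" "gradient \<phi> y = 0"
        using closure_subset[of "{x. \<phi> x \<noteq> 0}"] gradient_eq_0_off_support[of y \<phi>] by auto
    qed
    interpret dirichlet_solution Q t ell \<Omega> v gv Fv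
    proof
      show "0 < t" by (rule t)
      show "0 < ell" using A by (simp add: elliptic_matrix_def)
      show "open \<Omega>" by (rule \<Omega>)
      show "v \<in> borel_measurable borel" unfolding v_def by measurable
      show "gv \<in> borel_measurable borel" unfolding gv_def by measurable
      show "integrable lborel Fv" unfolding Fv_def using F by simp
      have "continuous_on (ball Q t) (\<lambda>y. a * (if y \<in> \<Omega> then u y else 0))"
        by (intro continuous_intros continuous_on_subset[OF cont]) (use t \<rho> in auto)
      then show "continuous_on (ball Q t) v"
        by (rule continuous_on_eq) (use VU in \<open>auto simp: v_def u'_def\<close>)
      show "v y = 0" "gv y = 0" if "y \<notin> ball Q t \<inter> \<Omega>" for y using that by (auto simp: v_def gv_def)
      show "\<bar>v y\<bar> \<le> 1" for y
      proof (cases "y \<in> ?V")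
        case True
        then have "y \<in> ?U" using VU by blast
        then show ?thesis using IH[OF True] True N by (simp add: v_def u'_def abs_mult a)
      next
        case False
        then have "v y = 0" unfolding v_def by (rule if_not_P)
        then show ?thesis by simp
      qed
      show "(\<integral>\<^sup>+ x. ennreal ((norm (gv x))\<^sup>2) \<partial>lborel) < \<infinity>"
      proof -
        have "(\<integral>\<^sup>+ x. ennreal ((norm (gv x))\<^sup>2) \<partial>lborel) \<le> (\<integral>\<^sup>+ x. ennreal (a\<^sup>2) * ennreal ((norm (g x))\<^sup>2) \<partial>lborel)"
          by (intro nn_integral_mono) (auto simp: gv_def power_mult_distrib ennreal_mult')
        also have "\<dots> = ennreal (a\<^sup>2) * (\<integral>\<^sup>+ x. ennreal ((norm (g x))\<^sup>2) \<partial>lborel)" by (rule nn_integral_cmult) measurable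
        also have "\<dots> < \<infinity>" using g2 by (simp add: ennreal_mult_less_top)
        finally show ?thesis .
      qed
      fix \<phi> assume \<phi>: "\<phi> \<in> test_functions ?V"
      show "(\<integral> x. v x * gradient \<phi> x $ i \<partial>lborel) = - (\<integral> x. gv x $ i * \<phi> x \<partial>lborel)" for i
      proof -
        have "(\<integral> x. v x * gradient \<phi> x $ i \<partial>lborel) = (\<integral> x. a * (u' x * gradient \<phi> x $ i) \<partial>lborel)"
          by (intro Bochner_Integration.integral_cong) (auto simp: v_def off[OF \<phi>])
        also have "\<dots> = - (\<integral> x. a * (g x $ i * \<phi> x) \<partial>lborel)" using wg[OF tVU[OF \<phi>], of i] by simp
        also have "(\<integral> x. a * (g x $ i * \<phi> x) \<partial>lborel) = (\<integral> x. gv x $ i * \<phi> x \<partial>lborel)"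
          by (intro Bochner_Integration.integral_cong) (auto simp: gv_def off[OF \<phi>])
        finally show ?thesis .
      qed
      show "(\<integral> x. Fv x \<bullet> gradient \<phi> x \<partial>lborel) = 0"
        using we[OF tVU[OF \<phi>]] by (simp add: Fv_def)
    next
      show "AE x in lborel. x \<in> ?V \<longrightarrow> (\<forall>p \<xi>. (norm p)\<^sup>2 / ell - ell * norm (p - gv x) * norm p \<le> Fv x \<bullet> p \<and>
        \<bar>Fv x \<bullet> \<xi>\<bar> \<le> ell * (norm p + norm (p - gv x)) * norm \<xi>)"
        using el
      proof eventually_elim
        case (elim x)
        show ?case
        proof (intro impI allI)
          fix p \<xi> :: "real^'n" assume x: "x \<in> ?V"
          have gx: "gv x = a *\<^sub>R g x" using x by (simp add: gv_def)
          define b where "b = \<bar>a\<bar>"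
          have b: "b > 0" using a(2) by (simp add: b_def)
          let ?q = "(1 / a) *\<^sub>R p"
          have sc: "norm (?q - g x) = norm (p - gv x) / b"
          proof -
            have "?q - g x = (1 / a) *\<^sub>R (p - gv x)" using a by (simp add: gx scaleR_diff_right)
            then show ?thesis by (simp add: b_def)
          qed
          have sp: "norm ?q = norm p / b" by (simp add: b_def)
          have e: "(norm ?q)\<^sup>2 / ell - ell * norm (?q - g x) * norm ?q \<le> F x \<bullet> ?q"
            "\<bar>F x \<bullet> \<xi>\<bar> \<le> ell * (norm ?q + norm (?q - g x)) * norm \<xi>"
            using elim x VU by blast+
          have "b\<^sup>2 * ((norm ?q)\<^sup>2 / ell - ell * norm (?q - g x) * norm ?q) \<le> b\<^sup>2 * (F x \<bullet> ?q)"
            by (intro mult_left_mono e) simp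
          moreover have "b\<^sup>2 * ((norm ?q)\<^sup>2 / ell - ell * norm (?q - g x) * norm ?q) = (norm p)\<^sup>2 / ell - ell * norm (p - gv x) * norm p"
            using b unfolding sc sp by (simp add: power2_eq_square field_simps)
          moreover have "b\<^sup>2 * (F x \<bullet> ?q) = Fv x \<bullet> p"
            using a(2) by (simp add: b_def Fv_def power2_eq_square)
          moreover have "b * \<bar>F x \<bullet> \<xi>\<bar> \<le> b * (ell * (norm ?q + norm (?q - g x)) * norm \<xi>)"
            using b by (intro mult_left_mono e) simp
          moreover have "b * (ell * (norm ?q + norm (?q - g x)) * norm \<xi>) = ell * (norm p + norm (p - gv x)) * norm \<xi>"
            using b unfolding sc sp by (simp add: field_simps)
          moreover have "b * \<bar>F x \<bullet> \<xi>\<bar> = \<bar>Fv x \<bullet> \<xi>\<bar>" by (simp add: b_def Fv_def abs_mult)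
          ultimately show "(norm p)\<^sup>2 / ell - ell * norm (p - gv x) * norm p \<le> Fv x \<bullet> p \<and>
            \<bar>Fv x \<bullet> \<xi>\<bar> \<le> ell * (norm p + norm (p - gv x)) * norm \<xi>" by (intro conjI) linarith+
        qed
      qed
    qed
    have tR: "0 < t / 4" "t / 4 < R" using t \<rho> by auto
    then have cap: "ennreal (C0 * (t / 4) ^ (CARD('n) - 2)) \<le> cap2 (ball Q (t / 4) \<inter> - \<Omega>)"
      using cdc Q unfolding capacity_density_def by blast
    have "v x \<le> \<theta>" unfolding \<theta>_def
      by (rule oscillation_decay[OF _ _ C0 n cap]) (use xt t in auto)
    moreover have "v x = \<sigma> * u x / N" using xV VU by (auto simp: v_def u'_def a_def)
    ultimately show ?thesis by simp
  qed
  have "\<bar>u x\<bar> \<le> \<theta> * N"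
  proof (cases "N > 0")
    case True
    from bound[OF True, of 1] bound[OF True, of "-1"] True show ?thesis by (auto simp: field_simps abs_le_iff)
  next
    case False
    have "\<bar>u x\<bar> \<le> N" by (rule IH[OF xV])
    with False have "u x = 0" "N = 0" by auto
    then show ?thesis by simp
  qed
  then show ?case by (simp add: N_def \<theta>_def)
qed

text \<open>
  The exponent is defined by \<open>(1 / 4) powr \<beta> = \<theta>\<close>. If \<open>k\<close> is the last index with \<open>d < (1 / 4) ^ k\<close>, then
  \<open>\<theta> ^ Suc k \<le> d powr \<beta>\<close>, and \<open>\<theta> \<ge> 1 / 2\<close> compares \<open>\<theta> ^ k\<close> with \<open>2 * \<theta> ^ Suc k\<close>.
\<close>

lemma geometric_to_power:
  fixes \<theta> d :: real
  assumes \<theta>: "1 / 2 \<le> \<theta>" "\<theta> < 1" and d: "0 < d" "d < 1" and M: "M \<ge> 0"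
    and le: "\<And>k. d < (1 / 4) ^ k \<Longrightarrow> v \<le> \<theta> ^ k * M"
  shows "v \<le> 2 * d powr (- ln \<theta> / ln 4) * M"
proof -
  define \<beta> where "\<beta> = - ln \<theta> / ln 4"
  have \<beta>: "\<beta> > 0" unfolding \<beta>_def using \<theta> by (intro divide_pos_pos) auto
  obtain m0 where "(1 / 4) ^ m0 < d" using real_arch_pow_inv[OF d(1), of "1 / 4"] by auto
  then have ex: "(1 / 4) ^ m0 \<le> d" by simp
  define m where "m = (LEAST m. (1 / 4) ^ m \<le> d)"
  have m: "(1 / 4) ^ m \<le> d" unfolding m_def by (rule LeastI[of "\<lambda>m. (1 / 4) ^ m \<le> d", OF ex])
  have "m \<noteq> 0" using m d by (cases m) auto
  then obtain k where k: "m = Suc k" by (cases m) auto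
  have "\<not> (1 / 4) ^ k \<le> d" using not_less_Least[of k "\<lambda>m. (1 / 4) ^ m \<le> d"] k by (simp add: m_def[symmetric])
  then have v: "v \<le> \<theta> ^ k * M" by (intro le) simp
  have q: "(1 / 4 :: real) powr \<beta> = \<theta>"
    using \<theta> by (simp add: powr_def \<beta>_def ln_div)
  have "\<theta> ^ Suc k = ((1 / 4) powr \<beta>) ^ Suc k" by (simp only: q)
  also have "\<dots> = ((1 / 4) ^ Suc k) powr \<beta>"
  proof -
    have "((1 / 4) powr \<beta>) ^ Suc k = ((1 / 4) powr \<beta>) powr real (Suc k)"
      by (rule powr_realpow[symmetric]) simp
    also have "\<dots> = ((1 / 4) powr real (Suc k)) powr \<beta>" by (simp only: powr_powr mult.commute)
    also have "(1 / 4) powr real (Suc k) = (1 / 4 :: real) ^ Suc k" by (rule powr_realpow) simp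
    finally show ?thesis .
  qed
  also have "\<dots> \<le> d powr \<beta>" using m k \<beta> by (intro powr_mono2) auto
  finally have "2 * \<theta> ^ Suc k \<le> 2 * d powr \<beta>" by simp
  moreover have "\<theta> ^ k \<le> 2 * \<theta> ^ Suc k" using \<theta> mult_right_mono[of 1 "2 * \<theta>" "\<theta> ^ k"] by simp
  ultimately have "\<theta> ^ k * M \<le> 2 * d powr \<beta> * M" using M by (intro mult_right_mono) auto
  with v show ?thesis by (simp add: \<beta>_def)
qed

theorem proposition3p4:
  fixes C0 ell :: real
  assumes "CARD('n::finite) \<ge> 3" and "C0 > 0" and "ell > 0"
  shows "\<exists>\<beta>::real. 0 < \<beta> \<and> \<beta> \<le> 1 \<and>
    (\<forall>(R::real) (\<Omega>::(real^'n) set) (A::real^'n \<Rightarrow> real^'n^'n).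
      open \<Omega> \<and> connected \<Omega> \<and> \<Omega> \<noteq> {} \<and> bounded \<Omega> \<and>
      capacity_density \<Omega> C0 R \<and> elliptic_matrix ell \<Omega> A \<longrightarrow>
      (\<forall>Q\<^sub>0 \<in> frontier \<Omega>. \<forall>\<rho>::real. 0 < \<rho> \<and> \<rho> \<le> min (diameter \<Omega> / 4) (3 * R / 4) \<longrightarrow>
        (\<forall>u::real^'n \<Rightarrow> real.
          u \<in> W12 (ball Q\<^sub>0 (3 * \<rho>) \<inter> \<Omega>) \<and>
          continuous_on (closure (ball Q\<^sub>0 (3 * \<rho>) \<inter> \<Omega>)) u \<and>
          weak_solution A (ball Q\<^sub>0 (3 * \<rho>) \<inter> \<Omega>) u \<and>
          (\<forall>X \<in> ball Q\<^sub>0 (3 * \<rho>) \<inter> frontier \<Omega>. u X = 0) \<longrightarrow>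
          (\<forall>X \<in> ball Q\<^sub>0 \<rho> \<inter> \<Omega>.
            \<bar>u X\<bar> \<le> 2 * (norm (X - Q\<^sub>0) / \<rho>) powr \<beta> *
              (SUP Y \<in> closure (ball Q\<^sub>0 (3 * \<rho>) \<inter> \<Omega>). \<bar>u Y\<bar>)))))"
proof -
  define \<theta> where "\<theta> = 1 - decay_gap CARD('n) C0 ell / 2"
  have \<theta>: "1 / 2 \<le> \<theta>" "\<theta> < 1"
    using decay_gap_bounds(1)[of "CARD('n)" C0 ell] decay_gap_bounds(2)[OF \<open>C0 > 0\<close>, of "CARD('n)" ell]
    by (auto simp: \<theta>_def)
  define \<beta> where "\<beta> = - ln \<theta> / ln 4"
  show ?thesis
  proof (intro exI[of _ \<beta>] conjI allI impI ballI)
    show "0 < \<beta>" unfolding \<beta>_def using \<theta> by (intro divide_pos_pos) auto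
    have "ln (1 / 4) \<le> ln \<theta>" using \<theta> by (subst ln_le_cancel_iff) auto
    then have "- ln \<theta> \<le> 1 * ln 4" by (simp add: ln_div)
    then show "\<beta> \<le> 1" unfolding \<beta>_def by (subst pos_divide_le_eq) auto
  next
    fix R :: real and \<Omega> :: "(real^'n) set" and A :: "real^'n \<Rightarrow> real^'n^'n"
      and Q\<^sub>0 :: "real^'n" and \<rho> :: real and u :: "real^'n \<Rightarrow> real" and X :: "real^'n"
    assume H: "open \<Omega> \<and> connected \<Omega> \<and> \<Omega> \<noteq> {} \<and> bounded \<Omega> \<and>
        capacity_density \<Omega> C0 R \<and> elliptic_matrix ell \<Omega> A"
      and Q: "Q\<^sub>0 \<in> frontier \<Omega>" and \<rho>: "0 < \<rho> \<and> \<rho> \<le> min (diameter \<Omega> / 4) (3 * R / 4)"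
      and u: "u \<in> W12 (ball Q\<^sub>0 (3 * \<rho>) \<inter> \<Omega>) \<and>
          continuous_on (closure (ball Q\<^sub>0 (3 * \<rho>) \<inter> \<Omega>)) u \<and>
          weak_solution A (ball Q\<^sub>0 (3 * \<rho>) \<inter> \<Omega>) u \<and>
          (\<forall>X \<in> ball Q\<^sub>0 (3 * \<rho>) \<inter> frontier \<Omega>. u X = 0)"
      and X: "X \<in> ball Q\<^sub>0 \<rho> \<inter> \<Omega>"
    let ?U = "ball Q\<^sub>0 (3 * \<rho>) \<inter> \<Omega>"
    define M where "M = (SUP Y \<in> closure ?U. \<bar>u Y\<bar>)"
    have comp: "compact (closure ?U)"
      unfolding compact_closure by (rule bounded_subset[OF bounded_ball]) auto
    have "compact ((\<lambda>Y. \<bar>u Y\<bar>) ` closure ?U)"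
      using u comp by (intro compact_continuous_image continuous_intros) auto
    then have "bdd_above ((\<lambda>Y. \<bar>u Y\<bar>) ` closure ?U)"
      by (intro bounded_imp_bdd_above compact_imp_bounded)
    then have MU: "\<bar>u Y\<bar> \<le> M" if "Y \<in> closure ?U" for Y
      unfolding M_def using that by (rule cSUP_upper[rotated])
    have MU': "\<bar>u Y\<bar> \<le> M" if "Y \<in> ?U" for Y using MU closure_subset[of ?U] that by blast
    have "X \<in> ?U" using X \<rho> by auto
    then have M0: "M \<ge> 0" using MU'[of X] by simp
    have \<Omega>: "open \<Omega>" using H by blast
    have "X \<noteq> Q\<^sub>0" using X Q \<Omega> by (auto simp: frontier_def interior_open)
    then have d: "0 < norm (X - Q\<^sub>0) / \<rho>" "norm (X - Q\<^sub>0) / \<rho> < 1"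
      using X \<rho> by (auto simp: dist_norm norm_minus_commute)
    have "\<bar>u X\<bar> \<le> 2 * (norm (X - Q\<^sub>0) / \<rho>) powr (- ln \<theta> / ln 4) * M"
    proof (rule geometric_to_power[OF \<theta> d M0])
      fix k assume "norm (X - Q\<^sub>0) / \<rho> < (1 / 4) ^ k"
      then have Xk: "X \<in> ball Q\<^sub>0 (\<rho> / 4 ^ k) \<inter> \<Omega>"
        using X \<rho> by (simp add: dist_norm norm_minus_commute power_one_over field_simps)
      have n: "CARD('n) \<ge> 2" using assms(1) by simp
      have \<rho>': "0 < \<rho>" "\<rho> \<le> 3 * R / 4" using \<rho> by auto
      have Acdc: "elliptic_matrix ell \<Omega> A" "capacity_density \<Omega> C0 R" using H by blast+
      have u': "continuous_on (closure ?U) u" "weak_solution A ?U u"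
        "\<And>x. x \<in> ball Q\<^sub>0 (3 * \<rho>) \<inter> frontier \<Omega> \<Longrightarrow> u x = 0" using u by blast+
      show "\<bar>u X\<bar> \<le> \<theta> ^ k * M" unfolding \<theta>_def
        by (rule boundary_decay[OF n \<open>C0 > 0\<close> \<Omega> Acdc Q \<rho>' u' MU' Xk])
    qed
    then show "\<bar>u X\<bar> \<le> 2 * (norm (X - Q\<^sub>0) / \<rho>) powr \<beta> * (SUP Y \<in> closure ?U. \<bar>u Y\<bar>)"
      by (simp only: \<beta>_def M_def)
  qed
qed

end
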